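(* (i) Every positive integer $n$ can be written as $n = x^2 + y^2 + T_z$ with $x,y,z\in\mathbb{Z}$ and $y$ odd (i.e. as a sum of a square, an odd square and a triangular number). Moreover, for a positive integer $m$, the triangular number $T_m$ can be written as $T_m = x^2+y^2+T_z$ with $x,y,z\in\mathbb{Z}$ and $x,y$ both odd if and only if $2m+1$ is not a prime congruent to $3$ modulo $4$. (ii) A positive integer $n$ cannot be written as $n = x^2 + T_y + T_z$ with $x,y,z\in\mathbb{Z}$ and $x$ odd if and only if $n = 2T_m$ for some positive integer $m$ such that $2m+1$ has no prime divisor congruent to $3$ modulo $4$.
   Context: For $x\in\mathbb{Z}$, the triangular number $T_x$ is $T_x = x(x+1)/2$. A square means $a^2$ with $a\in\mathbb{Z}$, an odd square means $a^2$ with $a$ an odd integer. *)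

theory Defs
  imports "HOL-Number_Theory.Number_Theory"
begin

(* The division is exact, since x * (x + 1) is even; x may be negative. *)
definition triangular :: "int \<Rightarrow> int" where
  "triangular x = x * (x + 1) div 2"

end

theory Submission
  imports Defs "HOL-Computational_Algebra.Computational_Algebra"
begin

text \<open>
  Two facts carry the theorem. The first is that every positive $M \equiv 1 \pmod 4$ is a sum of
  three squares. For squarefree $M$ one finds a prime $q \equiv 1 \pmod 4$ such that $-q$ is a square
  modulo $M$; reciprocity makes $M$ a square modulo $q$, the pigeonhole principle solves
  $T^2 + q W^2 = M Z^2$, and as $q$ is a sum of two squares, $M$ is a sum of three rational, hence of
  three integral squares. Only the values of some quadratic characters at $q$ are prescribed, so $q$
  comes from Mertens sums of real characters.

  The second fact is Jacobi's identity $\varphi(-q)^2 \psi(q) = \sum_k (-1)^k (2k+1) q^{k(k+1)/2}$.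
  It says that among the representations $n = x^2 + y^2 + T_z$ those with $x + y$ even and those with
  $x + y$ odd are equally numerous unless $n$ is triangular, and it tells which kind prevails for
  $n = T_m$.

  The remaining cases concern squares: $T_m = x^2 + y^2 + T_z$ amounts to
  $(2m+1)^2 = (2z+1)^2 + 8(x^2+y^2)$. Representations come from a divisor of $2m+1$ of a suitable
  shape; their absence is read off the factorization of $(2m+1)^2 - (2z+1)^2$, whose coprime factors
  are sums of two squares up to the common square.
\<close>

section \<open>Mertens sums of real characters\<close>

text \<open>Dirichlet's theorem in full would need complex characters. Here only signs are
  prescribed, namely (q/p) for p | M and the nontrivial character modulo 4 at q, so all characters
  take values in -1, 0, 1 and the nonvanishing of L(1, chi) stays elementary. The von Mangoldt
  weights count prime powers, so at first only a prime power with the required signs appears. A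
  prescribed sign -1 makes its exponent odd, and then the prime itself has the same signs; if no
  sign is -1, every prime factor of M is 1 modulo 4 and M is already a sum of two squares.

  Three squares give representations x^2 + y^2 + T_z but no control over the parities of x and y;
  this is the gap that Jacobi's identity fills. Its proof avoids infinite products: instances of a
  finite q-binomial theorem are compared with truncated theta series modulo X^(n+1), which is enough
  to read off the coefficient of X^n.\<close>

lemma sum_divisors_swap:
  fixes f :: "nat \<Rightarrow> nat \<Rightarrow> 'a :: comm_monoid_add"
  shows "(\<Sum>n=1..N. \<Sum>d | d dvd n. f d (n div d)) = (\<Sum>d=1..N. \<Sum>k=1..N div d. f d k)"
proof -
  have "(\<Sum>n=1..N. \<Sum>d | d dvd n. f d (n div d)) =
          (\<Sum>(n, d)\<in>(SIGMA n:{1..N}. {d. d dvd n}). f d (n div d))"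
    by (rule sum.Sigma) auto
  also have "\<dots> = (\<Sum>(d, k)\<in>(SIGMA d:{1..N}. {1..N div d}). f d k)"
  proof (rule sum.reindex_bij_witness[where i = "\<lambda>(d, k). (d * k, d)" and j = "\<lambda>(n, d). (d, n div d)"])
    fix a assume "a \<in> (SIGMA n:{1..N}. {d. d dvd n})"
    then obtain n d where a: "a = (n, d)" "1 \<le> n" "n \<le> N" "d dvd n" by auto
    then obtain k where k: "n = d * k" by auto
    with a have pos: "d > 0" "k > 0" by (auto intro!: Nat.gr0I)
    show "(case case a of (n, d) \<Rightarrow> (d, n div d) of (d, k) \<Rightarrow> (d * k, d)) = a"
      using a k by simp
    have "d * 1 \<le> d * k" using pos by (intro mult_le_mono2) auto
    then have "d \<le> N" using a(3) k by linarith
    moreover have "d * k div d \<le> N div d" using a k by (intro div_le_mono) auto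
    ultimately show "(case a of (n, d) \<Rightarrow> (d, n div d)) \<in> (SIGMA d:{1..N}. {1..N div d})"
      using a k pos by auto
  next
    fix b assume "b \<in> (SIGMA d:{1..N}. {1..N div d})"
    then obtain d k where b: "b = (d, k)" "1 \<le> d" "d \<le> N" "1 \<le> k" "k \<le> N div d" by auto
    then have "d * k \<le> N" by (metis div_times_less_eq_dividend mult.commute mult_le_mono2 order_trans)
    then show "(case b of (d, k) \<Rightarrow> (d * k, d)) \<in> (SIGMA n:{1..N}. {d. d dvd n})"
      using b by auto
    show "(case case b of (d, k) \<Rightarrow> (d * k, d) of (n, d) \<Rightarrow> (d, n div d)) = b" using b by auto
  qed auto
  also have "\<dots> = (\<Sum>d=1..N. \<Sum>k=1..N div d. f d k)"
    by (rule sum.Sigma [symmetric]) auto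
  finally show ?thesis .
qed

section \<open>Elementary estimates of Chebyshev and Mertens\<close>

definition psi_fun :: "nat \<Rightarrow> real" where "psi_fun N = (\<Sum>d=1..N. mangoldt d)"

text \<open>Legendre's formula for the prime exponents of a factorial, in logarithmic form. The
  lower bound for the Mertens sum without character and Chebyshev's upper bound are both read off
  from it.\<close>

lemma ln_fact_mangoldt: "ln (fact N) = (\<Sum>d=1..N. mangoldt d * real (N div d))"
proof -
  have "ln (fact N :: real) = (\<Sum>n=1..N. ln (real n))"
  proof (induction N)
    case (Suc N)
    have "ln (fact (Suc N) :: real) = ln (real (Suc N)) + ln (fact N)"
      by (simp only: fact_Suc of_nat_mult of_nat_fact) (subst ln_mult, auto)
    with Suc show ?case by simp
  qed simp
  also have "\<dots> = (\<Sum>n=1..N. \<Sum>d | d dvd n. mangoldt d)"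
    by (intro sum.cong refl) (simp add: mangoldt_sum)
  also have "\<dots> = (\<Sum>d=1..N. \<Sum>k=1..N div d. mangoldt d)"
    by (rule sum_divisors_swap[where f = "\<lambda>d k. mangoldt d"])
  finally show ?thesis by (simp add: mult.commute)
qed

text \<open>One half of Mertens' first theorem. Replacing the integer part of N/d by N/d only
  enlarges the sum, so in this direction a weak form of Stirling's formula suffices.\<close>

lemma sum_mangoldt_over_ge:
  assumes "N \<ge> 1"
  shows "(\<Sum>d=1..N. mangoldt d / real d) \<ge> ln (real N) - 1"
proof -
  have "real n * ln (real n) - real n \<le> ln (fact n)" if "n \<ge> 1" for n
    using that
  proof (induction n rule: nat_induct_at_least)
    case (Suc n)
    have "ln (real (Suc n) / real n) \<le> real (Suc n) / real n - 1"
      using Suc by (intro ln_le_minus_one) auto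
    then have "real n * (ln (real (Suc n)) - ln (real n)) \<le> 1"
      using Suc by (simp add: ln_div field_simps)
    moreover have "ln (fact (Suc n) :: real) = ln (real (Suc n)) + ln (fact n)"
      by (simp only: fact_Suc of_nat_mult of_nat_fact) (subst ln_mult, auto)
    ultimately show ?case using Suc.IH by (simp add: algebra_simps)
  qed simp
  from this[OF assms] have "real N * ln (real N) - real N \<le> (\<Sum>d=1..N. mangoldt d * real (N div d))"
    by (simp add: ln_fact_mangoldt)
  also have "\<dots> \<le> (\<Sum>d=1..N. mangoldt d * (real N / real d))"
    by (intro sum_mono mult_left_mono mangoldt_nonneg of_nat_div_le_of_nat)
  also have "\<dots> = real N * (\<Sum>d=1..N. mangoldt d / real d)"
    by (simp add: sum_distrib_left mult_ac)
  finally have "real N * (ln (real N) - 1) \<le> real N * (\<Sum>d=1..N. mangoldt d / real d)"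
    by (simp add: algebra_simps)
  then show ?thesis using assms by simp
qed

text \<open>Chebyshev's argument: psi(2n) - psi(n) is at most the logarithm of the central binomial
  coefficient, hence at most 2n ln 2, and N is halved repeatedly. For a constant K ln 2 the
  induction needs (K + 2) c \<le> K N with c = N/2 rounded up; if only 2c \<le> N + 1 is used, the
  case N = 2 makes K = 6 the least choice.\<close>

lemma psi_fun_le: "psi_fun N \<le> 6 * ln 2 * real N"
proof (induction N rule: less_induct)
  case (less N)
  have mono: "psi_fun a \<le> psi_fun b" if "a \<le> b" for a b
    unfolding psi_fun_def using that by (intro sum_mono2 mangoldt_nonneg) auto
  have double: "psi_fun (2 * n) - psi_fun n \<le> 2 * real n * ln 2" for n
  proof -
    have "psi_fun (2 * n) - psi_fun n = (\<Sum>d=n+1..2*n. mangoldt d)"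
    proof -
      have "{1..2*n} = {1..n} \<union> {n+1..2*n}" by auto
      then have "psi_fun (2 * n) = psi_fun n + (\<Sum>d=n+1..2*n. mangoldt d)"
        unfolding psi_fun_def by (simp add: sum.union_disjoint)
      then show ?thesis by simp
    qed
    also have "\<dots> = (\<Sum>d=n+1..2*n. mangoldt d * (real (2 * n div d) - 2 * real (n div d)))"
    proof (intro sum.cong refl)
      fix d assume d: "d \<in> {n+1..2*n}"
      then have "2 * n div d = 1" by (auto intro!: div_nat_eqI)
      moreover have "n div d = 0" using d by auto
      ultimately show "mangoldt d = mangoldt d * (real (2 * n div d) - 2 * real (n div d))" by simp
    qed
    also have "\<dots> \<le> (\<Sum>d=1..2*n. mangoldt d * (real (2 * n div d) - 2 * real (n div d)))"
    proof (intro sum_mono2 mult_nonneg_nonneg mangoldt_nonneg)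
      fix d
      have "n div d + n div d \<le> (n + n) div d" by (metis div_add1_eq le_add1)
      then have "2 * (n div d) \<le> 2 * n div d" by (simp add: mult_2)
      then have "real (2 * (n div d)) \<le> real (2 * n div d)" by (rule of_nat_mono)
      then show "0 \<le> real (2 * n div d) - 2 * real (n div d)" by simp
    qed auto
    also have "\<dots> = (\<Sum>d=1..2*n. mangoldt d * real (2 * n div d)) - 2 * (\<Sum>d=1..2*n. mangoldt d * real (n div d))"
      by (simp add: sum_subtractf sum_distrib_left algebra_simps)
    also have "(\<Sum>d=1..2*n. mangoldt d * real (n div d)) = (\<Sum>d=1..n. mangoldt d * real (n div d))"
      by (intro sum.mono_neutral_right) auto
    also have "(\<Sum>d=1..2*n. mangoldt d * real (2 * n div d)) - 2 * (\<Sum>d=1..n. mangoldt d * real (n div d))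
             = ln (fact (2 * n)) - 2 * ln (fact n)" by (simp add: ln_fact_mangoldt)
    also have "\<dots> = ln (real ((2 * n) choose n))"
    proof -
      have "fact n * fact (2 * n - n) * (2 * n choose n) = (fact (2 * n) :: nat)"
        by (rule binomial_fact_lemma) simp
      then have "real (fact n * fact n * (2 * n choose n)) = real (fact (2 * n))" by (simp add: mult_2)
      then have "ln (fact n * fact n * real (2 * n choose n)) = ln (fact (2 * n))" by simp
      moreover have "real (2 * n choose n) > 0" by simp
      ultimately show ?thesis by (simp add: ln_mult)
    qed
    also have "\<dots> \<le> ln (real (2 ^ (2 * n)))"
      using binomial_le_pow2[of "2 * n" n] by (subst ln_le_cancel_iff) (auto simp del: of_nat_power)
    also have "\<dots> = 2 * real n * ln 2" by (simp add: ln_realpow)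
    finally show ?thesis .
  qed
  show ?case
  proof (cases "N \<ge> 2")
    case False
    then have "N = 0 \<or> N = 1" by auto
    then show ?thesis by (auto simp: psi_fun_def)
  next
    case True
    define c where "c = (N + 1) div 2"
    have c: "c < N" "N \<le> 2 * c" "2 * c \<le> N + 1" using True by (auto simp: c_def)
    have "psi_fun N \<le> psi_fun (2 * c)" using c by (intro mono) auto
    also have "\<dots> \<le> psi_fun c + 2 * real c * ln 2" using double[of c] by simp
    also have "\<dots> \<le> 6 * ln 2 * real c + 2 * real c * ln 2" using less[OF c(1)] by (rule add_right_mono)
    also have "\<dots> = ln 2 * (8 * real c)" by (simp add: algebra_simps)
    also have "\<dots> \<le> ln 2 * (6 * real N)"
    proof (intro mult_left_mono)
      have "8 * c \<le> 4 * N + 4" using c by simp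
      also have "\<dots> \<le> 6 * N" using True by simp
      finally show "8 * real c \<le> 6 * real N" by linarith
    qed simp
    finally show ?thesis by (simp add: mult_ac)
  qed
qed

text \<open>Bounded partial sums are all that the analysis takes from a nonprincipal character with
  a modulus. Products of residue symbols to different moduli thus fit in without further
  bookkeeping.\<close>

locale real_character =
  fixes \<chi> :: "nat \<Rightarrow> real" and B :: real
  assumes mult: "\<chi> (a * b) = \<chi> a * \<chi> b"
    and one: "\<chi> 1 = 1"
    and vals: "\<chi> n \<in> {-1, 0, 1}"
    and partial_sums: "\<bar>\<Sum>n=1..k. \<chi> n\<bar> \<le> B"
begin

lemma B_nonneg: "B \<ge> 0" using partial_sums[of 0] by simp

lemma abs_chi_le: "\<bar>\<chi> n\<bar> \<le> 1" using vals[of n] by auto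

lemma abel_sum:
  assumes "a \<ge> 1" "a \<le> b"
  shows "(\<Sum>n=a..b. \<chi> n * g n) = (\<Sum>n=1..b. \<chi> n) * g b - (\<Sum>n=1..a-1. \<chi> n) * g a
           + (\<Sum>n=a..<b. (\<Sum>k=1..n. \<chi> k) * (g n - g (Suc n)))"
  using assms(2)
proof (induction b rule: nat_induct_at_least)
  case base
  have "(\<Sum>n=1..a. \<chi> n) = (\<Sum>n=1..a-1. \<chi> n) + \<chi> a"
    using assms(1) by (cases a) auto
  then show ?case by (simp add: algebra_simps)
next
  case (Suc b)
  then show ?case using assms(1) by (simp add: algebra_simps)
qed

text \<open>The variation of a decreasing g telescopes: the three terms of the summation by parts
  are at most B g(b), B g(a) and B (g(a) - g(b)).\<close>

lemma abel_bound:
  assumes "a \<ge> 1" and dec: "\<And>n. n \<ge> a \<Longrightarrow> g (Suc n) \<le> g n" and nonneg: "\<And>n. n \<ge> a \<Longrightarrow> g n \<ge> (0::real)"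
  shows "\<bar>\<Sum>n=a..b. \<chi> n * g n\<bar> \<le> 2 * B * g a"
proof (cases "a \<le> b")
  case False
  then show ?thesis using B_nonneg nonneg[of a] by simp
next
  case True
  have tel: "(\<Sum>n=a..<b. g n - g (Suc n)) = g a - g b"
    using True by (induction b rule: nat_induct_at_least) auto
  have "\<bar>\<Sum>n=a..<b. (\<Sum>k=1..n. \<chi> k) * (g n - g (Suc n))\<bar> \<le> (\<Sum>n=a..<b. B * (g n - g (Suc n)))"
    using dec partial_sums by (intro order.trans[OF sum_abs] sum_mono) (auto simp: abs_mult B_nonneg intro!: mult_mono)
  also have "\<dots> = B * (g a - g b)" by (simp add: sum_distrib_left [symmetric] tel)
  finally have 1: "\<bar>\<Sum>n=a..<b. (\<Sum>k=1..n. \<chi> k) * (g n - g (Suc n))\<bar> \<le> B * (g a - g b)" .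
  have 2: "\<bar>(\<Sum>n=1..b. \<chi> n) * g b\<bar> \<le> B * g b"
    using partial_sums nonneg[OF True] by (simp add: abs_mult mult_right_mono)
  have 3: "\<bar>(\<Sum>n=1..a-1. \<chi> n) * g a\<bar> \<le> B * g a"
    using partial_sums nonneg[of a] by (simp add: abs_mult mult_right_mono)
  show ?thesis unfolding abel_sum[OF assms(1) True]
    using 1 2 3 by (simp add: algebra_simps)
qed

definition L where "L = lim (\<lambda>N. \<Sum>n=1..N. \<chi> n / real n)"

lemma tail_bound: "a \<ge> 1 \<Longrightarrow> \<bar>\<Sum>n=a..b. \<chi> n / real n\<bar> \<le> 2 * B / real a"
  using abel_bound[of a "\<lambda>n. 1 / real n" b] by (simp add: field_simps)

lemma partial_diff:
  assumes "M \<le> N"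
  shows "(\<Sum>n=1..N. \<chi> n / real n) - (\<Sum>n=1..M. \<chi> n / real n) = (\<Sum>n=Suc M..N. \<chi> n / real n)"
proof -
  have "{1..N} = {1..M} \<union> {Suc M..N}" using assms by auto
  then show ?thesis by (simp add: sum.union_disjoint)
qed

lemma L_tendsto: "(\<lambda>N. \<Sum>n=1..N. \<chi> n / real n) \<longlonglongrightarrow> L"
proof -
  let ?S = "\<lambda>N. \<Sum>n=1..N. \<chi> n / real n"
  have "Cauchy ?S"
  proof (rule metric_CauchyI)
    fix e :: real assume e: "e > 0"
    obtain K :: nat where K: "2 * B / e < real K" using reals_Archimedean2 by blast
    have "\<bar>?S n - ?S m\<bar> < e" if "m \<ge> K" "n \<ge> m" for m n
    proof -
      have "\<bar>?S n - ?S m\<bar> \<le> 2 * B / real (Suc m)"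
        unfolding partial_diff[OF that(2)] by (rule tail_bound) simp
      also have "\<dots> < e"
      proof -
        have "2 * B < e * real K" using K e by (simp add: field_simps)
        also have "\<dots> \<le> e * real (Suc m)" using e that(1) by (intro mult_left_mono) auto
        finally show ?thesis by (simp add: field_simps)
      qed
      finally show ?thesis .
    qed
    then have "dist (?S m) (?S n) < e" if "m \<ge> K" "n \<ge> K" for m n
      using that \<open>\<And>n m. m \<ge> K \<Longrightarrow> n \<ge> m \<Longrightarrow> \<bar>?S n - ?S m\<bar> < e\<close>[of m n]
        \<open>\<And>n m. m \<ge> K \<Longrightarrow> n \<ge> m \<Longrightarrow> \<bar>?S n - ?S m\<bar> < e\<close>[of n m]
      unfolding dist_real_def by (metis abs_minus_commute nat_le_linear)
    then show "\<exists>M. \<forall>m\<ge>M. \<forall>n\<ge>M. dist (?S m) (?S n) < e" by blast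
  qed
  then show ?thesis unfolding L_def by (simp add: Cauchy_convergent_iff convergent_LIMSEQ_iff)
qed

text \<open>The explicit rate, beyond mere convergence, is what allows these errors to be summed
  against Chebyshev's bound in \<open>mertens_bounded\<close>.\<close>

lemma L_error: "\<bar>L - (\<Sum>n=1..N. \<chi> n / real n)\<bar> \<le> 2 * B / real (Suc N)"
proof (rule tendsto_upperbound)
  let ?S = "\<lambda>N. \<Sum>n=1..N. \<chi> n / real n"
  show "(\<lambda>m. \<bar>?S m - ?S N\<bar>) \<longlonglongrightarrow> \<bar>L - ?S N\<bar>" by (intro tendsto_intros L_tendsto)
  show "\<forall>\<^sub>F m in sequentially. \<bar>?S m - ?S N\<bar> \<le> 2 * B / real (Suc N)"
    using eventually_ge_at_top[of N]
    by eventually_elim (use tail_bound[of "Suc N"] partial_diff in simp)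
qed simp

lemma chi_power: "\<chi> (n ^ k) = \<chi> n ^ k"
  by (induction k) (use mult one in auto)

lemma divisor_sum_coprime:
  assumes "coprime a b" "a > 0" "b > 0"
  shows "(\<Sum>d | d dvd a * b. \<chi> d) = (\<Sum>d | d dvd a. \<chi> d) * (\<Sum>d | d dvd b. \<chi> d)"
proof -
  have gcds: "gcd (x * y) a = x" "gcd (x * y) b = y" if "x dvd a" "y dvd b" for x y
  proof -
    have "coprime y a" "coprime x b" using that assms(1)
      by (meson coprime_commute coprime_divisors dvd_refl)+
    then have "gcd a (x * y) = gcd a x" "gcd b (x * y) = gcd b y"
      by (simp_all add: gcd_mult_right_right_cancel gcd_mult_right_left_cancel coprime_commute)
    then show "gcd (x * y) a = x" "gcd (x * y) b = y"
      using that by (simp_all add: gcd.commute gcd_nat.absorb2)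
  qed
  have "(\<Sum>d | d dvd a. \<chi> d) * (\<Sum>d | d dvd b. \<chi> d) = (\<Sum>(x, y)\<in>{d. d dvd a} \<times> {d. d dvd b}. \<chi> (x * y))"
    by (simp add: sum_product sum.cartesian_product mult)
  also have "\<dots> = (\<Sum>d | d dvd a * b. \<chi> d)"
  proof (rule sum.reindex_bij_witness[where i = "\<lambda>d. (gcd d a, gcd d b)" and j = "\<lambda>(x, y). x * y"])
    fix p assume "p \<in> {d. d dvd a} \<times> {d. d dvd b}"
    then show "(gcd (case p of (x, y) \<Rightarrow> x * y) a, gcd (case p of (x, y) \<Rightarrow> x * y) b) = p"
      and "(case p of (x, y) \<Rightarrow> x * y) \<in> {d. d dvd a * b}"
      using gcds by (auto intro: mult_dvd_mono)
  next
    fix d assume "d \<in> {d. d dvd a * b}"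
    then obtain x y where "d = x * y" "x dvd a" "y dvd b" using division_decomp[of d a b] by auto
    with gcds show "(case (gcd d a, gcd d b) of (x, y) \<Rightarrow> x * y) = d" by simp
  qed auto
  finally show ?thesis by simp
qed

text \<open>The divisor p^i contributes the i-th power of chi(p): for chi(p) = -1 the sum alternates
  between 1 and 0, for chi(p) = 0 it is 1, for chi(p) = 1 it is k + 1.\<close>

lemma divisor_sum_prime_power:
  assumes "prime p"
  shows "(\<Sum>d | d dvd p ^ k. \<chi> d) \<ge> 0" "even k \<Longrightarrow> (\<Sum>d | d dvd p ^ k. \<chi> d) \<ge> 1"
proof -
  have "{d. d dvd p ^ k} = (\<lambda>i. p ^ i) ` {..k}"
    using assms by (auto simp: divides_primepow_nat)
  moreover have "inj_on (\<lambda>i. p ^ i) {..k}"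
    using assms prime_gt_1_nat by (auto simp: inj_on_def)
  ultimately have eq: "(\<Sum>d | d dvd p ^ k. \<chi> d) = (\<Sum>i\<le>k. \<chi> p ^ i)"
    by (simp add: sum.reindex chi_power)
  have "(\<Sum>i\<le>k. (-1::real) ^ i) = (if even k then 1 else 0)" by (induction k) auto
  moreover have "(\<Sum>i\<le>k. (0::real) ^ i) = 1" by (induction k) auto
  ultimately show "(\<Sum>d | d dvd p ^ k. \<chi> d) \<ge> 0" "even k \<Longrightarrow> (\<Sum>d | d dvd p ^ k. \<chi> d) \<ge> 1"
    unfolding eq using vals[of p] by auto
qed

text \<open>These sums are the coefficients of zeta(s) L(s, chi). They are multiplicative, so prime
  powers decide; every exponent in a square is even, which excludes the value 0.\<close>

lemma divisor_sum_nonneg: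
  assumes "n > 0"
  shows "(\<Sum>d | d dvd n. \<chi> d) \<ge> 0 \<and> ((\<exists>m. n = m ^ 2) \<longrightarrow> (\<Sum>d | d dvd n. \<chi> d) \<ge> 1)"
  using assms
proof (induction n rule: less_induct)
  case (less n)
  show ?case
  proof (cases "n = 1")
    case True
    then show ?thesis using one by simp
  next
    case False
    then obtain p where p: "prime p" "p dvd n" using prime_factor_nat by blast
    define k where "k = multiplicity p n"
    obtain m where m: "n = p ^ k * m" "\<not> p dvd m"
      using multiplicity_decompose'[of n p] p less.prems unfolding k_def by (metis not_prime_unit not_gr_zero)
    have k: "k > 0" using p less.prems by (simp add: k_def prime_multiplicity_gt_zero_iff)
    have "m > 0" using m less.prems by (auto intro!: Nat.gr0I)
    have "p ^ k > 1" using p k using prime_gt_1_nat by (intro one_less_power) auto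
    then have "m < n" using m \<open>m > 0\<close> by simp
    have cop: "coprime (p ^ k) m" using p m by (simp add: prime_imp_coprime)
    note IH = less.IH[OF \<open>m < n\<close> \<open>m > 0\<close>]
    have eq: "(\<Sum>d | d dvd n. \<chi> d) = (\<Sum>d | d dvd p ^ k. \<chi> d) * (\<Sum>d | d dvd m. \<chi> d)"
      unfolding m(1) using p \<open>m > 0\<close> prime_gt_0_nat by (intro divisor_sum_coprime cop) auto
    show ?thesis
    proof (intro conjI impI)
      show "(\<Sum>d | d dvd n. \<chi> d) \<ge> 0"
        unfolding eq using IH divisor_sum_prime_power[OF p(1)] by auto
      assume "\<exists>r. n = r ^ 2"
      then obtain r where r: "n = r ^ 2" by blast
      have "r > 0" using r less.prems by (auto intro!: Nat.gr0I)
      have "k = 2 * multiplicity p r"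
        unfolding k_def r using p \<open>r > 0\<close> by (simp add: prime_elem_multiplicity_power_distrib)
      then have "even k" by simp
      have "\<exists>t. m = t ^ 2"
        using cop m(1) r by (metis coprime_commute is_nth_power_def is_nth_power_mult_coprime_nat_iff mult.commute)
      then have m1: "(\<Sum>d | d dvd m. \<chi> d) \<ge> 1" using IH by blast
      show "(\<Sum>d | d dvd n. \<chi> d) \<ge> 1"
        unfolding eq using mult_mono[OF divisor_sum_prime_power(2)[OF p(1) \<open>even k\<close>] m1]
          divisor_sum_prime_power(1)[OF p(1), of k] by simp
    qed
  qed
qed

end

text \<open>The inequality of arithmetic and geometric means for the terms with exponents i and n -
  1 - i, whose product is the square of u^(n-1).\<close>

lemma geometric_sum_ge:
  assumes "0 < u" "u < (1::real)"
  shows "real n * u ^ (n - 1) \<le> (\<Sum>i<n. (u\<^sup>2) ^ i)"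
proof -
  have "2 * (\<Sum>i<n. (u\<^sup>2) ^ i) = (\<Sum>i<n. (u\<^sup>2) ^ i) + (\<Sum>i<n. (u\<^sup>2) ^ (n - Suc i))"
    by (simp add: sum.nat_diff_reindex)
  also have "\<dots> = (\<Sum>i<n. (u\<^sup>2) ^ i + (u\<^sup>2) ^ (n - Suc i))" by (simp add: sum.distrib)
  also have "\<dots> \<ge> (\<Sum>i<n. 2 * u ^ (n - 1))"
  proof (intro sum_mono)
    fix i assume "i \<in> {..<n}"
    then have "u ^ (n - 1) = u ^ i * u ^ (n - Suc i)" by (simp flip: power_add)
    moreover have "(u ^ i - u ^ (n - Suc i))\<^sup>2 \<ge> 0" by simp
    ultimately show "2 * u ^ (n - 1) \<le> (u\<^sup>2) ^ i + (u\<^sup>2) ^ (n - Suc i)"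
      by (simp add: power2_eq_square power_mult_distrib algebra_simps)
  qed
  finally show ?thesis by simp
qed

text \<open>Monsky's argument: if $L(1,\chi) = 0$, the Lambert series $\sum_n \chi(n) t^n / (1 - t^n)$ is
  $-\sum_n \chi(n)$ times the following decreasing sequence, hence bounded by Abel summation; but it
  dominates $\sum_k t^{k^2}$, which is unbounded as $t \to 1$.\<close>

definition lambert_defect :: "real \<Rightarrow> nat \<Rightarrow> real" where
  "lambert_defect t n = 1 / (real n * (1 - t)) - t ^ n / (1 - t ^ n)"

text \<open>With G(n) = 1 + t + ... + t^(n-1), the difference of consecutive terms is 1/(n(n+1)) -
  t^n/(G(n) G(n+1)), divided by 1 - t. Monotonicity therefore amounts to n(n+1) t^n \<le> G(n)
  G(n+1).\<close>

lemma lambert_defect: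
  assumes t: "0 < t" "t < 1" and n: "n \<ge> 1"
  shows "lambert_defect t n \<ge> 0" "lambert_defect t (Suc n) \<le> lambert_defect t n"
proof -
  define G where "G n = (\<Sum>i<n. t ^ i)" for n
  have G: "1 - t ^ n = (1 - t) * G n" for n unfolding G_def by (rule one_diff_power_eq)
  have Gpos: "G n > 0" if "n \<ge> 1" for n
    using t that unfolding G_def by (intro sum_pos) (auto simp: lessThan_empty_iff)
  have eq: "lambert_defect t n = (1 / real n - t ^ n / G n) / (1 - t)" if "n \<ge> 1" for n
    using t Gpos[OF that] that unfolding lambert_defect_def G by (simp add: diff_divide_distrib mult.commute)
  have "(\<Sum>i<n. t ^ n) \<le> G n" unfolding G_def using t by (intro sum_mono power_decreasing) auto
  then have "real n * t ^ n \<le> G n" by simp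
  then show "lambert_defect t n \<ge> 0"
    unfolding eq[OF n] using t n Gpos[OF n] by (simp add: field_simps)
  \<comment> \<open>In terms of the root, n u^(n-1) \<le> G(n) and (n+1) u^n \<le> G(n+1); the
    product of the left sides contains u^(2n-1), which is at least u^(2n) = t^n.\<close>
  define u where "u = sqrt t"
  have u: "0 < u" "u < 1" "u\<^sup>2 = t" using t by (auto simp: u_def)
  have "t ^ n = u ^ (2 * n)" using u by (simp add: power_mult)
  also have "\<dots> \<le> u ^ (n - 1 + n)" using u by (intro power_decreasing) auto
  also have "\<dots> = u ^ (n - 1) * u ^ n" by (simp add: power_add)
  finally have "real n * real (Suc n) * t ^ n \<le> real n * real (Suc n) * (u ^ (n - 1) * u ^ n)"
    by (intro mult_left_mono) auto
  also have "\<dots> = real n * u ^ (n - 1) * (real (Suc n) * u ^ n)" by (simp only: mult_ac)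
  also have "\<dots> \<le> G n * G (Suc n)"
  proof (rule mult_mono)
    show "real n * u ^ (n - 1) \<le> G n" "real (Suc n) * u ^ n \<le> G (Suc n)"
      using geometric_sum_ge[OF u(1,2), of n] geometric_sum_ge[OF u(1,2), of "Suc n"]
      unfolding G_def u(3) by simp_all
  qed (use Gpos[OF n] u in auto)
  finally have key: "real n * real (Suc n) * t ^ n \<le> G n * G (Suc n)" .
  have "G (Suc n) = 1 + t * G n" using G[of n] by (simp add: G_def algebra_simps)
  then have "t ^ n * G (Suc n) - t ^ Suc n * G n = t ^ n" by (simp add: algebra_simps)
  then have "t ^ n / G n - t ^ Suc n / G (Suc n) = t ^ n / (G n * G (Suc n))"
    using Gpos[of n] Gpos[of "Suc n"] n by (subst diff_frac_eq) auto
  also have "\<dots> \<le> 1 / (real n * real (Suc n))"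
    using key Gpos[of n] Gpos[of "Suc n"] n by (simp add: divide_le_eq pos_le_divide_eq mult_ac del: of_nat_Suc)
  also have "\<dots> = 1 / real n - 1 / real (Suc n)" using n by (subst diff_frac_eq) auto
  finally have "1 / real (Suc n) - t ^ Suc n / G (Suc n) \<le> 1 / real n - t ^ n / G n" by linarith
  then show "lambert_defect t (Suc n) \<le> lambert_defect t n"
    using t n by (simp add: eq divide_right_mono del: of_nat_Suc power_Suc)
qed

context real_character
begin

lemma theta_lower:
  assumes t: "0 < t" "t < 1" and N: "K\<^sup>2 \<le> N"
  shows "(\<Sum>k=1..K. t ^ (k\<^sup>2)) \<le> (\<Sum>m=1..N. (\<Sum>d | d dvd m. \<chi> d) * t ^ m)"
proof -
  have "(\<Sum>k=1..K. t ^ (k\<^sup>2)) = (\<Sum>m\<in>(\<lambda>k. k\<^sup>2) ` {1..K}. t ^ m)"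
    by (subst sum.reindex) (auto simp: inj_on_def)
  also have "\<dots> \<le> (\<Sum>m\<in>(\<lambda>k. k\<^sup>2) ` {1..K}. (\<Sum>d | d dvd m. \<chi> d) * t ^ m)"
  proof (intro sum_mono)
    fix m assume "m \<in> (\<lambda>k. k\<^sup>2) ` {1..K}"
    then have "m > 0" "\<exists>k. m = k\<^sup>2" by auto
    then have "1 \<le> (\<Sum>d | d dvd m. \<chi> d)" using divisor_sum_nonneg by blast
    then have "1 * t ^ m \<le> (\<Sum>d | d dvd m. \<chi> d) * t ^ m" using t by (intro mult_right_mono) auto
    then show "t ^ m \<le> (\<Sum>d | d dvd m. \<chi> d) * t ^ m" by simp
  qed
  also have "\<dots> \<le> (\<Sum>m=1..N. (\<Sum>d | d dvd m. \<chi> d) * t ^ m)"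
  proof (intro sum_mono2)
    show "(\<lambda>k. k\<^sup>2) ` {1..K} \<subseteq> {1..N}"
    proof
      fix m assume "m \<in> (\<lambda>k. k\<^sup>2) ` {1..K}"
      then obtain k where k: "m = k\<^sup>2" "1 \<le> k" "k \<le> K" by auto
      then have "k\<^sup>2 \<le> K\<^sup>2" by (intro power_mono) auto
      then have "k\<^sup>2 \<le> N" using N by (rule order_trans)
      with k show "m \<in> {1..N}" by auto
    qed
  qed (use divisor_sum_nonneg t in auto)
  finally show ?thesis .
qed

text \<open>All sums stay finite, so no double series has to be rearranged. The price is the last
  term: the geometric series of each n is cut after \<open>N div n\<close> terms, the first omitted
  exponent exceeds N, and each of the N tails is at most t^N/(1 - t).\<close>

lemma lambert_upper:
  assumes t: "0 < t" "t < 1"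
  shows "(\<Sum>m=1..N. (\<Sum>d | d dvd m. \<chi> d) * t ^ m)
           \<le> (\<Sum>n=1..N. \<chi> n / real n) / (1 - t) + 2 * B + real N * t ^ N / (1 - t)"
proof -
  have "(\<Sum>m=1..N. (\<Sum>d | d dvd m. \<chi> d) * t ^ m) = (\<Sum>m=1..N. \<Sum>d | d dvd m. \<chi> d * t ^ (d * (m div d)))"
    by (simp add: sum_distrib_right)
  also have "\<dots> = (\<Sum>n=1..N. \<Sum>k=1..N div n. \<chi> n * t ^ (n * k))"
    by (rule sum_divisors_swap)
  also have "\<dots> \<le> (\<Sum>n=1..N. \<chi> n * (t ^ n / (1 - t ^ n)) + t ^ N / (1 - t))"
  proof (intro sum_mono)
    fix n assume n: "n \<in> {1..N}"
    define x where "x = t ^ n"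
    have x: "0 < x" "x < 1" "x \<le> t" using t n by (auto simp: x_def power_less_one_iff power_le_one intro: power_decreasing[of 1, simplified])
    have geo: "(\<Sum>k=1..M. x ^ k) = x / (1 - x) - x ^ Suc M / (1 - x)" for M
    proof -
      have "(\<Sum>k=1..M. x ^ k) * (1 - x) = x - x ^ Suc M" 
      proof (induction M)
        case (Suc M)
        have "(\<Sum>k=1..Suc M. x ^ k) * (1 - x) = (\<Sum>k=1..M. x ^ k) * (1 - x) + x ^ Suc M * (1 - x)"
          by (simp add: distrib_right)
        also have "\<dots> = x - x ^ Suc (Suc M)" by (simp only: Suc.IH) (simp add: algebra_simps)
        finally show ?case .
      qed simp
      then show ?thesis using x by (simp add: eq_divide_eq flip: diff_divide_distrib)
    qed
    have "N < n * Suc (N div n)" using n dividend_less_times_div[of n N] by simp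
    then have "x ^ Suc (N div n) \<le> t ^ N"
      unfolding x_def power_mult [symmetric] using t by (intro power_decreasing) auto
    then have "x ^ Suc (N div n) / (1 - x) \<le> t ^ N / (1 - t)"
      using x t by (intro frac_le) auto
    moreover have "\<bar>\<chi> n * (x ^ Suc (N div n) / (1 - x))\<bar> \<le> 1 * (x ^ Suc (N div n) / (1 - x))"
      unfolding abs_mult using x abs_chi_le[of n] by (intro mult_mono) auto
    moreover have "(\<Sum>k=1..N div n. \<chi> n * t ^ (n * k)) = \<chi> n * (x / (1 - x)) - \<chi> n * (x ^ Suc (N div n) / (1 - x))"
    proof -
      have "(\<Sum>k=1..N div n. \<chi> n * t ^ (n * k)) = \<chi> n * (\<Sum>k=1..N div n. x ^ k)"
        by (simp add: x_def power_mult sum_distrib_left)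
      then show ?thesis unfolding geo by (simp only: right_diff_distrib)
    qed
    ultimately show "(\<Sum>k=1..N div n. \<chi> n * t ^ (n * k)) \<le> \<chi> n * (t ^ n / (1 - t ^ n)) + t ^ N / (1 - t)"
      unfolding x_def [symmetric] by linarith
  qed
  also have "\<dots> = (\<Sum>n=1..N. \<chi> n * (t ^ n / (1 - t ^ n))) + real N * t ^ N / (1 - t)"
    by (simp add: sum.distrib)
  also have "(\<Sum>n=1..N. \<chi> n * (t ^ n / (1 - t ^ n)))
              = (\<Sum>n=1..N. \<chi> n / real n) / (1 - t) - (\<Sum>n=1..N. \<chi> n * lambert_defect t n)"
    by (simp add: lambert_defect_def sum_divide_distrib sum_subtractf [symmetric] right_diff_distrib)
  finally have "(\<Sum>m=1..N. (\<Sum>d | d dvd m. \<chi> d) * t ^ m) \<le> (\<Sum>n=1..N. \<chi> n / real n) / (1 - t)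
                  - (\<Sum>n=1..N. \<chi> n * lambert_defect t n) + real N * t ^ N / (1 - t)" .
  moreover have "- (\<Sum>n=1..N. \<chi> n * lambert_defect t n) \<le> 2 * B"
  proof -
    have "\<bar>\<Sum>n=1..N. \<chi> n * lambert_defect t n\<bar> \<le> 2 * B * lambert_defect t 1"
      using lambert_defect[OF t] by (intro abel_bound) auto
    \<comment> \<open>The first term does not depend on t, hence the bound 2B is uniform as t tends
      to 1.\<close>
    moreover have "lambert_defect t 1 = 1" using t by (simp add: lambert_defect_def field_simps)
    ultimately show ?thesis by simp
  qed
  ultimately show ?thesis by linarith
qed

text \<open>The order of the limits matters: for fixed t and K, letting N tend to infinity removes
  both terms with denominator 1 - t; only then t tends to 1, and K \<le> 2B results for every
  K.\<close>

lemma L_nonzero: "L \<noteq> 0"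
proof
  assume L: "L = 0"
  have bound: "(\<Sum>k=1..K. t ^ (k\<^sup>2)) \<le> 2 * B" if t: "0 < t" "t < 1" for t :: real and K :: nat
  proof (rule tendsto_lowerbound)
    let ?f = "\<lambda>N. (\<Sum>n=1..N. \<chi> n / real n) / (1 - t) + 2 * B + real N * t ^ N / (1 - t)"
    have "?f \<longlonglongrightarrow> L / (1 - t) + 2 * B + 0 / (1 - t)"
      using t by (intro tendsto_intros L_tendsto powser_times_n_limit_0) auto
    then show "?f \<longlonglongrightarrow> 2 * B" using L by simp
    show "\<forall>\<^sub>F N in sequentially. (\<Sum>k=1..K. t ^ (k\<^sup>2)) \<le> ?f N"
      using eventually_ge_at_top[of "K\<^sup>2"]
      by eventually_elim (use theta_lower[OF t] lambert_upper[OF t] in \<open>blast intro: order_trans\<close>)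
  qed simp
  have "real K \<le> 2 * B" for K :: nat
  proof (rule tendsto_upperbound)
    have "((\<lambda>t::real. \<Sum>k=1..K. t ^ (k\<^sup>2)) \<longlongrightarrow> (\<Sum>k=1..K. 1 ^ (k\<^sup>2))) (at_left 1)"
      by (intro tendsto_intros)
    then show "((\<lambda>t::real. \<Sum>k=1..K. t ^ (k\<^sup>2)) \<longlongrightarrow> real K) (at_left 1)" by simp
    have "\<forall>\<^sub>F t::real in at_left 1. t \<in> {0<..<1}"
      by (rule eventually_at_left_real) simp
    then show "\<forall>\<^sub>F t::real in at_left 1. (\<Sum>k=1..K. t ^ (k\<^sup>2)) \<le> 2 * B"
      by eventually_elim (use bound in auto)
  qed simp
  then show False using reals_Archimedean2[of "2 * B"] by (metis linorder_not_less)
qed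

text \<open>Summation by parts against ln n / n. This function decreases only beyond e, whence the
  start at 3 and the separate bound for the first two terms.\<close>

lemma log_sum_bounded: "\<exists>C. \<forall>N. \<bar>\<Sum>n=1..N. \<chi> n * ln (real n) / real n\<bar> \<le> C"
proof -
  have dec: "ln (real (Suc n)) / real (Suc n) \<le> ln (real n) / real n" if "n \<ge> 3" for n
  proof -
    have "ln (real (Suc n) / real n) \<le> real (Suc n) / real n - 1"
      using that by (intro ln_le_minus_one) auto
    then have "real n * (ln (real (Suc n)) - ln (real n)) \<le> 1"
      using that by (simp add: ln_div field_simps)
    also have "1 \<le> ln (real n)" using that exp_le by (subst ln_ge_iff) auto
    finally have "real n * ln (real (Suc n)) \<le> real (Suc n) * ln (real n)" by (simp add: algebra_simps)
    then show ?thesis using that by (simp add: field_simps)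
  qed
  define c where "c = 2 * B * (ln 3 / 3)"
  have tail: "\<bar>\<Sum>n=3..N. \<chi> n * (ln (real n) / real n)\<bar> \<le> c" for N
    using abel_bound[of 3 "\<lambda>n. ln (real n) / real n" N] dec by (simp add: c_def)
  have "\<bar>\<Sum>n=1..N. \<chi> n * ln (real n) / real n\<bar> \<le> ln 2 + c" for N
  proof (cases "N \<ge> 2")
    case True
    then have "{1..N} = {1, 2} \<union> {3..N}" by auto
    then have "(\<Sum>n=1..N. \<chi> n * ln (real n) / real n) = \<chi> 2 * ln 2 / 2 + (\<Sum>n=3..N. \<chi> n * (ln (real n) / real n))"
      by (simp add: sum.union_disjoint)
    moreover have "\<bar>\<chi> 2 * ln 2 / 2\<bar> \<le> 1 * ln 2"
      using mult_mono[OF abs_chi_le[of 2], of "ln 2" "ln 2"] by (simp add: abs_mult)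
    ultimately show ?thesis using tail[of N] by linarith
  next
    case False
    then have "N = 0 \<or> N = 1" by auto
    moreover have "c \<ge> 0" using B_nonneg by (simp add: c_def)
    ultimately show ?thesis by auto
  qed
  then show ?thesis by blast
qed

text \<open>Writing ln as the divisor sum of the von Mangoldt function turns the bounded logarithmic
  sum into L times the Mertens sum plus an error. In the error, |e(d)| \<le> 2B d/N cancels the
  denominator d, so that Chebyshev's bound applies; then one divides by L.\<close>

lemma mertens_bounded: "\<exists>C. \<forall>N\<ge>1. \<bar>\<Sum>d=1..N. \<chi> d * mangoldt d / real d\<bar> \<le> C"
proof -
  obtain C where C: "\<And>N. \<bar>\<Sum>n=1..N. \<chi> n * ln (real n) / real n\<bar> \<le> C"
    using log_sum_bounded by blast
  have "\<bar>\<Sum>d=1..N. \<chi> d * mangoldt d / real d\<bar> \<le> (C + 2 * B * (6 * ln 2)) / \<bar>L\<bar>" if N: "N \<ge> 1" for N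
  proof -
    define S where "S = (\<Sum>d=1..N. \<chi> d * mangoldt d / real d)"
    define e where "e d = (\<Sum>k=1..N div d. \<chi> k / real k) - L" for d
    have "(\<Sum>n=1..N. \<chi> n * ln (real n) / real n) = (\<Sum>n=1..N. \<Sum>d | d dvd n. \<chi> d * \<chi> (n div d) * mangoldt d / (real d * real (n div d)))"
    proof (intro sum.cong refl)
      fix n assume n: "n \<in> {1..N}"
      have "\<chi> n * ln (real n) / real n = (\<Sum>d | d dvd n. \<chi> n * mangoldt d / real n)"
        using n mangoldt_sum[of n, where ?'a = real] by (simp add: sum_distrib_left [symmetric] sum_divide_distrib [symmetric])
      also have "\<dots> = (\<Sum>d | d dvd n. \<chi> d * \<chi> (n div d) * mangoldt d / (real d * real (n div d)))"
        by (intro sum.cong refl) (auto simp flip: mult of_nat_mult)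
      finally show "\<chi> n * ln (real n) / real n = \<dots>" .
    qed
    also have "\<dots> = (\<Sum>d=1..N. \<Sum>k=1..N div d. \<chi> d * \<chi> k * mangoldt d / (real d * real k))"
      by (rule sum_divisors_swap)
    also have "\<dots> = (\<Sum>d=1..N. \<chi> d * mangoldt d / real d * (L + e d))"
      unfolding e_def by (intro sum.cong refl) (simp add: sum_distrib_left mult_ac)
    also have "\<dots> = L * S + (\<Sum>d=1..N. \<chi> d * mangoldt d / real d * e d)"
      unfolding S_def sum_distrib_left sum.distrib [symmetric]
      by (intro sum.cong refl) (simp only: distrib_left distrib_right mult.commute)
    finally have eq: "L * S = (\<Sum>n=1..N. \<chi> n * ln (real n) / real n) - (\<Sum>d=1..N. \<chi> d * mangoldt d / real d * e d)"
      by simp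
    have "\<bar>\<Sum>d=1..N. \<chi> d * mangoldt d / real d * e d\<bar> \<le> (\<Sum>d=1..N. mangoldt d * (2 * B / real N))"
    proof (intro order.trans[OF sum_abs] sum_mono)
      fix d assume d: "d \<in> {1..N}"
      have "\<bar>e d\<bar> \<le> 2 * B / real (Suc (N div d))"
        using L_error[of "N div d"] by (simp add: e_def abs_minus_commute)
      also have "N < d * Suc (N div d)" using d dividend_less_times_div[of d N] by simp
      then have "real N \<le> real d * real (Suc (N div d))" by (metis less_imp_le of_nat_le_iff of_nat_mult)
      then have "2 * B / real (Suc (N div d)) \<le> 2 * B * (real d / real N)"
        using B_nonneg N d mult_left_mono[of "real N" "real d * real (Suc (N div d))" "2 * B"]
        by (simp add: field_simps del: of_nat_Suc)
      finally have e: "\<bar>e d\<bar> \<le> 2 * B * (real d / real N)" .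
      have "\<bar>\<chi> d * mangoldt d / real d * e d\<bar> = \<bar>\<chi> d\<bar> * (mangoldt d / real d * \<bar>e d\<bar>)"
        by (simp add: abs_mult)
      also have "\<dots> \<le> 1 * (mangoldt d / real d * (2 * B * (real d / real N)))"
        using e abs_chi_le by (intro mult_mono) (auto simp: mangoldt_nonneg)
      also have "\<dots> = mangoldt d * (2 * B / real N)" using d by simp
      finally show "\<bar>\<chi> d * mangoldt d / real d * e d\<bar> \<le> mangoldt d * (2 * B / real N)" .
    qed
    also have "\<dots> = psi_fun N * (2 * B / real N)" unfolding psi_fun_def by (rule sum_distrib_right [symmetric])
    also have "\<dots> \<le> 6 * ln 2 * real N * (2 * B / real N)"
      using B_nonneg by (intro mult_right_mono psi_fun_le) auto
    also have "\<dots> = 2 * B * (6 * ln 2)" using N by simp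
    finally have "\<bar>L * S\<bar> \<le> C + 2 * B * (6 * ln 2)" unfolding eq using C[of N] by linarith
    then show ?thesis unfolding S_def [symmetric] using L_nonzero by (simp add: abs_mult field_simps)
  qed
  then show ?thesis by blast
qed

end

text \<open>Limits, uniformly in N, the contribution of an exceptional prime, one at which some
  character vanishes. From 1/p \<le> 1/2 the geometric series is at most 1.\<close>

lemma sum_mangoldt_prime_le:
  assumes p: "prime p"
  shows "(\<Sum>d\<in>{d\<in>{1..N}. primepow d \<and> aprimedivisor d = p}. mangoldt d / real d) \<le> ln (real p)"
proof -
  have p1: "p > 1" using p by (rule prime_gt_1_nat)
  have "{d\<in>{1..N}. primepow d \<and> aprimedivisor d = p} \<subseteq> (\<lambda>k. p ^ k) ` {1..N}"
  proof
    fix d assume "d \<in> {d\<in>{1..N}. primepow d \<and> aprimedivisor d = p}"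
    then have d: "d \<le> N" "primepow d" "aprimedivisor d = p" by auto
    then obtain r k where r: "prime r" "k > 0" "d = r ^ k" by (auto simp: primepow_def)
    then have "r = p" using d by (simp add: aprimedivisor_prime_power)
    have "k < d" using r p1 \<open>r = p\<close> by (simp add: power_gt_expt)
    with r d \<open>r = p\<close> show "d \<in> (\<lambda>k. p ^ k) ` {1..N}" by auto
  qed
  then have "(\<Sum>d\<in>{d\<in>{1..N}. primepow d \<and> aprimedivisor d = p}. mangoldt d / real d)
               \<le> (\<Sum>d\<in>(\<lambda>k. p ^ k) ` {1..N}. mangoldt d / real d)"
    by (intro sum_mono2) (auto simp: mangoldt_nonneg)
  also have "\<dots> = (\<Sum>k=1..N. ln (real p) * (1 / real p) ^ k)"
    using p p1 by (subst sum.reindex) (auto simp: inj_on_def power_one_over)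
  also have "\<dots> \<le> (\<Sum>k=1..N. ln (real p) * (1 / 2) ^ k)"
    using p1 by (intro sum_mono mult_left_mono power_mono) (auto simp: field_simps)
  also have "\<dots> = ln (real p) * (\<Sum>k=1..N. (1 / 2) ^ k)" by (simp add: sum_distrib_left)
  also have "(\<Sum>k=1..N. (1 / 2 :: real) ^ k) = 1 - (1 / 2) ^ N" by (induction N) auto
  also have "ln (real p) * (1 - (1 / 2) ^ N) \<le> ln (real p) * 1"
    using p1 by (intro mult_left_mono) auto
  finally show ?thesis by simp
qed

text \<open>Expanding $\prod_i (1 + \varepsilon_i \chi_i)$ turns a weighted count of prime powers in the
  prescribed class into Mertens sums, of which only the one of the empty product is unbounded.\<close>

lemma primepow_with_characters:
  fixes \<chi> :: "'i \<Rightarrow> nat \<Rightarrow> real" and \<epsilon> :: "'i \<Rightarrow> real"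
  assumes fin: "finite I" "finite Z" and Z: "\<And>p. p \<in> Z \<Longrightarrow> prime p"
    and mult: "\<And>i a b. i \<in> I \<Longrightarrow> \<chi> i (a * b) = \<chi> i a * \<chi> i b"
    and one: "\<And>i. i \<in> I \<Longrightarrow> \<chi> i 1 = 1"
    and vals: "\<And>i n. i \<in> I \<Longrightarrow> \<chi> i n \<in> {-1, 0, 1}"
    and sums: "\<And>S. S \<subseteq> I \<Longrightarrow> S \<noteq> {} \<Longrightarrow> \<exists>B. \<forall>k. \<bar>\<Sum>n=1..k. \<Prod>i\<in>S. \<chi> i n\<bar> \<le> B"
    and zero: "\<And>i n. i \<in> I \<Longrightarrow> primepow n \<Longrightarrow> \<chi> i n = 0 \<Longrightarrow> aprimedivisor n \<in> Z"
    and \<epsilon>: "\<And>i. i \<in> I \<Longrightarrow> \<epsilon> i \<in> {-1, 1}"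
  shows "\<exists>n. primepow n \<and> (\<forall>i\<in>I. \<chi> i n = \<epsilon> i)"
proof (rule ccontr)
  assume none: "\<not> ?thesis"
  have "\<exists>C. \<forall>N\<ge>1. \<bar>\<Sum>d=1..N. (\<Prod>i\<in>S. \<chi> i d) * mangoldt d / real d\<bar> \<le> C" if S: "S \<subseteq> I" "S \<noteq> {}" for S
  proof -
    obtain B where B: "\<And>k. \<bar>\<Sum>n=1..k. \<Prod>i\<in>S. \<chi> i n\<bar> \<le> B" using sums[OF S] by blast
    have "real_character (\<lambda>n. \<Prod>i\<in>S. \<chi> i n) B"
    proof
      show "(\<Prod>i\<in>S. \<chi> i (a * b)) = (\<Prod>i\<in>S. \<chi> i a) * (\<Prod>i\<in>S. \<chi> i b)" for a b
        using S mult by (simp flip: prod.distrib) (intro prod.cong, auto)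
      show "(\<Prod>i\<in>S. \<chi> i 1) = 1" using S one by (intro prod.neutral) auto
      have "finite S" using S fin finite_subset by blast
      then show "(\<Prod>i\<in>S. \<chi> i n) \<in> {-1, 0, 1}" for n using S(1)
      proof (induction S rule: finite_induct)
        case (insert x F)
        then have "\<chi> x n \<in> {-1, 0, 1}" "(\<Prod>i\<in>F. \<chi> i n) \<in> {-1, 0, 1}" using vals by auto
        with insert.hyps show ?case by auto
      qed simp
    qed (rule B)
    then show ?thesis by (rule real_character.mertens_bounded)
  qed
  then obtain C where C: "\<And>S N. S \<subseteq> I \<Longrightarrow> S \<noteq> {} \<Longrightarrow> N \<ge> 1 \<Longrightarrow>
      \<bar>\<Sum>d=1..N. (\<Prod>i\<in>S. \<chi> i d) * mangoldt d / real d\<bar> \<le> C S" by metis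
  define w where "w d = (\<Prod>i\<in>I. \<epsilon> i * \<chi> i d + 1)" for d
  have f: "\<epsilon> i * \<chi> i d + 1 \<in> {0, 1, 2}" if "i \<in> I" for i d using \<epsilon>[OF that] vals[OF that, of d] by auto
  have w_le: "w d \<le> 2 ^ card I" for d
  proof -
    have "w d \<le> (\<Prod>i\<in>I. 2)" unfolding w_def
    proof (intro prod_mono conjI)
      fix i assume "i \<in> I"
      from f[OF this, of d] show "0 \<le> \<epsilon> i * \<chi> i d + 1" "\<epsilon> i * \<chi> i d + 1 \<le> 2" by auto
    qed
    then show ?thesis by simp
  qed
  \<comment> \<open>If no prime power lies in the prescribed class, then each one outside the
    exceptional primes has a character value opposite to the prescribed sign, and the corresponding
    factor of \<open>w\<close> is 0.\<close>
  have w_zero: "w d = 0" if d: "primepow d" "aprimedivisor d \<notin> Z" for d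
  proof -
    obtain i where i: "i \<in> I" "\<chi> i d \<noteq> \<epsilon> i" using none d by blast
    have "\<chi> i d \<noteq> 0" using zero i d by blast
    then have "\<epsilon> i * \<chi> i d + 1 = 0" using \<epsilon>[OF i(1)] vals[OF i(1), of d] i(2) by auto
    then show ?thesis unfolding w_def using i(1) fin by auto
  qed
  \<comment> \<open>The 1 comes from the lower bound ln N - 1; the other terms bound the nonempty
    products of characters and the exceptional primes. As K does not depend on N, it cannot dominate
    ln N.\<close>
  define K where "K = 1 + (\<Sum>S\<in>Pow I - {{}}. C S) + 2 ^ card I * (\<Sum>p\<in>Z. ln (real p))"
  have "ln (real N) \<le> K" if N: "N \<ge> 1" for N
  proof -
    have "(\<Sum>d=1..N. w d * mangoldt d / real d) \<le> 2 ^ card I * (\<Sum>p\<in>Z. ln (real p))"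
    proof -
      let ?A = "\<lambda>p. {d\<in>{1..N}. primepow d \<and> aprimedivisor d = p}"
      have "(\<Sum>d=1..N. w d * mangoldt d / real d) = (\<Sum>d\<in>(\<Union>p\<in>Z. ?A p). w d * mangoldt d / real d)"
        by (intro sum.mono_neutral_right) (auto simp: mangoldt_def w_zero)
      also have "\<dots> \<le> (\<Sum>d\<in>(\<Union>p\<in>Z. ?A p). 2 ^ card I * (mangoldt d / real d))"
      proof (intro sum_mono)
        fix d
        have "w d * (mangoldt d / real d) \<le> 2 ^ card I * (mangoldt d / real d)"
          using w_le[of d] by (intro mult_right_mono) (auto simp: mangoldt_nonneg)
        then show "w d * mangoldt d / real d \<le> 2 ^ card I * (mangoldt d / real d)" by simp
      qed
      also have "\<dots> = 2 ^ card I * (\<Sum>p\<in>Z. \<Sum>d\<in>?A p. mangoldt d / real d)"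
        unfolding sum_distrib_left [symmetric] using fin
        by (subst sum.UNION_disjoint) auto
      also have "\<dots> \<le> 2 ^ card I * (\<Sum>p\<in>Z. ln (real p))"
        using Z by (intro mult_left_mono sum_mono sum_mangoldt_prime_le) auto
      finally show ?thesis .
    qed
    moreover have "(\<Sum>d=1..N. w d * mangoldt d / real d)
        = (\<Sum>S\<in>Pow I. (\<Prod>i\<in>S. \<epsilon> i) * (\<Sum>d=1..N. (\<Prod>i\<in>S. \<chi> i d) * mangoldt d / real d))"
    proof -
      have "w d = (\<Sum>S\<in>Pow I. (\<Prod>i\<in>S. \<epsilon> i) * (\<Prod>i\<in>S. \<chi> i d))" for d
        unfolding w_def using fin by (subst prod_add) (auto simp: prod.distrib)
      then show ?thesis
        by (simp add: sum_distrib_right sum_distrib_left sum_divide_distrib mult.assoc) (rule sum.swap)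
    qed
    moreover have "\<dots> = (\<Sum>d=1..N. mangoldt d / real d)
        + (\<Sum>S\<in>Pow I - {{}}. (\<Prod>i\<in>S. \<epsilon> i) * (\<Sum>d=1..N. (\<Prod>i\<in>S. \<chi> i d) * mangoldt d / real d))"
      using fin by (subst sum.remove[of _ "{}"]) auto
    moreover have "- (\<Sum>S\<in>Pow I - {{}}. (\<Prod>i\<in>S. \<epsilon> i) * (\<Sum>d=1..N. (\<Prod>i\<in>S. \<chi> i d) * mangoldt d / real d))
        \<le> (\<Sum>S\<in>Pow I - {{}}. C S)"
      unfolding sum_negf [symmetric]
    proof (intro sum_mono)
      fix S assume S: "S \<in> Pow I - {{}}"
      have "\<bar>\<Prod>i\<in>S. \<epsilon> i\<bar> = 1" unfolding abs_prod using S \<epsilon> by (intro prod.neutral) fastforce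
      then show "- ((\<Prod>i\<in>S. \<epsilon> i) * (\<Sum>d=1..N. (\<Prod>i\<in>S. \<chi> i d) * mangoldt d / real d)) \<le> C S"
        using C[of S N] S N
        by (intro order.trans[OF abs_ge_minus_self]) (simp add: abs_mult)
    qed
    ultimately show ?thesis using sum_mangoldt_over_ge[OF N] unfolding K_def by linarith
  qed
  moreover obtain N :: nat where N: "exp (K + 1) < real N" using reals_Archimedean2 by blast
  moreover have N0: "real N > 0" using exp_gt_zero N by (rule less_trans)
  moreover have "K + 1 < ln (real N)" using N N0 by (metis exp_gt_zero ln_exp ln_less_cancel_iff)
  moreover have "N \<ge> 1" using N0 by simp
  ultimately show False by fastforce
qed

text \<open>Multiplication by r permutes the residues and reverses all signs, so a full period sums
  to 0 and at most m terms remain. Periods are counted from 0 but the sum starts at 1; the term at 0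
  accounts for the bound m + 1.\<close>

lemma periodic_sum_bounded:
  fixes \<chi> :: "nat \<Rightarrow> real"
  assumes m: "m > 0" and per: "\<And>a b. [a = b] (mod m) \<Longrightarrow> \<chi> a = \<chi> b"
    and mult: "\<And>a b. \<chi> (a * b) = \<chi> a * \<chi> b" and bound: "\<And>n. \<bar>\<chi> n\<bar> \<le> 1"
    and r: "coprime r m" "\<chi> r = -1"
  shows "\<exists>B. \<forall>k. \<bar>\<Sum>n=1..k. \<chi> n\<bar> \<le> B"
proof -
  have "bij_betw (\<lambda>n. r * n mod m) {..<m} {..<m}"
  proof -
    have "inj_on (\<lambda>n. r * n mod m) {..<m}"
    proof (rule inj_onI)
      fix a b assume ab: "a \<in> {..<m}" "b \<in> {..<m}" "r * a mod m = r * b mod m"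
      then have "[r * a = r * b] (mod m)" by (simp add: cong_def)
      then have "[a = b] (mod m)" using r(1) by (simp add: cong_mult_lcancel_nat)
      then show "a = b" using ab by (simp add: cong_def)
    qed
    moreover have "(\<lambda>n. r * n mod m) ` {..<m} \<subseteq> {..<m}" using m by auto
    ultimately show ?thesis by (simp add: bij_betw_def endo_inj_surj)
  qed
  then have "(\<Sum>n<m. \<chi> (r * n mod m)) = (\<Sum>n<m. \<chi> n)"
    by (rule sum.reindex_bij_betw)
  moreover have "\<chi> (r * n mod m) = - \<chi> n" for n
    using per[of "r * n mod m" "r * n"] r(2) by (simp add: mult cong_def)
  ultimately have zero: "(\<Sum>n<m. \<chi> n) = 0" by (simp add: sum_negf)
  have block: "(\<Sum>n<q * m + s. \<chi> n) = (\<Sum>n<s. \<chi> n)" for q s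
  proof (induction q)
    case (Suc q)
    have "(\<Sum>n<m + (q * m + s). \<chi> n) = (\<Sum>n<m. \<chi> n) + (\<Sum>n=m..<m + (q * m + s). \<chi> n)"
      by (simp add: lessThan_atLeast0 sum.atLeastLessThan_concat)
    also have "(\<Sum>n=m..<m + (q * m + s). \<chi> n) = (\<Sum>n<q * m + s. \<chi> (n + m))"
      using sum.shift_bounds_nat_ivl[of \<chi> 0 m "q * m + s"] by (simp add: lessThan_atLeast0 add.commute)
    also have "\<dots> = (\<Sum>n<q * m + s. \<chi> n)"
      by (intro sum.cong refl per) (simp add: cong_def)
    finally show ?case using zero Suc by (simp add: add.assoc)
  qed simp
  have small: "\<bar>\<Sum>n<s. \<chi> n\<bar> \<le> real s" for s
  proof -
    have "\<bar>\<Sum>n<s. \<chi> n\<bar> \<le> (\<Sum>n<s. \<bar>\<chi> n\<bar>)" by (rule sum_abs)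
    also have "\<dots> \<le> (\<Sum>n<s. 1)" by (intro sum_mono bound)
    finally show ?thesis by simp
  qed
  have "\<bar>\<Sum>n=1..k. \<chi> n\<bar> \<le> real m + 1" for k
  proof -
    have "(\<Sum>n<Suc k. \<chi> n) = (\<Sum>n<Suc k mod m. \<chi> n)"
      using block[of "Suc k div m" "Suc k mod m"] by simp
    then have "\<bar>\<Sum>n<Suc k. \<chi> n\<bar> \<le> real m"
      using small[of "Suc k mod m"] m by (smt (verit) mod_less_divisor of_nat_less_iff)
    moreover have "(\<Sum>n<Suc k. \<chi> n) = \<chi> 0 + (\<Sum>n=1..k. \<chi> n)"
      by (simp add: lessThan_Suc_atMost sum.atMost_shift sum.atLeast1_atMost_eq)
    ultimately show ?thesis using bound[of 0] by linarith
  qed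
  then show ?thesis by blast
qed

section \<open>Primes with prescribed residue symbols\<close>

lemma Legendre_vals: "Legendre a p \<in> {-1, 0, 1}"
  by (auto simp: Legendre_def)

lemma Legendre_cong: "[a = b] (mod p) \<Longrightarrow> Legendre a p = Legendre b p"
proof -
  assume ab: "[a = b] (mod p)"
  then have "[a = 0] (mod p) \<longleftrightarrow> [b = 0] (mod p)"
    by (meson cong_sym cong_trans)
  moreover have "QuadRes p a \<longleftrightarrow> QuadRes p b"
    unfolding QuadRes_def using ab by (meson cong_sym cong_trans)
  ultimately show ?thesis by (simp add: Legendre_def)
qed

text \<open>Euler's criterion gives Legendre symbols only modulo p; for p > 2 the values -1, 0, 1
  are distinct residues, so such congruences are equations.\<close>

lemma sign_eq_of_cong:
  fixes a b :: int
  assumes "a \<in> {-1, 0, 1}" "b \<in> {-1, 0, 1}" "[a = b] (mod int p)" "p > 2"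
  shows "a = b"
proof (rule ccontr)
  assume ne: "a \<noteq> b"
  have "int p dvd a - b" using assms(3) by (simp add: cong_iff_dvd_diff)
  then have "int p \<le> \<bar>a - b\<bar>" using ne by (intro zdvd_imp_le) auto
  then show False using assms by auto
qed

lemma Legendre_mult:
  assumes "prime p" "p > 2"
  shows "Legendre (a * b) (int p) = Legendre a (int p) * Legendre b (int p)"
proof (rule sign_eq_of_cong)
  have "[Legendre (a * b) p = (a * b) ^ ((p - 1) div 2)] (mod p)"
    using assms by (rule euler_criterion)
  also have "(a * b) ^ ((p - 1) div 2) = a ^ ((p - 1) div 2) * b ^ ((p - 1) div 2)"
    by (rule power_mult_distrib)
  also have "[\<dots> = Legendre a p * Legendre b p] (mod p)"
    using assms by (intro cong_mult cong_sym[OF euler_criterion])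
  finally show "[Legendre (a * b) p = Legendre a p * Legendre b p] (mod p)" .
qed (use assms Legendre_vals[of a p] Legendre_vals[of b p] Legendre_vals[of "a * b" p] in auto)

lemma Legendre_one: "prime p \<Longrightarrow> p > 2 \<Longrightarrow> Legendre 1 (int p) = 1"
  using prime_gt_1_nat[of p] unfolding Legendre_def QuadRes_def
  by (auto simp: cong_def intro: exI[of _ 1])

lemma Legendre_eq_0: "Legendre a p = 0 \<longleftrightarrow> p dvd a"
  by (auto simp: Legendre_def cong_0_iff)

lemma Legendre_minus_one:
  assumes "prime p" "p > 2"
  shows "Legendre (-1) (int p) = (if p mod 4 = 1 then 1 else -1)"
proof (rule sign_eq_of_cong)
  have "odd p" using assms prime_odd_nat by blast
  then have "even ((p - 1) div 2) \<longleftrightarrow> p mod 4 = 1" by presburger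
  then have "(-1 :: int) ^ ((p - 1) div 2) = (if p mod 4 = 1 then 1 else -1)"
    by (simp add: uminus_power_if)
  then show "[Legendre (-1) p = (if p mod 4 = 1 then 1 else -1)] (mod p)"
    using euler_criterion[OF assms, of "-1"] by metis
qed (use assms Legendre_vals in auto)

text \<open>Otherwise all p - 1 nonzero residues would be roots of x^((p-1)/2) - 1, by Euler's
  criterion.\<close>

lemma ex_nonresidue:
  assumes "prime p" "p > 2"
  shows "\<exists>a::nat. Legendre (int a) (int p) = -1"
proof (rule ccontr)
  assume none: "\<not> ?thesis"
  let ?k = "(p - 1) div 2"
  have "[a ^ ?k = 1] (mod p)" if "a \<in> {1..<p}" for a
  proof -
    have "\<not> int p dvd int a" using that by (auto dest: nat_dvd_not_less)
    then have "Legendre (int a) p = 1" using none Legendre_vals[of "int a" "int p"] Legendre_eq_0 by blast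
    then have "[1 = int a ^ ?k] (mod p)" using euler_criterion[OF assms, of "int a"] by simp
    then have "[int (a ^ ?k) = int 1] (mod int p)" by (simp add: cong_sym)
    then show ?thesis by (simp only: cong_int_iff)
  qed
  then have "{1..<p} \<subseteq> {x\<in>{..<p}. [x ^ ?k = 1] (mod p)}" by auto
  then have "card {1..<p} \<le> card {x\<in>{..<p}. [x ^ ?k = 1] (mod p)}" by (intro card_mono) auto
  also have "\<dots> \<le> ?k" using assms by (intro roots_mod_prime_bound) auto
  finally show False using assms by simp
qed

definition chi4 :: "nat \<Rightarrow> int" where
  "chi4 n = (if even n then 0 else if n mod 4 = 1 then 1 else -1)"

lemma chi4_cong: "[a = b] (mod 4) \<Longrightarrow> chi4 a = chi4 b"
  unfolding chi4_def cong_def by presburger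

lemma chi4_mult: "chi4 (a * b) = chi4 a * chi4 b"
proof -
  have small: "chi4 (x * y) = chi4 x * chi4 y" if "x \<in> {0, 1, 2, 3}" "y \<in> {0, 1, 2, 3}" for x y
    using that by (elim insertE emptyE) (simp_all add: chi4_def)
  have "chi4 (a * b) = chi4 ((a mod 4) * (b mod 4))"
    by (rule chi4_cong) (simp add: cong_def mod_mult_eq)
  also have "\<dots> = chi4 (a mod 4) * chi4 (b mod 4)"
    by (rule small) auto
  also have "chi4 (a mod 4) = chi4 a" by (rule chi4_cong) (simp add: cong_def)
  also have "chi4 (b mod 4) = chi4 b" by (rule chi4_cong) (simp add: cong_def)
  finally show ?thesis .
qed

lemma chi4_one: "chi4 1 = 1" by (simp add: chi4_def)

text \<open>The index 4, which is not a prime, stands for the nontrivial character modulo 4.\<close>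

definition kron :: "nat \<Rightarrow> nat \<Rightarrow> int" where
  "kron q n = (if q = 4 then chi4 n else Legendre (int n) (int q))"

lemma kron_props:
  assumes "q = 4 \<or> (prime q \<and> q > 2)"
  shows "kron q (a * b) = kron q a * kron q b" "kron q 1 = 1" "kron q a \<in> {-1, 0, 1}"
    "[a = b] (mod q) \<Longrightarrow> kron q a = kron q b" "\<exists>r. kron q r = -1 \<and> coprime r q"
proof -
  have not4: "q \<noteq> 4" if "prime q" using that by auto
  show "kron q (a * b) = kron q a * kron q b"
    using assms by (auto simp: kron_def chi4_mult Legendre_mult)
  show "kron q 1 = 1" using assms Legendre_one[of q] chi4_one by (auto simp: kron_def)
  show "kron q a \<in> {-1, 0, 1}" using Legendre_vals[of a q] by (auto simp: kron_def chi4_def)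
  show "[a = b] (mod q) \<Longrightarrow> kron q a = kron q b"
    using assms Legendre_cong[of a b q] by (auto simp: kron_def chi4_cong cong_int_iff)
  show "\<exists>r. kron q r = -1 \<and> coprime r q"
  proof (cases "q = 4")
    case True
    have "coprime 3 (4 :: nat)" using coprime_Suc_right_nat[of 3] by simp
    then show ?thesis using True by (intro exI[of _ 3]) (auto simp: kron_def chi4_def)
  next
    case False
    then obtain r where r: "Legendre (int r) (int q) = -1" using assms ex_nonresidue by blast
    then have "\<not> q dvd r" using Legendre_eq_0[of "int r" "int q"] by auto
    then have "coprime r q" using assms False by (metis coprime_commute prime_imp_coprime)
    then show ?thesis using r False by (auto simp: kron_def)
  qed
qed

lemma primepow_with_residues:
  assumes P: "finite P" "\<And>p. p \<in> P \<Longrightarrow> prime p \<and> p > 2"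
    and e: "\<And>p. p \<in> P \<Longrightarrow> e p \<in> {-1, 1 :: int}"
  shows "\<exists>n. primepow n \<and> n mod 4 = 1 \<and> (\<forall>p\<in>P. Legendre (int n) (int p) = e p)"
proof -
  define I where "I = insert 4 P"
  have I: "q = 4 \<or> (prime q \<and> q > 2)" if "q \<in> I" for q using that P by (auto simp: I_def)
  have finI: "finite I" using P by (simp add: I_def)
  have cop: "coprime i j" if "i \<in> I" "j \<in> I" "i \<noteq> j" for i j
  proof -
    have 4: "coprime 4 p" if "prime p" "p > 2" for p :: nat
    proof -
      have "odd p" using that prime_odd_nat by blast
      then have "coprime ((2::nat) ^ 2) p" by (simp only: coprime_power_left_iff coprime_left_2_iff_odd simp_thms)
      moreover have "(2::nat) ^ 2 = 4" by simp
      ultimately show ?thesis by metis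
    qed
    show ?thesis using I[OF that(1)] I[OF that(2)] that(3) 4 primes_coprime by (metis coprime_commute)
  qed
  have "\<exists>n. primepow n \<and> (\<forall>i\<in>I. real_of_int (kron i n) = (if i = 4 then 1 else real_of_int (e i)))"
  \<comment> \<open>The exceptional primes: 2 for the character modulo 4, and each p for its own
    Legendre symbol.\<close>
  proof (rule primepow_with_characters[where Z = "insert 2 P"])
    fix S assume S: "S \<subseteq> I" "S \<noteq> {}"
    have finS: "finite S" using S finI finite_subset by blast
    obtain i where i: "i \<in> S" using S by blast
    obtain s where s: "kron i s = -1" "coprime s i" using kron_props(5)[OF I] S i by blast
    \<comment> \<open>The Chinese remainder theorem makes one chosen character of the product equal
      to -1 at r and all others equal to 1. Hence no nonempty product is principal.\<close>
    have "\<exists>x. \<forall>j\<in>S. [x = (if j = i then s else 1)] (mod j)"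
      using S cop finS by (intro chinese_remainder_nat) auto
    then obtain r where r: "\<And>j. j \<in> S \<Longrightarrow> [r = (if j = i then s else 1)] (mod j)" by blast
    have kr: "kron j r = (if j = i then -1 else 1)" if "j \<in> S" for j
      using kron_props(2)[OF I, of j] kron_props(4)[OF I, of j, OF _ r[OF that]] S that s(1) by auto
    show "\<exists>B. \<forall>k. \<bar>\<Sum>n=1..k. \<Prod>j\<in>S. real_of_int (kron j n)\<bar> \<le> B"
    proof (rule periodic_sum_bounded[where m = "\<Prod>S" and r = r])
      show "\<Prod>S > 0" using S I by (intro prod_pos) fastforce
      show "(\<Prod>j\<in>S. real_of_int (kron j a)) = (\<Prod>j\<in>S. real_of_int (kron j b))" if "[a = b] (mod \<Prod>S)" for a b
      proof (intro prod.cong refl)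
        fix j assume j: "j \<in> S"
        then have "[a = b] (mod j)" using that finS by (metis cong_dvd_modulus_nat dvd_prodI)
        then show "real_of_int (kron j a) = real_of_int (kron j b)" using kron_props(4)[OF I] S j by auto
      qed
      show "(\<Prod>j\<in>S. real_of_int (kron j (a * b))) = (\<Prod>j\<in>S. real_of_int (kron j a)) * (\<Prod>j\<in>S. real_of_int (kron j b))" for a b
        using S kron_props(1)[OF I] by (simp flip: prod.distrib) (intro prod.cong, auto)
      show "\<bar>\<Prod>j\<in>S. real_of_int (kron j n)\<bar> \<le> 1" for n
        unfolding abs_prod
      proof (intro prod_le_1 conjI)
        fix j assume "j \<in> S"
        then have "j \<in> I" using S by blast
        then show "\<bar>real_of_int (kron j n)\<bar> \<le> 1" using kron_props(3)[OF I, of j n] by auto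
      qed auto
      show "coprime r (\<Prod>S)"
      proof (rule prod_coprime_right)
        fix j assume j: "j \<in> S"
        then have "coprime (if j = i then s else 1) j" using s by auto
        then show "coprime r j" using r[OF j] cong_imp_coprime cong_sym by blast
      qed
      have "(\<Prod>j\<in>S. kron j r) = kron i r * (\<Prod>j\<in>S-{i}. kron j r)"
        using finS i by (rule prod.remove)
      also have "(\<Prod>j\<in>S-{i}. kron j r) = 1" by (intro prod.neutral) (auto simp: kr)
      finally show "(\<Prod>j\<in>S. real_of_int (kron j r)) = -1"
        using kr[OF i] by (simp flip: of_int_prod)
    qed
  next
    fix i n assume i: "i \<in> I" and n: "primepow n" "real_of_int (kron i n) = 0"
    obtain p k where pk: "prime p" "k > 0" "n = p ^ k" using n(1) by (auto simp: primepow_def)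
    then have ap: "aprimedivisor n = p" by (simp add: aprimedivisor_prime_power)
    show "aprimedivisor n \<in> insert 2 P"
    proof (cases "i = 4")
      case True
      then have "even n" using n(2) by (auto simp: kron_def chi4_def split: if_splits)
      then have "2 dvd p" using pk by (simp add: prime_dvd_power_iff)
      then show ?thesis using pk ap by (metis insertI1 primes_dvd_imp_eq two_is_prime_nat)
    next
      case False
      then have "i dvd n" using n(2) by (auto simp: kron_def Legendre_eq_0)
      then have "i dvd p" using pk I[OF i] False by (meson prime_dvd_power)
      then have "i = p" using pk I[OF i] False by (simp add: primes_dvd_imp_eq)
      then show ?thesis using i False ap by (auto simp: I_def)
    qed
  next
    show "real_of_int (kron i (a * b)) = real_of_int (kron i a) * real_of_int (kron i b)" if "i \<in> I" for i a b
      using kron_props(1)[OF I[OF that]] by simp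
    show "real_of_int (kron i 1) = 1" if "i \<in> I" for i
      using kron_props(2)[OF I[OF that]] by simp
    show "real_of_int (kron i n) \<in> {-1, 0, 1}" if "i \<in> I" for i n
      using kron_props(3)[OF I[OF that], of n] by auto
    show "(if i = 4 then 1 else real_of_int (e i)) \<in> {-1, 1}" if "i \<in> I" for i
      using that e[of i] by (auto simp: I_def)
  qed (use finI P in auto)
  then obtain n where n: "primepow n" "\<And>i. i \<in> I \<Longrightarrow> real_of_int (kron i n) = (if i = 4 then 1 else real_of_int (e i))" by blast
  have "n mod 4 = 1" using n(2)[of 4] by (auto simp: I_def kron_def chi4_def split: if_splits)
  moreover have "Legendre (int n) (int p) = e p" if p: "p \<in> P" for p
  proof -
    have "p \<noteq> 4" using P(2)[OF p] by auto
    then show ?thesis using n(2)[of p] p by (auto simp: I_def kron_def)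
  qed
  ultimately show ?thesis using n(1) by blast
qed

section \<open>Sums of three squares\<close>

lemma ex_int_sqrt:
  fixes N :: int
  assumes "N > 0" "\<nexists>s. N = s\<^sup>2"
  shows "\<exists>s\<ge>0. s\<^sup>2 < N \<and> N < (s + 1)\<^sup>2"
proof -
  define s where "s = \<lfloor>sqrt (real_of_int N)\<rfloor>"
  have s0: "s \<ge> 0" using assms by (simp add: s_def)
  have "real_of_int s \<le> sqrt N" by (simp add: s_def)
  then have "(real_of_int s)\<^sup>2 \<le> (sqrt N)\<^sup>2" using s0 by (intro power_mono) auto
  then have "real_of_int (s\<^sup>2) \<le> real_of_int N" using assms by simp
  then have "s\<^sup>2 \<le> N" by (simp only: of_int_le_iff)
  then have "s\<^sup>2 < N" using assms(2) by (metis order_le_less)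
  have "sqrt N < real_of_int (s + 1)" unfolding s_def by linarith
  then have "(sqrt N)\<^sup>2 < (real_of_int (s + 1))\<^sup>2" using assms s0 by (intro power_strict_mono) auto
  then have "real_of_int N < real_of_int ((s + 1)\<^sup>2)" using assms by simp
  then have "N < (s + 1)\<^sup>2" by (simp only: of_int_less_iff)
  with s0 \<open>s\<^sup>2 < N\<close> show ?thesis by blast
qed

lemma abs_diff_square_le:
  fixes a b s :: int
  assumes "a \<in> {0..s}" "b \<in> {0..s}"
  shows "(a - b)\<^sup>2 \<le> s\<^sup>2"
proof -
  have "0 \<le> a" "a \<le> s" "0 \<le> b" "b \<le> s" using assms by simp_all
  then have "\<bar>a - b\<bar> \<le> \<bar>s\<bar>" by linarith
  then show ?thesis by (simp only: abs_le_square_iff)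
qed

text \<open>Thue's argument: more than M pairs (t, w) force a coincidence of t - \<alpha> w modulo
  M, and the differences satisfy M | T^2 + W^2 < 2M. That M is not a square makes the last
  inequality strict.\<close>

lemma two_squares_of_residue:
  fixes M \<alpha> :: int
  assumes M: "M > 0" "\<nexists>s. M = s\<^sup>2" and \<alpha>: "M dvd \<alpha>\<^sup>2 + 1"
  shows "\<exists>x y. M = x\<^sup>2 + y\<^sup>2"
proof -
  obtain s where s: "s \<ge> 0" "s\<^sup>2 < M" "M < (s + 1)\<^sup>2" using ex_int_sqrt[OF M] by blast
  let ?A = "{0..s} \<times> {0..s}" and ?f = "\<lambda>(t, w). (t - \<alpha> * w) mod M"
  have "?f ` ?A \<subseteq> {0..<M}" using M by auto
  then have "card (?f ` ?A) \<le> nat M" using card_mono[of "{0..<M}"] by simp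
  also have "\<dots> < card ?A" using s M by (simp add: card_cartesian_product power2_eq_square nat_mult_distrib flip: nat_mult_distrib)
  finally have "\<not> inj_on ?f ?A" using pigeonhole by blast
  then obtain t w t' w' where tw: "t \<in> {0..s}" "w \<in> {0..s}" "t' \<in> {0..s}" "w' \<in> {0..s}"
      "(t, w) \<noteq> (t', w')" "(t - \<alpha> * w) mod M = (t' - \<alpha> * w') mod M"
    by (auto simp: inj_on_def)
  define T W where "T = t - t'" and "W = w - w'"
  have "M dvd (t - \<alpha> * w) - (t' - \<alpha> * w')" using tw(6) by (simp add: mod_eq_dvd_iff)
  then have dvd: "M dvd T - \<alpha> * W" by (simp add: T_def W_def algebra_simps)
  have "M dvd (T - \<alpha> * W) * (T + \<alpha> * W) + (\<alpha>\<^sup>2 + 1) * W\<^sup>2"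
    by (rule dvd_add[OF dvd_mult2[OF dvd] dvd_mult2[OF \<alpha>]])
  then have "M dvd T\<^sup>2 + W\<^sup>2" by (simp add: power2_eq_square algebra_simps)
  then obtain k where k: "T\<^sup>2 + W\<^sup>2 = M * k" by (auto elim: dvdE)
  have "T\<^sup>2 < M" "W\<^sup>2 < M" using abs_diff_square_le tw s unfolding T_def W_def by (meson le_less_trans)+
  then have "M * k < M * 2" using k by linarith
  moreover have "T\<^sup>2 + W\<^sup>2 > 0" using tw(5) by (simp add: T_def W_def sum_power2_gt_zero_iff)
  then have "M * k > 0" using k by simp
  then have "k > 0" using M(1) by (simp add: zero_less_mult_iff)
  ultimately have "k = 1" using M(1) by (simp add: mult_less_cancel_left_pos)
  then show ?thesis using k by auto
qed

text \<open>The pigeonhole principle makes $T^2 + q W^2 - M Z^2$ equal to $0$ or $M q$; in the latter case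
  $T^2 + q W^2 = M (Z^2 + q)$ is multiplied by the norm $Z^2 + q$.\<close>

lemma legendre_equation:
  fixes M q \<alpha> \<beta> :: int
  assumes M: "M > 0" "\<nexists>s. M = s\<^sup>2" and q: "q > 0" "\<nexists>s. q = s\<^sup>2" and Mq: "\<nexists>s. M * q = s\<^sup>2"
    and cop: "coprime M q" and \<alpha>: "M dvd \<alpha>\<^sup>2 + q" and \<beta>: "q dvd \<beta>\<^sup>2 - M"
  shows "\<exists>T W Z. Z \<noteq> 0 \<and> T\<^sup>2 + q * W\<^sup>2 = M * Z\<^sup>2"
proof -
  have Mq0: "M * q > 0" using M q by simp
  obtain r where r: "r \<ge> 0" "r\<^sup>2 < M * q" "M * q < (r + 1)\<^sup>2" using ex_int_sqrt[OF Mq0 Mq] by blast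
  obtain s where s: "s \<ge> 0" "s\<^sup>2 < M" "M < (s + 1)\<^sup>2" using ex_int_sqrt[OF M] by blast
  obtain u where u: "u \<ge> 0" "u\<^sup>2 < q" "q < (u + 1)\<^sup>2" using ex_int_sqrt[OF q] by blast
  \<comment> \<open>The sides are about the square roots of M q, M and q. This gives more points
    than the M q pairs of residues, and T^2, q W^2 and M Z^2 all stay below M q, so the form lies
    strictly between -M q and 2 M q.\<close>
  let ?A = "{0..r} \<times> {0..s} \<times> {0..u}" and ?f = "\<lambda>(t, w, z). ((t - \<alpha> * w) mod M, (t - \<beta> * z) mod q)"
  have "?f ` ?A \<subseteq> {0..<M} \<times> {0..<q}" using M q by auto
  then have "card (?f ` ?A) \<le> card ({0..<M} \<times> {0..<q})" by (intro card_mono) auto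
  also have "\<dots> = nat (M * q)" using M q by (simp add: card_cartesian_product nat_mult_distrib)
  also have "\<dots> < card ?A"
  proof -
    have "(M * q) * (M * q) < (r + 1)\<^sup>2 * ((s + 1)\<^sup>2 * (u + 1)\<^sup>2)"
      using r s u M q Mq0 by (intro mult_strict_mono) auto
    then have "(M * q)\<^sup>2 < ((r + 1) * ((s + 1) * (u + 1)))\<^sup>2" by (simp add: power_mult_distrib power2_eq_square mult_ac)
    then have "M * q < (r + 1) * ((s + 1) * (u + 1))"
      by (rule power2_less_imp_less) (use r s u in auto)
    then have "nat (M * q) < nat ((r + 1) * ((s + 1) * (u + 1)))" using Mq0 by linarith
    also have "\<dots> = card ?A" using r s u by (simp add: card_cartesian_product nat_mult_distrib)
    finally show ?thesis .
  qed
  finally have "\<not> inj_on ?f ?A" using pigeonhole by blast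
  then obtain t w z t' w' z' where tw: "t \<in> {0..r}" "w \<in> {0..s}" "z \<in> {0..u}" "t' \<in> {0..r}" "w' \<in> {0..s}" "z' \<in> {0..u}"
      "(t, w, z) \<noteq> (t', w', z')" "(t - \<alpha> * w) mod M = (t' - \<alpha> * w') mod M" "(t - \<beta> * z) mod q = (t' - \<beta> * z') mod q"
    by (auto simp: inj_on_def)
  define T W Z where "T = t - t'" and "W = w - w'" and "Z = z - z'"
  define F where "F = T\<^sup>2 + q * W\<^sup>2 - M * Z\<^sup>2"
  have "M dvd (t - \<alpha> * w) - (t' - \<alpha> * w')" using tw(8) by (simp add: mod_eq_dvd_iff)
  then have d1: "M dvd T - \<alpha> * W" by (simp add: T_def W_def algebra_simps)
  have "q dvd (t - \<beta> * z) - (t' - \<beta> * z')" using tw(9) by (simp add: mod_eq_dvd_iff)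
  then have d2: "q dvd T - \<beta> * Z" by (simp add: T_def Z_def algebra_simps)
  have "M dvd (T - \<alpha> * W) * (T + \<alpha> * W) + (\<alpha>\<^sup>2 + q) * W\<^sup>2 - M * Z\<^sup>2"
    by (rule dvd_diff[OF dvd_add[OF dvd_mult2[OF d1] dvd_mult2[OF \<alpha>]] dvd_triv_left])
  then have "M dvd F" by (simp add: F_def power2_eq_square algebra_simps)
  moreover have "q dvd (T - \<beta> * Z) * (T + \<beta> * Z) + (\<beta>\<^sup>2 - M) * Z\<^sup>2 + q * W\<^sup>2"
    by (rule dvd_add[OF dvd_add[OF dvd_mult2[OF d2] dvd_mult2[OF \<beta>]] dvd_triv_left])
  then have "q dvd F" by (simp add: F_def power2_eq_square algebra_simps)
  ultimately have "M * q dvd F" using cop by (rule divides_mult)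
  then obtain k where k: "F = M * q * k" by (auto elim: dvdE)
  have bounds: "T\<^sup>2 < M * q" "W\<^sup>2 < M" "Z\<^sup>2 < q"
    using abs_diff_square_le tw r s u unfolding T_def W_def Z_def by (meson le_less_trans)+
  then have b2: "q * W\<^sup>2 < q * M" "M * Z\<^sup>2 < M * q" using M q by auto
  have pos: "0 \<le> T\<^sup>2" "0 \<le> q * W\<^sup>2" "0 \<le> M * Z\<^sup>2" using M q by auto
  have F2: "F < M * q * 2" unfolding F_def using bounds b2 pos by (simp add: mult.commute)
  have F1: "M * q * (-1) < F" unfolding F_def using bounds b2 pos by linarith
  have "-1 < k" "k < 2" using F1 F2 unfolding k by (simp_all only: mult_less_cancel_left_pos[OF Mq0])
  then consider "k = 0" | "k = 1" by linarith
  then show ?thesis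
  proof cases
    case 1
    then have eq: "T\<^sup>2 + q * W\<^sup>2 = M * Z\<^sup>2" using k by (simp add: F_def)
    moreover have "Z \<noteq> 0"
    proof
      assume "Z = 0"
      then have "T\<^sup>2 = 0" "q * W\<^sup>2 = 0" using eq pos by (simp_all add: add_nonneg_eq_0_iff)
      then have "T = 0" "W = 0" using q by auto
      with \<open>Z = 0\<close> tw(7) show False by (simp add: T_def W_def Z_def)
    qed
    ultimately show ?thesis by blast
  next
    case 2
    have "(T * Z - q * W)\<^sup>2 + q * (T + W * Z)\<^sup>2 = (T\<^sup>2 + q * W\<^sup>2) * (Z\<^sup>2 + q)"
      by (simp add: power2_eq_square algebra_simps)
    also have "T\<^sup>2 + q * W\<^sup>2 = M * (Z\<^sup>2 + q)" using k 2 by (simp add: F_def algebra_simps)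
    finally have "(T * Z - q * W)\<^sup>2 + q * (T + W * Z)\<^sup>2 = M * (Z\<^sup>2 + q)\<^sup>2" by (simp add: power2_eq_square)
    moreover have "Z\<^sup>2 + q > 0" using q by (simp add: add_nonneg_pos)
    ultimately show ?thesis by (intro exI[of _ "T * Z - q * W"] exI[of _ "T + W * Z"] exI[of _ "Z\<^sup>2 + q"]) auto
  qed
qed

lemma ex_nearest:
  fixes a z :: int
  assumes "z > 0"
  shows "\<exists>a' r. a = z * a' + r \<and> 4 * r\<^sup>2 \<le> z\<^sup>2"
proof -
  define a' where "a' = (2 * a + z) div (2 * z)"
  have "2 * a + z = 2 * z * a' + (2 * a + z) mod (2 * z)" by (simp add: a'_def)
  moreover have "0 \<le> (2 * a + z) mod (2 * z)" "(2 * a + z) mod (2 * z) < 2 * z" using assms by auto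
  ultimately have "\<bar>2 * (a - z * a')\<bar> \<le> \<bar>z\<bar>" by (simp add: algebra_simps)
  define r where "r = a - z * a'"
  have "\<bar>2 * r\<bar> \<le> \<bar>z\<bar>" using \<open>\<bar>2 * (a - z * a')\<bar> \<le> \<bar>z\<bar>\<close> by (simp only: r_def)
  then have "(2 * r)\<^sup>2 \<le> z\<^sup>2" by (simp only: abs_le_square_iff)
  then have "4 * r\<^sup>2 \<le> z\<^sup>2" by (simp add: power_mult_distrib)
  moreover have "a = z * a' + r" by (simp add: r_def)
  ultimately show ?thesis by blast
qed

text \<open>Davenport--Cassels: the line through a rational point of the sphere and a nearest integer
  point meets the sphere in a second point, whose denominator is smaller.\<close>

lemma davenport_cassels:
  fixes M :: int
  assumes "M * z\<^sup>2 = a\<^sup>2 + b\<^sup>2 + c\<^sup>2" "z \<noteq> 0"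
  shows "\<exists>x y w. M = x\<^sup>2 + y\<^sup>2 + w\<^sup>2"
  using assms
proof (induction "nat \<bar>z\<bar>" arbitrary: a b c z rule: less_induct)
  case less
  define t where "t = \<bar>z\<bar>"
  have t: "t > 0" "M * t\<^sup>2 = a\<^sup>2 + b\<^sup>2 + c\<^sup>2" using less.prems by (auto simp: t_def)
  obtain a' r1 where 1: "a = t * a' + r1" "4 * r1\<^sup>2 \<le> t\<^sup>2" using ex_nearest[OF t(1)] by blast
  obtain b' r2 where 2: "b = t * b' + r2" "4 * r2\<^sup>2 \<le> t\<^sup>2" using ex_nearest[OF t(1)] by blast
  obtain c' r3 where 3: "c = t * c' + r3" "4 * r3\<^sup>2 \<le> t\<^sup>2" using ex_nearest[OF t(1)] by blast
  define R where "R = r1\<^sup>2 + r2\<^sup>2 + r3\<^sup>2"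
  define n where "n = a'\<^sup>2 + b'\<^sup>2 + c'\<^sup>2"
  define d where "d = a * a' + b * b' + c * c'"
  \<comment> \<open>The new denominator: t times the squared distance between the rational point and
    its nearest integer point. It is an integer and equals R/t, which is at most 3t/4 because each
    coordinate is off by at most 1/2.\<close>
  define z' where "z' = t * n + M * t - 2 * d"
  have R: "t * z' = R"
  proof -
    have "t * z' = t\<^sup>2 * n + M * t\<^sup>2 - 2 * (t * d)" by (simp add: z'_def power2_eq_square algebra_simps)
    also have "\<dots> = R" unfolding t(2) by (simp add: 1(1) 2(1) 3(1) n_def d_def R_def power2_eq_square algebra_simps)
    finally show ?thesis .
  qed
  show ?case
  proof (cases "R = 0")
    case True
    then have "r1 = 0" "r2 = 0" "r3 = 0" unfolding R_def
      by (smt (verit) power_eq_0_iff zero_le_power2)+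
    then have "M * t\<^sup>2 = n * t\<^sup>2" using t(2) by (simp add: 1(1) 2(1) 3(1) n_def power_mult_distrib algebra_simps)
    then have "M = n" using t(1) by simp
    then show ?thesis unfolding n_def by blast
  next
    case False
    moreover have "R \<ge> 0" by (simp add: R_def)
    ultimately have "R > 0" by simp
    then have z'pos: "z' > 0" using R t(1) by (metis zero_less_mult_pos)
    have "4 * R \<le> 3 * t\<^sup>2" using 1(2) 2(2) 3(2) by (simp add: R_def)
    then have "t * (4 * z') \<le> t * (3 * t)" using R by (simp add: power2_eq_square algebra_simps)
    then have "4 * z' \<le> 3 * t" using t(1) by simp
    then have "z' < t" using t(1) by linarith
    \<comment> \<open>Coefficients of the second intersection point, the affine combination (A a + B
      a')/(A t + B) in each coordinate, whose denominator is \<open>z'\<close>.\<close>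
    define A B where "A = n - M" and "B = 2 * (M * t - d)"
    have z'_eq: "z' = A * t + B" by (simp add: z'_def A_def B_def algebra_simps)
    have "(A * a + B * a')\<^sup>2 + (A * b + B * b')\<^sup>2 + (A * c + B * c')\<^sup>2
            = A\<^sup>2 * (a\<^sup>2 + b\<^sup>2 + c\<^sup>2) + 2 * A * B * d + B\<^sup>2 * n"
      by (simp add: n_def d_def power2_eq_square algebra_simps)
    also have "\<dots> = M * z'\<^sup>2 + A * B * (2 * d - 2 * M * t + B)"
      unfolding t(2) [symmetric] z'_eq by (simp add: A_def power2_eq_square algebra_simps)
    also have "\<dots> = M * z'\<^sup>2" by (simp add: B_def)
    finally have "M * z'\<^sup>2 = (A * a + B * a')\<^sup>2 + (A * b + B * b')\<^sup>2 + (A * c + B * c')\<^sup>2" by simp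
    moreover have "nat \<bar>z'\<bar> < nat \<bar>z\<bar>" using z'pos \<open>z' < t\<close> by (simp add: t_def)
    ultimately show ?thesis using less.hyps z'pos by blast
  qed
qed

lemma squarefree_not_square:
  fixes M :: nat
  assumes "squarefree M" "M > 1"
  shows "\<nexists>s::int. int M = s\<^sup>2"
proof
  assume "\<exists>s::int. int M = s\<^sup>2"
  then obtain s :: int where "int M = s\<^sup>2" by blast
  then have "int M = int ((nat \<bar>s\<bar>)\<^sup>2)" by simp
  then have eq: "M = (nat \<bar>s\<bar>)\<^sup>2" by (simp only: of_nat_eq_iff)
  then have "nat \<bar>s\<bar> dvd 1" using squarefreeD[OF assms(1)] by (metis dvd_refl)
  then show False using eq assms(2) by simp
qed

lemma prod_Legendre:
  assumes "finite P" "prime q" "q > 2"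
  shows "Legendre (int (\<Prod>P)) (int q) = (\<Prod>p\<in>P. Legendre (int p) (int q))"
  using assms(1)
proof (induction P rule: finite_induct)
  case empty
  then show ?case using Legendre_one assms by simp
next
  case (insert p P)
  then show ?case using assms by (simp add: Legendre_mult)
qed

lemma prod_chi4: "finite P \<Longrightarrow> chi4 (\<Prod>P) = (\<Prod>p\<in>P. chi4 p)"
  by (induction P rule: finite_induct) (simp_all add: chi4_mult, simp add: chi4_def)

text \<open>Prescribing (q/p) = (-1/p) makes -q a square modulo every p | M. By reciprocity with q
  \<equiv> 1 (mod 4) also (p/q) = (-1/p), and the product over p is the character modulo 4 at M,
  which is 1: here M \<equiv> 1 (mod 4) enters.\<close>

lemma three_squares_squarefree:
  fixes M :: nat
  assumes sf: "squarefree M" and M: "M mod 4 = 1"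
  shows "\<exists>x y z::int. int M = x\<^sup>2 + y\<^sup>2 + z\<^sup>2"
proof (cases "M = 1")
  case True
  then show ?thesis by (intro exI[of _ 1] exI[of _ 0]) auto
next
  case False
  then have M1: "M > 1" using M by (cases "M = 0") auto
  have nsq: "\<nexists>s::int. int M = s\<^sup>2" using squarefree_not_square[OF sf M1] .
  define P where "P = prime_factors M"
  have finP: "finite P" by (simp add: P_def)
  have prodP: "\<Prod>P = M"
  proof -
    have "M = (\<Prod>p\<in>P. p ^ multiplicity p M)"
      using M1 unfolding P_def by (intro prime_factorization_nat) simp
    also have "\<dots> = (\<Prod>p\<in>P. p)"
    proof (intro prod.cong refl)
      fix p assume "p \<in> P"
      then have "multiplicity p M = 1"
        using sf M1 unfolding P_def by (simp add: squarefree_factorial_semiring' prime_factors_multiplicity)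
      then show "p ^ multiplicity p M = p" by simp
    qed
    finally show ?thesis by simp
  qed
  have P: "prime p" "p > 2" "p dvd M" if "p \<in> P" for p
  proof -
    show p: "prime p" "p dvd M" using that by (auto simp: P_def)
    have "odd M" using M by presburger
    then have "p \<noteq> 2" using p(2) by auto
    then show "p > 2" using prime_ge_2_nat[OF p(1)] by simp
  qed
  have crt: "\<exists>\<alpha>. int M dvd \<alpha>\<^sup>2 + c" if "\<And>p. p \<in> P \<Longrightarrow> QuadRes (int p) (- c)" for c
  proof -
    \<comment> \<open>Nonnegative roots are chosen because the Chinese remainder theorem is applied
      to natural numbers.\<close>
    have "\<exists>y. [y\<^sup>2 = - c] (mod int p) \<and> y \<ge> 0" if "p \<in> P" for p
    proof -
      obtain y where "[y\<^sup>2 = - c] (mod int p)" using \<open>\<And>p. p \<in> P \<Longrightarrow> QuadRes (int p) (- c)\<close> \<open>p \<in> P\<close> by (auto simp: QuadRes_def)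
      then show ?thesis by (intro exI[of _ "\<bar>y\<bar>"]) auto
    qed
    then obtain y where y: "\<And>p. p \<in> P \<Longrightarrow> [(y p)\<^sup>2 = - c] (mod int p) \<and> y p \<ge> 0" by metis
    have "\<exists>x. \<forall>p\<in>P. [x = nat (y p)] (mod p)"
      using finP P(1) by (intro chinese_remainder_nat) (auto simp: primes_coprime)
    then obtain x where x: "\<And>p. p \<in> P \<Longrightarrow> [x = nat (y p)] (mod p)" by blast
    have "[(int x)\<^sup>2 = - c] (mod int p)" if "p \<in> P" for p
    proof -
      have "[int x = int (nat (y p))] (mod int p)" using x[OF that] by (simp only: cong_int_iff)
      then have "[(int x)\<^sup>2 = (y p)\<^sup>2] (mod int p)" using y[OF that] by (intro cong_pow) simp
      then show ?thesis using y[OF that] cong_trans by blast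
    qed
    then have "[(int x)\<^sup>2 = - c] (mod (\<Prod>p\<in>P. int p))"
      using P(1) by (intro cong_cong_prod_coprime) (auto simp: primes_coprime)
    then have "[(int x)\<^sup>2 = - c] (mod int M)" using prodP by (simp flip: of_nat_prod)
    then show ?thesis by (auto simp: cong_iff_dvd_diff)
  qed
  have minus_one: "Legendre (-1) (int p) = chi4 p" if "p \<in> P" for p
    using Legendre_minus_one[of p] P[OF that] prime_odd_nat[of p] by (auto simp: chi4_def)
  show ?thesis
  proof (cases "\<forall>p\<in>P. p mod 4 = 1")
    case True
    have "QuadRes (int p) (- 1)" if "p \<in> P" for p
      using Legendre_minus_one[of p] P[OF that] True that by (auto simp: Legendre_def split: if_splits)
    then obtain \<alpha> where "int M dvd \<alpha>\<^sup>2 + 1" using crt by blast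
    then obtain x y where "int M = x\<^sup>2 + y\<^sup>2" using two_squares_of_residue nsq M1 by force
    then show ?thesis by (intro exI[of _ x] exI[of _ y] exI[of _ 0]) auto
  next
    case False
    then obtain p0 where p0: "p0 \<in> P" "p0 mod 4 \<noteq> 1" by blast
    have "\<exists>n. primepow n \<and> n mod 4 = 1 \<and> (\<forall>p\<in>P. Legendre (int n) (int p) = chi4 p)"
      using finP P prime_odd_nat by (intro primepow_with_residues) (auto simp: chi4_def)
    then obtain n where n: "primepow n" "n mod 4 = 1" "\<And>p. p \<in> P \<Longrightarrow> Legendre (int n) (int p) = chi4 p" by blast
    obtain q k where q: "prime q" "n = q ^ k" using n(1) by (auto simp: primepow_def)
    have Leg_pow: "Legendre (int (q ^ j)) (int p) = Legendre (int q) (int p) ^ j" if "p \<in> P" for p j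
      using P[OF that] by (induction j) (simp_all add: Legendre_one Legendre_mult)
    have odd_pow: "x ^ k = x" if "x \<in> {-1, 0, 1 :: int}" "odd k" for x
      using that by (auto elim!: oddE)
    have "chi4 p0 = -1" using p0 P prime_odd_nat by (auto simp: chi4_def)
    then have Lk: "Legendre (int q) (int p0) ^ k = -1" using n(3)[OF p0(1)] Leg_pow[OF p0(1)] q by simp
    have k: "odd k"
    proof
      assume "even k"
      then have "Legendre (int q) (int p0) ^ k \<ge> 0" by (rule zero_le_even_power)
      then show False using Lk by simp
    qed
    have Lq: "Legendre (int q) (int p) = chi4 p" if "p \<in> P" for p
      using n(3)[OF that] Leg_pow[OF that] q odd_pow[OF Legendre_vals k] by metis
    have "chi4 q ^ k = chi4 n" unfolding q(2) by (induction k) (simp_all add: chi4_mult, simp add: chi4_def)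
    also have "\<dots> = 1" using n(2) unfolding chi4_def by presburger
    finally have "chi4 q ^ k = 1" .
    then have "chi4 q = 1" using odd_pow[OF _ k, of "chi4 q"] by (simp add: chi4_def)
    then have q4: "q mod 4 = 1" by (auto simp: chi4_def split: if_splits)
    then have q2: "q > 2" using prime_ge_2_nat[OF q(1)] by (cases "q = 2") auto
    have qP: "q \<notin> P"
    proof
      assume "q \<in> P"
      then have "Legendre (int q) (int q) = chi4 q" by (rule Lq)
      moreover have "Legendre (int q) (int q) = 0" by (simp add: Legendre_eq_0)
      ultimately show False using \<open>chi4 q = 1\<close> by simp
    qed
    have cop: "coprime q M" using qP q(1) M1 by (intro prime_imp_coprime) (auto simp: P_def prime_factors_dvd)
    have "QuadRes (int p) (- int q)" if p: "p \<in> P" for p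
    proof -
      have "Legendre (- 1 * int q) (int p) = chi4 p * chi4 p"
        using P[OF p] Lq[OF p] minus_one[OF p] by (simp only: Legendre_mult)
      also have "\<dots> = 1" using P[OF p] prime_odd_nat by (auto simp: chi4_def)
      finally show ?thesis by (auto simp: Legendre_def split: if_splits)
    qed
    then obtain \<alpha> where \<alpha>: "int M dvd \<alpha>\<^sup>2 + int q" using crt by blast
    have "Legendre (int p) (int q) = chi4 p" if p: "p \<in> P" for p
    proof -
      have "p \<noteq> q" using p qP by auto
      then have "Legendre (int p) (int q) * Legendre (int q) (int p) = (-1) ^ ((p - 1) div 2 * ((q - 1) div 2))"
        using P[OF p] q(1) q2 by (intro Quadratic_Reciprocity) auto
      moreover have "even ((q - 1) div 2)" using q4 by presburger
      ultimately have "Legendre (int p) (int q) * chi4 p = 1" using Lq[OF p] by simp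
      then show ?thesis using P[OF p] by (auto simp: chi4_def split: if_splits)
    qed
    then have "Legendre (int M) (int q) = chi4 M"
      using prod_Legendre[OF finP q(1) q2] prod_chi4[OF finP] prodP by simp
    also have "\<dots> = 1" using M unfolding chi4_def by presburger
    finally have "QuadRes (int q) (int M)" by (auto simp: Legendre_def split: if_splits)
    then obtain \<beta> where \<beta>: "int q dvd \<beta>\<^sup>2 - int M" by (auto simp: QuadRes_def cong_iff_dvd_diff)
    \<comment> \<open>That neither M nor q nor M q is a square makes the bounds of the pigeonhole
      argument strict.\<close>
    have qsf: "squarefree q" using q(1) by (simp add: squarefree_prime)
    have qnsq: "\<nexists>s::int. int q = s\<^sup>2" using squarefree_not_square[OF qsf] q2 by simp
    have "1 < M * q" using less_1_mult[of M q] M1 q2 by simp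
    moreover have "squarefree (M * q)" using sf qsf cop by (intro squarefree_mult_coprime) (auto simp: coprime_commute)
    ultimately have Mqnsq: "\<nexists>s::int. int M * int q = s\<^sup>2"
      using squarefree_not_square[of "M * q"] by simp
    obtain T W Z where TWZ: "Z \<noteq> 0" "T\<^sup>2 + int q * W\<^sup>2 = int M * Z\<^sup>2"
      using legendre_equation[OF _ nsq _ qnsq Mqnsq _ \<alpha> \<beta>] M1 q2 cop by (auto simp: coprime_commute)
    have "QuadRes (int q) (- 1)"
      using Legendre_minus_one[OF q(1) q2] q4 by (auto simp: Legendre_def split: if_splits)
    then obtain \<gamma> where "int q dvd \<gamma>\<^sup>2 + 1" by (auto simp: QuadRes_def cong_iff_dvd_diff)
    then obtain X Y where XY: "int q = X\<^sup>2 + Y\<^sup>2" using two_squares_of_residue[OF _ qnsq, of \<gamma>] q2 by auto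
    have "int M * Z\<^sup>2 = T\<^sup>2 + (X * W)\<^sup>2 + (Y * W)\<^sup>2"
      using TWZ(2) XY by (simp add: power_mult_distrib algebra_simps)
    then show ?thesis using TWZ(1) by (rule davenport_cassels)
  qed
qed

text \<open>An odd square is 1 modulo 4, so the squarefree part inherits the residue class; the
  square part is then multiplied into the three squares.\<close>

lemma three_squares:
  fixes M :: int
  assumes "M > 0" "M mod 4 = 1"
  shows "\<exists>x y z. M = x\<^sup>2 + y\<^sup>2 + z\<^sup>2"
proof -
  define n where "n = nat M"
  have n: "M = int n" using assms by (simp add: n_def)
  have n4: "n mod 4 = 1" using assms(2) unfolding n by presburger
  define s f where "s = square_part n" and "f = squarefree_part n"
  have sf: "n = f * s\<^sup>2" unfolding s_def f_def by (rule squarefree_decompose)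
  have "odd n" using n4 by presburger
  then have "odd s" using sf by auto
  then obtain b where b: "s = 2 * b + 1" by (elim oddE)
  have "s\<^sup>2 = 4 * (b * b + b) + 1" by (simp add: b power2_eq_square algebra_simps)
  moreover have "(4 * x + 1) mod 4 = 1" for x :: nat by presburger
  ultimately have "s\<^sup>2 mod 4 = 1" by metis
  then have "f mod 4 = n mod 4" unfolding sf by (metis mod_mult_right_eq mult.right_neutral)
  then obtain x y z where "int f = x\<^sup>2 + y\<^sup>2 + z\<^sup>2"
    using three_squares_squarefree[of f] n4 unfolding f_def by auto
  then have "M = (int s * x)\<^sup>2 + (int s * y)\<^sup>2 + (int s * z)\<^sup>2"
    using n sf by (simp add: power_mult_distrib algebra_simps)
  then show ?thesis by blast
qed

section \<open>Jacobi's identity\<close>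

text \<open>Gaussian binomial coefficients, given by a Pascal rule instead of a quotient so that
  they make sense in every commutative ring; \<open>qbinomial_qpoch\<close> is the quotient formula
  with denominators cleared.\<close>

fun qbinomial :: "'a :: comm_ring_1 \<Rightarrow> nat \<Rightarrow> nat \<Rightarrow> 'a" where
  "qbinomial q N 0 = 1"
| "qbinomial q 0 (Suc k) = 0"
| "qbinomial q (Suc N) (Suc k) = qbinomial q N (Suc k) + q ^ (N - k) * qbinomial q N k"

definition qpoch :: "'a :: comm_ring_1 \<Rightarrow> nat \<Rightarrow> 'a" where
  "qpoch q n = (\<Prod>i<n. 1 - q ^ Suc i)"

lemma qpoch_simps: "qpoch q 0 = 1" "qpoch q (Suc n) = qpoch q n * (1 - q ^ Suc n)"
  by (simp_all add: qpoch_def)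

lemma qbinomial_eq_0: "k > N \<Longrightarrow> qbinomial q N k = 0"
  by (induction q N k rule: qbinomial.induct) auto

lemma qbinomial_qpoch: "k \<le> N \<Longrightarrow> qpoch q k * qpoch q (N - k) * qbinomial q N k = qpoch q N"
proof (induction N arbitrary: k)
  case 0
  then show ?case by (simp add: qpoch_simps)
next
  case (Suc N)
  show ?case
  proof (cases k)
    case 0
    then show ?thesis by (simp add: qpoch_simps)
  next
    case (Suc j)
    have j: "j \<le> N" using Suc Suc.prems by simp
    have 1: "qpoch q (Suc j) * qpoch q (N - j) * qbinomial q N (Suc j) = qpoch q N * (1 - q ^ (N - j))"
    proof (cases "j = N")
      case True
      then show ?thesis by (simp add: qbinomial_eq_0)
    next
      case False
      then have "N - j = Suc (N - Suc j)" using j by simp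
      then have "qpoch q (N - j) = qpoch q (N - Suc j) * (1 - q ^ (N - j))"
        using qpoch_simps(2)[of q "N - Suc j"] by simp
      then have "qpoch q (Suc j) * qpoch q (N - j) * qbinomial q N (Suc j)
          = (qpoch q (Suc j) * qpoch q (N - Suc j) * qbinomial q N (Suc j)) * (1 - q ^ (N - j))"
        by (simp only: mult_ac)
      then show ?thesis using Suc.IH[of "Suc j"] False j by simp
    qed
    have "qpoch q (Suc j) * qpoch q (N - j) * (q ^ (N - j) * qbinomial q N j)
        = (qpoch q j * qpoch q (N - j) * qbinomial q N j) * (q ^ (N - j) * (1 - q ^ Suc j))"
      by (simp only: qpoch_simps mult_ac)
    also have "\<dots> = qpoch q N * (q ^ (N - j) - q ^ Suc N)"
      using Suc.IH[OF j] j by (simp only: right_diff_distrib mult_1_right flip: power_add) simp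
    finally have 2: "qpoch q (Suc j) * qpoch q (N - j) * (q ^ (N - j) * qbinomial q N j)
        = qpoch q N * (q ^ (N - j) - q ^ Suc N)" .
    show ?thesis unfolding Suc qbinomial.simps diff_Suc_Suc distrib_left 1 2
      by (simp add: qpoch_simps algebra_simps)
  qed
qed

lemma coeff_linear_mult: "coeff ([:a, b:] * p) (Suc k) = a * coeff p (Suc k) + b * coeff p k"
  for p :: "'a :: comm_ring_1 poly"
  by (simp add: mult_pCons_left)

text \<open>The homogeneous q-binomial theorem, stated for polynomials in the second variable so
  that it can be differentiated as well as evaluated.\<close>

lemma coeff_qproduct:
  "coeff (\<Prod>i<N. [:x, q ^ i:]) k = (if k \<le> N then qbinomial q N k * q ^ (k choose 2) * x ^ (N - k) else 0)"
  for x q :: "'a :: comm_ring_1"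
proof (induction N arbitrary: k)
  case 0
  then show ?case by (cases k) (auto simp: binomial_eq_0)
next
  case (Suc N)
  have eq: "(\<Prod>i<Suc N. [:x, q ^ i:]) = [:x, q ^ N:] * (\<Prod>i<N. [:x, q ^ i:])" by (simp add: mult.commute)
  show ?case
  proof (cases k)
    case 0
    then show ?thesis unfolding eq using Suc.IH[of 0] by (simp add: mult_pCons_left binomial_eq_0)
  next
    case (Suc j)
    have "coeff (\<Prod>i<Suc N. [:x, q ^ i:]) (Suc j)
        = x * (if Suc j \<le> N then qbinomial q N (Suc j) * q ^ (Suc j choose 2) * x ^ (N - Suc j) else 0)
        + q ^ N * (if j \<le> N then qbinomial q N j * q ^ (j choose 2) * x ^ (N - j) else 0)"
      unfolding eq coeff_linear_mult Suc.IH ..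
    also have "\<dots> = (if Suc j \<le> Suc N then qbinomial q (Suc N) (Suc j) * q ^ (Suc j choose 2) * x ^ (Suc N - Suc j) else 0)"
    proof (cases "j \<le> N")
      case True
      have h1: "q ^ N * q ^ (j choose 2) = q ^ (N - j) * q ^ (Suc j choose 2)"
        using True by (simp add: numeral_2_eq_2 flip: power_add)
      show ?thesis
      proof (cases "Suc j \<le> N")
        case sj: True
        have h2: "x * x ^ (N - Suc j) = x ^ (N - j)"
          using sj by (simp flip: power_Suc add: Suc_diff_Suc)
        have "x * (qbinomial q N (Suc j) * q ^ (Suc j choose 2) * x ^ (N - Suc j))
            + q ^ N * (qbinomial q N j * q ^ (j choose 2) * x ^ (N - j))
            = qbinomial q N (Suc j) * q ^ (Suc j choose 2) * (x * x ^ (N - Suc j))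
            + qbinomial q N j * (q ^ N * q ^ (j choose 2)) * x ^ (N - j)" by (simp only: mult_ac)
        also have "\<dots> = (qbinomial q N (Suc j) + q ^ (N - j) * qbinomial q N j) * q ^ (Suc j choose 2) * x ^ (N - j)"
          unfolding h1 h2 by (simp only: distrib_left distrib_right mult_ac)
        finally show ?thesis using True sj by simp
      next
        case False
        with True have "j = N" by simp
        then show ?thesis using h1 by (simp add: qbinomial_eq_0 mult.left_commute[of "q ^ N"])
      qed
    qed auto
    finally show ?thesis by (simp only: Suc)
  qed
qed

lemma degree_qproduct: "degree (\<Prod>i<N. [:x, q ^ i:]) \<le> N" for x q :: "'a :: comm_ring_1"
  by (rule degree_le) (simp add: coeff_qproduct)

lemma qproduct_sum:
  "(\<Prod>i<N. [:x, q ^ i:]) = (\<Sum>k\<le>N. monom (qbinomial q N k * q ^ (k choose 2) * x ^ (N - k)) k)"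
  for x q :: "'a :: comm_ring_1"
proof -
  have "(\<Prod>i<N. [:x, q ^ i:]) = (\<Sum>k\<le>N. monom (coeff (\<Prod>i<N. [:x, q ^ i:]) k) k)"
    by (rule poly_as_sum_of_monoms' [symmetric]) (rule degree_qproduct)
  also have "\<dots> = (\<Sum>k\<le>N. monom (qbinomial q N k * q ^ (k choose 2) * x ^ (N - k)) k)"
    by (intro sum.cong refl) (simp add: coeff_qproduct)
  finally show ?thesis .
qed

lemma qbinomial_theorem:
  "(\<Prod>i<N. x + y * q ^ i) = (\<Sum>k\<le>N. qbinomial q N k * (q ^ (k choose 2) * x ^ (N - k)) * y ^ k)"
  for x y q :: "'a :: comm_ring_1"
proof -
  have "(\<Prod>i<N. x + y * q ^ i) = poly (\<Prod>i<N. [:x, q ^ i:]) y" by (simp add: poly_prod)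
  then show ?thesis unfolding qproduct_sum by (simp add: poly_sum poly_monom mult.assoc)
qed

text \<open>At -1 the factor with i = n vanishes, so the derivative of the product retains only the
  term in which this factor is differentiated. On the other side differentiation creates the weights
  k (-1)^(k-1), the origin of the coefficients 2k + 1 in Jacobi's identity.\<close>

lemma qbinomial_theorem_deriv:
  fixes x q :: "'a :: idom"
  assumes "n < N" "x = q ^ n"
  shows "x * (\<Prod>i\<in>{..<N}-{n}. x - q ^ i)
           = (\<Sum>k\<le>N. qbinomial q N k * (q ^ (k choose 2) * x ^ (N - k)) * (of_nat k * (-1) ^ (k - 1)))"
proof -
  have "(\<Prod>i<N. [:x, q ^ i:]) = [:x, x:] * (\<Prod>i\<in>{..<N}-{n}. [:x, q ^ i:])"
    using assms by (subst prod.remove[of _ n]) auto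
  then have "poly (pderiv (\<Prod>i<N. [:x, q ^ i:])) (-1) = x * (\<Prod>i\<in>{..<N}-{n}. x - q ^ i)"
    by (simp only: pderiv_mult) (simp add: poly_prod pderiv_pCons)
  then show ?thesis unfolding qproduct_sum
    by (simp add: higher_pderiv_sum[of 1, simplified] pderiv_monom poly_sum poly_monom mult_ac)
qed

section \<open>Power series modulo a power of X\<close>

abbreviation fps_cong :: "nat \<Rightarrow> real fps \<Rightarrow> real fps \<Rightarrow> bool" where
  "fps_cong n a b \<equiv> fps_X ^ n dvd (a - b)"

lemma fps_cong_refl: "fps_cong n a a" by simp

lemma fps_cong_sym: "fps_cong n a b \<Longrightarrow> fps_cong n b a"
  by (metis dvd_minus_iff minus_diff_eq)

lemma fps_cong_trans: "fps_cong n a b \<Longrightarrow> fps_cong n b c \<Longrightarrow> fps_cong n a c"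
  using dvd_add[of "fps_X ^ n" "a - b" "b - c"] by simp

lemma fps_cong_mult: "fps_cong n a b \<Longrightarrow> fps_cong n c d \<Longrightarrow> fps_cong n (a * c) (b * d)"
proof -
  assume "fps_cong n a b" "fps_cong n c d"
  then have "fps_X ^ n dvd (a - b) * c + b * (c - d)" by (intro dvd_add dvd_mult dvd_mult2)
  then show ?thesis by (simp add: algebra_simps)
qed

lemma fps_cong_sum: "(\<And>i. i \<in> A \<Longrightarrow> fps_cong n (f i) (g i)) \<Longrightarrow> fps_cong n (sum f A) (sum g A)"
  by (simp flip: sum_subtractf) (rule dvd_sum, auto)

lemma fps_cong_weaken: "fps_cong n a b \<Longrightarrow> m \<le> n \<Longrightarrow> fps_cong m a b"
  by (meson dvd_trans le_imp_power_dvd)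

lemma fps_cong_X_mult: "fps_cong n a b \<Longrightarrow> fps_cong (k + n) (fps_X ^ k * a) (fps_X ^ k * b)"
  by (simp add: power_add mult_dvd_mono flip: right_diff_distrib)

lemma fps_cong_X_cancel: "fps_cong (k + n) (fps_X ^ k * a) (fps_X ^ k * b) \<Longrightarrow> fps_cong n a b"
  by (simp add: power_add flip: right_diff_distrib)

lemma fps_cong_unit_cancel:
  assumes "u $ 0 \<noteq> 0" "fps_cong n (u * a) (u * b)"
  shows "fps_cong n a b"
proof -
  have "fps_X ^ n dvd inverse u * (u * a - u * b)" using assms(2) by (rule dvd_mult)
  moreover have "inverse u * (u * a - u * b) = a - b"
    using inverse_mult_eq_1[OF assms(1)] by (simp add: right_diff_distrib flip: mult.assoc)
  ultimately show ?thesis by simp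
qed

lemma fps_cong_nth: "fps_cong n a b \<Longrightarrow> i < n \<Longrightarrow> a $ i = b $ i"
proof -
  assume "fps_cong n a b" "i < n"
  then obtain c where "a - b = fps_X ^ n * c" by (auto elim: dvdE)
  then have "(a - b) $ i = 0" using \<open>i < n\<close> by (simp add: fps_X_power_mult_nth)
  then show ?thesis by simp
qed

lemma qpoch_nth_0: "c > 0 \<Longrightarrow> qpoch (fps_X ^ c :: real fps) r $ 0 = 1"
  by (induction r) (simp_all add: qpoch_simps fps_mult_nth_0 flip: power_mult power_Suc power_add)

lemma qpoch_cong:
  "r \<le> m \<Longrightarrow> fps_cong (c * Suc r) (qpoch (fps_X ^ c) m) (qpoch (fps_X ^ c) r)"
proof (induction m rule: dec_induct)
  case (step m)
  have "fps_X ^ (c * Suc r) dvd qpoch (fps_X ^ c) m * (fps_X ^ c) ^ Suc m"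
    unfolding power_mult [symmetric] using step.hyps by (intro dvd_mult le_imp_power_dvd mult_le_mono2) auto
  then have "fps_cong (c * Suc r) (qpoch (fps_X ^ c) (Suc m)) (qpoch (fps_X ^ c) m)"
    by (simp only: qpoch_simps right_diff_distrib mult_1_right) (simp add: dvd_minus_iff)
  then show ?case by (rule fps_cong_trans) (rule step.IH)
qed simp

text \<open>The finite substitute for the limit 1/(q;q)_inf of the Gaussian binomials: in the
  quotient formula all three factors \<open>qpoch\<close> agree with the one of index r up to the
  stated precision, and one of them cancels as a unit.\<close>

lemma qbinomial_qpoch_cong:
  assumes "c > 0" "k \<le> N" "r \<le> k" "r \<le> N - k" "r \<le> m"
  shows "fps_cong (c * Suc r) (qpoch (fps_X ^ c) m * qbinomial (fps_X ^ c) N k) 1"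
proof -
  let ?P = "qpoch (fps_X ^ c :: real fps)" and ?b = "qbinomial (fps_X ^ c :: real fps) N k"
  have c: "fps_cong (c * Suc r) (?P m) (?P r)" if "r \<le> m" for m using that by (rule qpoch_cong)
  have "fps_cong (c * Suc r) (?P k * ?P (N - k) * ?b) (?P r * ?P r * ?b)"
    using assms by (intro fps_cong_mult c fps_cong_refl)
  then have A: "fps_cong (c * Suc r) (?P N) (?P r * ?P r * ?b)"
    using qbinomial_qpoch[OF assms(2), of "fps_X ^ c :: real fps"] by simp
  have "fps_cong (c * Suc r) (?P N) (?P r)" using assms by (intro c) simp
  then have "fps_cong (c * Suc r) (?P r * ?P r * ?b) (?P r)"
    by (rule fps_cong_trans[OF fps_cong_sym[OF A]])
  then have "fps_cong (c * Suc r) (?P r * (?P r * ?b)) (?P r * 1)"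
    by (simp only: mult.assoc mult_1_right)
  then have "fps_cong (c * Suc r) (?P r * ?b) 1"
    by (rule fps_cong_unit_cancel[rotated]) (simp add: qpoch_nth_0[OF assms(1)])
  moreover have "fps_cong (c * Suc r) (?P m * ?b) (?P r * ?b)"
    using assms by (intro fps_cong_mult c fps_cong_refl)
  ultimately show ?thesis by (rule fps_cong_trans[rotated])
qed

section \<open>Finite forms of three theta identities\<close>

lemma choose_two_add: "(a + b) choose 2 = (a choose 2) + (b choose 2) + a * b"
  by (induction a) (auto simp: numeral_2_eq_2)

lemma choose_two_double: "2 * (n choose 2) + n = n * n"
  by (induction n) (auto simp: numeral_2_eq_2)

lemma prod_power_lessThan: "(\<Prod>i<n. x ^ i) = x ^ (n choose 2)" for x :: "'a :: comm_monoid_mult"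
  by (induction n) (auto simp: numeral_2_eq_2 power_add mult.commute)

text \<open>The power of $q$ common to all terms of the $q$-binomial theorem for
  $\prod_{i \le 2n} (q^n + y q^i)$.\<close>

definition tri_exp :: "nat \<Rightarrow> nat" where "tri_exp n = (n choose 2) + n + n * n"

text \<open>The indices n - j and, by the next lemma, n + 1 + j carry the same power of q, which
  exceeds the common one by T_j. This symmetry about n + 1/2 is what produces psi(q).\<close>

lemma tri_exp_lower: "j \<le> n \<Longrightarrow> ((n - j) choose 2) + n * (2 * n + 1 - (n - j)) = tri_exp n + (Suc j choose 2)"
proof -
  assume "j \<le> n"
  then obtain k where n: "n = k + j" by (metis add.commute le_Suc_ex)
  have "2 * n + 1 - (n - j) = k + 2 * j + 1" using n by simp
  then show ?thesis using choose_two_add[of k j] choose_two_double[of j]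
    by (simp add: n tri_exp_def numeral_2_eq_2 algebra_simps)
qed

lemma tri_exp_upper: "j \<le> n \<Longrightarrow> ((n + 1 + j) choose 2) + n * (2 * n + 1 - (n + 1 + j)) = tri_exp n + (Suc j choose 2)"
proof -
  assume "j \<le> n"
  then obtain k where n: "n = k + j" by (metis add.commute le_Suc_ex)
  have "2 * n + 1 - (n + 1 + j) = k" using n by simp
  moreover have "(n + 1 + j) choose 2 = (n choose 2) + (Suc j choose 2) + n * Suc j"
    using choose_two_add[of n "Suc j"] by simp
  ultimately show ?thesis by (simp add: n tri_exp_def algebra_simps)
qed

lemma sum_split_odd: "(\<Sum>k\<le>2*n+1. g k) = (\<Sum>j\<le>n. g (n - j)) + (\<Sum>j\<le>n. g (n + 1 + j))"
  for g :: "nat \<Rightarrow> 'a :: comm_monoid_add"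
proof -
  have "(\<Sum>k\<le>2*n+1. g k) = (\<Sum>k\<le>n. g k) + (\<Sum>k=n+1..2*n+1. g k)"
  proof -
    have "{..2*n+1} = {..n} \<union> {n+1..2*n+1}" by auto
    then show ?thesis by (simp only:) (rule sum.union_disjoint, auto)
  qed
  also have "(\<Sum>k\<le>n. g k) = (\<Sum>j\<le>n. g (n - j))" using sum.nat_diff_reindex[of g "Suc n"] by (simp add: lessThan_Suc_atMost)
  also have "(\<Sum>k=n+1..2*n+1. g k) = (\<Sum>j\<le>n. g (n + 1 + j))"
    by (rule sum.reindex_bij_witness[of _ "\<lambda>j. n + 1 + j" "\<lambda>k. k - (n + 1)"]) auto
  finally show ?thesis .
qed

lemma sum_split_even: "(\<Sum>k\<le>2*n. g k) = (\<Sum>j\<le>n. g (n + j)) + (\<Sum>j=1..n. g (n - j))"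
  for g :: "nat \<Rightarrow> 'a :: comm_monoid_add"
proof -
  have "(\<Sum>k\<le>2*n. g k) = (\<Sum>k=n..2*n. g k) + (\<Sum>k<n. g k)"
    by (subst sum.union_disjoint [symmetric]) (auto intro!: sum.cong)
  also have "(\<Sum>k<n. g k) = (\<Sum>j=1..n. g (n - j))"
    by (rule sum.reindex_bij_witness[of _ "\<lambda>j. n - j" "\<lambda>k. n - k"]) auto
  also have "(\<Sum>k=n..2*n. g k) = (\<Sum>j\<le>n. g (n + j))"
    by (rule sum.reindex_bij_witness[of _ "\<lambda>j. n + j" "\<lambda>k. k - n"]) auto
  finally show ?thesis .
qed

text \<open>The weight is left open to serve both the plain theorem and its derivative. At distance
  j from the middle the binomial is known only modulo X^(n-j+1), but its term carries the extra
  factor X^(T_j) with T_j \<ge> j, so the precision X^(n+1) is uniform.\<close>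

lemma weighted_odd_sum_cong:
  fixes w :: "nat \<Rightarrow> real fps"
  shows "fps_cong (tri_exp n + Suc n)
    (qpoch fps_X n * (\<Sum>k\<le>2*n+1. qbinomial fps_X (2*n+1) k * (fps_X ^ (k choose 2) * (fps_X ^ n) ^ (2*n+1-k)) * w k))
    (fps_X ^ tri_exp n * (\<Sum>j\<le>n. fps_X ^ (Suc j choose 2) * (w (n - j) + w (n + 1 + j))))"
proof -
  define h where "h k = qpoch fps_X n * (qbinomial fps_X (2*n+1) k * (fps_X ^ (k choose 2) * (fps_X ^ n) ^ (2*n+1-k)) * w k)" for k
  have h: "fps_cong (tri_exp n + Suc n) (h k) (fps_X ^ tri_exp n * (fps_X ^ (Suc j choose 2) * w k))"
    if "j \<le> n" "k = n - j \<or> k = n + 1 + j" for j k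
  proof -
    have f: "(k choose 2) + n * (2 * n + 1 - k) = tri_exp n + (Suc j choose 2)"
      using that tri_exp_lower[of j n] tri_exp_upper[of j n] by auto
    have X: "fps_X ^ (k choose 2) * (fps_X ^ n) ^ (2*n+1-k) = (fps_X ^ (tri_exp n + (Suc j choose 2)) :: real fps)"
      unfolding f [symmetric] by (simp only: power_add power_mult)
    have "fps_cong (1 * Suc (n - j)) (qpoch (fps_X ^ 1) n * qbinomial (fps_X ^ 1) (2*n+1) k) 1"
      using that by (intro qbinomial_qpoch_cong) auto
    then have "fps_cong (Suc (n - j)) (qpoch fps_X n * qbinomial fps_X (2*n+1) k * w k) (1 * w k)"
      by (intro fps_cong_mult fps_cong_refl) simp
    then have "fps_cong (tri_exp n + (Suc j choose 2) + Suc (n - j))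
       (fps_X ^ (tri_exp n + (Suc j choose 2)) * (qpoch fps_X n * qbinomial fps_X (2*n+1) k * w k))
       (fps_X ^ (tri_exp n + (Suc j choose 2)) * (1 * w k))" by (rule fps_cong_X_mult)
    moreover have "j \<le> Suc j choose 2" by (simp add: numeral_2_eq_2)
    ultimately have "fps_cong (tri_exp n + Suc n)
       (fps_X ^ (tri_exp n + (Suc j choose 2)) * (qpoch fps_X n * qbinomial fps_X (2*n+1) k * w k))
       (fps_X ^ (tri_exp n + (Suc j choose 2)) * (1 * w k))" using that(1) by (elim fps_cong_weaken) simp
    then show ?thesis unfolding h_def X by (simp only: mult_ac power_add mult_1)
  qed
  have "fps_cong (tri_exp n + Suc n) (\<Sum>j\<le>n. h (n - j) + h (n + 1 + j))
          (\<Sum>j\<le>n. fps_X ^ tri_exp n * (fps_X ^ (Suc j choose 2) * (w (n - j) + w (n + 1 + j))))"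
  proof (rule fps_cong_sum)
    fix j assume "j \<in> {..n}"
    then have j: "j \<le> n" by simp
    show "fps_cong (tri_exp n + Suc n) (h (n - j) + h (n + 1 + j))
            (fps_X ^ tri_exp n * (fps_X ^ (Suc j choose 2) * (w (n - j) + w (n + 1 + j))))"
      using dvd_add[OF h[OF j disjI1[OF refl]] h[OF j disjI2[OF refl]]]
      by (simp only: add_diff_add distrib_left)
  qed
  moreover have "(\<Sum>j\<le>n. h (n - j) + h (n + 1 + j)) = (\<Sum>k\<le>2*n+1. h k)"
    unfolding sum_split_odd sum.distrib ..
  ultimately show ?thesis by (simp only: h_def sum_distrib_left)
qed

text \<open>Factors below and above i = n both run through 1 + s x^1, ..., 1 + s x^n up to
  monomials, hence the square. The factor i = n is left out because it is 2 x^n for s = 1 but 0 for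
  s = -1.\<close>

lemma prod_split_odd:
  fixes x s :: "'a :: comm_ring_1"
  assumes s: "s * s = 1"
  shows "(\<Prod>i\<in>{..<2*n+1}-{n}. x ^ n + s * x ^ i) = s ^ n * x ^ ((n choose 2) + n * n) * (\<Prod>i<n. 1 + s * x ^ Suc i)\<^sup>2"
proof -
  have split: "{..<2*n+1}-{n} = {..<n} \<union> {n+1..<2*n+1}" by auto
  have "{..<n} \<inter> {n+1..<2*n+1} = {}" by auto
  then have "(\<Prod>i\<in>{..<2*n+1}-{n}. x ^ n + s * x ^ i) = (\<Prod>i<n. x ^ n + s * x ^ i) * (\<Prod>i=n+1..<2*n+1. x ^ n + s * x ^ i)"
    unfolding split by (intro prod.union_disjoint) auto
  also have "(\<Prod>i=n+1..<2*n+1. x ^ n + s * x ^ i) = (\<Prod>j<n. x ^ n + s * x ^ (n + Suc j))"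
    by (rule prod.reindex_bij_witness[of _ "\<lambda>j. n + Suc j" "\<lambda>k. k - (n + 1)"]) auto
  also have "\<dots> = (\<Prod>j<n. x ^ n * (1 + s * x ^ Suc j))"
    by (intro prod.cong refl) (simp only: distrib_left power_add mult_ac mult_1_right mult_1_left)
  also have "\<dots> = x ^ (n * n) * (\<Prod>j<n. 1 + s * x ^ Suc j)"
    by (simp only: prod.distrib prod_constant card_lessThan power_mult)
  also have "(\<Prod>i<n. x ^ n + s * x ^ i) = (\<Prod>i<n. s * x ^ i * (1 + s * x ^ Suc (n - Suc i)))"
  proof (intro prod.cong refl)
    fix i assume "i \<in> {..<n}"
    then have "x ^ n = x ^ i * x ^ Suc (n - Suc i)" by (simp only: flip: power_add) simp
    then have "s * x ^ i * (1 + s * x ^ Suc (n - Suc i)) = s * x ^ i + (s * s) * x ^ n"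
      by (simp only: distrib_left mult_ac mult_1_right mult_1_left)
    then show "x ^ n + s * x ^ i = s * x ^ i * (1 + s * x ^ Suc (n - Suc i))" using s by simp
  qed
  also have "\<dots> = s ^ n * x ^ (n choose 2) * (\<Prod>i<n. 1 + s * x ^ Suc (n - Suc i))"
    by (simp only: prod.distrib prod_constant card_lessThan prod_power_lessThan)
  also have "(\<Prod>i<n. 1 + s * x ^ Suc (n - Suc i)) = (\<Prod>i<n. 1 + s * x ^ Suc i)"
    by (rule prod.nat_diff_reindex)
  finally show ?thesis by (simp only: power2_eq_square power_add mult_ac)
qed

text \<open>Truncation of (-q;q)_inf, as \<open>qpoch_odd\<close> is of (q;q^2)_inf; by Euler these
  two products are inverse to each other.\<close>

definition qpoch_plus :: "nat \<Rightarrow> real fps" where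
  "qpoch_plus n = (\<Prod>i<n. 1 + fps_X ^ Suc i)"

definition qpoch_odd :: "nat \<Rightarrow> real fps" where
  "qpoch_odd n = (\<Prod>i<n. 1 - fps_X ^ (2 * i + 1))"

definition theta_tri :: "nat \<Rightarrow> real fps" where
  "theta_tri n = (\<Sum>j\<le>n. fps_X ^ (Suc j choose 2))"

text \<open>The series phi(-q) runs over all integers j; the second sum stands for the negative
  ones, so that j = 0 counts once.\<close>

definition theta_sq :: "nat \<Rightarrow> real fps" where
  "theta_sq n = (\<Sum>j\<le>n. (-1) ^ j * fps_X ^ (j * j)) + (\<Sum>j=1..n. (-1) ^ j * fps_X ^ (j * j))"

definition jacobi_cube :: "nat \<Rightarrow> real fps" where
  "jacobi_cube n = (\<Sum>j\<le>n. fps_X ^ (Suc j choose 2) * ((-1) ^ j * (2 * of_nat j + 1)))"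

text \<open>Gauss's product for psi(q). A factor 2 cancels: the middle factor of the product is 2
  q^n, and every power of q arises from two indices.\<close>

lemma theta_tri_cong: "fps_cong (Suc n) (qpoch fps_X n * (qpoch_plus n)\<^sup>2) (theta_tri n)"
proof -
  have "(\<Prod>i<2*n+1. fps_X ^ n + 1 * fps_X ^ i :: real fps)
      = 2 * fps_X ^ n * (\<Prod>i\<in>{..<2*n+1}-{n}. fps_X ^ n + 1 * fps_X ^ i)"
    by (subst prod.remove[of _ n]) auto
  also have "\<dots> = 2 * (fps_X ^ tri_exp n * (qpoch_plus n)\<^sup>2)"
    by (subst prod_split_odd) (simp_all add: qpoch_plus_def tri_exp_def power_add mult_ac)
  finally have "(\<Sum>k\<le>2*n+1. qbinomial fps_X (2*n+1) k * (fps_X ^ (k choose 2) * (fps_X ^ n) ^ (2*n+1-k)) * 1 ^ k)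
      = 2 * (fps_X ^ tri_exp n * (qpoch_plus n)\<^sup>2)"
    unfolding qbinomial_theorem [symmetric] .
  then have "fps_cong (tri_exp n + Suc n) (qpoch fps_X n * (2 * (fps_X ^ tri_exp n * (qpoch_plus n)\<^sup>2)))
     (fps_X ^ tri_exp n * (\<Sum>j\<le>n. fps_X ^ (Suc j choose 2) * (1 ^ (n - j) + 1 ^ (n + 1 + j))))"
    using weighted_odd_sum_cong[of n "\<lambda>k. 1 ^ k"] by metis
  moreover have "(\<Sum>j\<le>n. fps_X ^ (Suc j choose 2) * (1 ^ (n - j) + 1 ^ (n + 1 + j))) = 2 * theta_tri n"
    by (simp add: theta_tri_def sum_distrib_left mult.commute)
  ultimately have "fps_cong (tri_exp n + Suc n) (fps_X ^ tri_exp n * (2 * (qpoch fps_X n * (qpoch_plus n)\<^sup>2)))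
     (fps_X ^ tri_exp n * (2 * theta_tri n))" by (simp only: mult_ac)
  then have "fps_cong (Suc n) (2 * (qpoch fps_X n * (qpoch_plus n)\<^sup>2)) (2 * theta_tri n)"
    by (rule fps_cong_X_cancel)
  then show ?thesis by (rule fps_cong_unit_cancel[rotated]) simp
qed

lemma jacobi_cube_cong: "fps_cong (Suc n) (qpoch fps_X n ^ 3) (jacobi_cube n)"
proof -
  let ?w = "\<lambda>k. of_nat k * (-1) ^ (k - 1) :: real fps"
  have "fps_X ^ n * (\<Prod>i\<in>{..<2*n+1}-{n}. fps_X ^ n - fps_X ^ i :: real fps)
      = fps_X ^ n * (\<Prod>i\<in>{..<2*n+1}-{n}. fps_X ^ n + (-1) * fps_X ^ i)" by simp
  also have "\<dots> = fps_X ^ tri_exp n * ((-1) ^ n * (qpoch fps_X n)\<^sup>2)"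
    by (subst prod_split_odd) (simp_all add: qpoch_def tri_exp_def power_add mult_ac)
  finally have "(\<Sum>k\<le>2*n+1. qbinomial fps_X (2*n+1) k * (fps_X ^ (k choose 2) * (fps_X ^ n) ^ (2*n+1-k)) * ?w k)
      = fps_X ^ tri_exp n * ((-1) ^ n * (qpoch fps_X n)\<^sup>2)"
    using qbinomial_theorem_deriv[of n "2*n+1" "fps_X ^ n" "fps_X :: real fps"] by simp
  then have "fps_cong (tri_exp n + Suc n) (qpoch fps_X n * (fps_X ^ tri_exp n * ((-1) ^ n * (qpoch fps_X n)\<^sup>2)))
     (fps_X ^ tri_exp n * (\<Sum>j\<le>n. fps_X ^ (Suc j choose 2) * (?w (n - j) + ?w (n + 1 + j))))"
    using weighted_odd_sum_cong[of n ?w] by metis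
  moreover have "(\<Sum>j\<le>n. fps_X ^ (Suc j choose 2) * (?w (n - j) + ?w (n + 1 + j))) = (-1) ^ n * jacobi_cube n"
    unfolding jacobi_cube_def sum_distrib_left
  proof (intro sum.cong refl)
    fix j assume "j \<in> {..n}"
    then obtain k where n: "n = k + j" by (metis add.commute atMost_iff le_Suc_ex)
    \<comment> \<open>With k = n - j the two weights are -k and k + 2j + 1, both times (-1)^k; they
      add up to 2j + 1.\<close>
    have 1: "?w (n - j) = - (of_nat k * (-1) ^ k)" using n by (cases k) auto
    have 2: "?w (n + 1 + j) = (of_nat k + 2 * of_nat j + 1) * (-1) ^ k"
      by (simp add: n power_add flip: power_mult_distrib)
    have 3: "(-1) ^ n * (-1) ^ j = ((-1) ^ k :: real fps)" by (simp add: n power_add flip: power_mult_distrib)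
    have "?w (n - j) + ?w (n + 1 + j) = ((-1) ^ n * (-1) ^ j) * (2 * of_nat j + 1)"
      unfolding 1 2 3 by (simp add: algebra_simps)
    then show "fps_X ^ (Suc j choose 2) * (?w (n - j) + ?w (n + 1 + j))
      = (-1) ^ n * (fps_X ^ (Suc j choose 2) * ((-1) ^ j * (2 * of_nat j + 1)))"
      by (simp only: mult_ac)
  qed
  ultimately have "fps_cong (tri_exp n + Suc n) (fps_X ^ tri_exp n * ((-1) ^ n * qpoch fps_X n ^ 3))
     (fps_X ^ tri_exp n * ((-1) ^ n * jacobi_cube n))" by (simp only: mult_ac power2_eq_square power3_eq_cube)
  then have "fps_cong (Suc n) ((-1) ^ n * qpoch fps_X n ^ 3) ((-1) ^ n * jacobi_cube n)"
    by (rule fps_cong_X_cancel)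
  then show ?thesis by (rule fps_cong_unit_cancel[rotated]) (simp add: fps_power_zeroth)
qed

text \<open>The counterpart of \<open>tri_exp\<close> for base q^2, N = 2n and x = q^(2n-1). This x
  lies half-way between two powers of the base, so the exponents at n + j and n - j exceed the
  common one by j^2.\<close>

definition sq_exp :: "nat \<Rightarrow> nat" where "sq_exp n = 2 * (n choose 2) + (2 * n - 1) * n"

lemma sq_exp_upper:
  assumes "j \<le> n" "n > 0"
  shows "2 * ((n + j) choose 2) + (2 * n - 1) * (2 * n - (n + j)) = sq_exp n + j * j"
proof -
  obtain k where n: "n = k + j" using assms(1) by (metis add.commute le_Suc_ex)
  define m where "m = 2 * n - 1"
  have m: "2 * n = m + 1" using assms by (simp add: m_def)
  have d: "2 * n - (n + j) = k" using n by simp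
  have "2 * ((n + j) choose 2) + m * k = 2 * (n choose 2) + (2 * (j choose 2) + (2 * n) * j) + m * k"
    by (simp add: choose_two_add)
  also have "\<dots> = 2 * (n choose 2) + m * n + (2 * (j choose 2) + j)"
    unfolding m by (simp add: n algebra_simps)
  finally show ?thesis using choose_two_double[of j] d by (simp add: sq_exp_def m_def)
qed

lemma sq_exp_lower:
  assumes "j \<le> n" "n > 0"
  shows "2 * ((n - j) choose 2) + (2 * n - 1) * (2 * n - (n - j)) = sq_exp n + j * j"
proof -
  obtain k where n: "n = k + j" using assms(1) by (metis add.commute le_Suc_ex)
  define m where "m = 2 * n - 1"
  have m: "2 * k + 2 * j = m + 1" using assms n by (simp add: m_def)
  have d: "2 * n - k = n + j" "n - j = k" using n by simp_all
  have "2 * (k choose 2) + m * (n + j) + (2 * (j choose 2) + j) = 2 * (k choose 2) + m * n + 2 * (j choose 2) + (m + 1) * j"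
    by (simp add: algebra_simps)
  also have "\<dots> = 2 * (k choose 2) + 2 * (j choose 2) + 2 * (k * j) + m * n + 2 * (j * j)"
    unfolding m [symmetric] by (simp add: algebra_simps)
  also have "2 * (k choose 2) + 2 * (j choose 2) + 2 * (k * j) = 2 * (n choose 2)"
    unfolding n choose_two_add by simp
  finally show ?thesis using choose_two_double[of j] unfolding d m_def [symmetric] sq_exp_def by linarith
qed

lemma prod_odd_split:
  assumes "n > 0"
  shows "(\<Prod>i<2*n. fps_X ^ (2*n-1) + (-1) * (fps_X\<^sup>2) ^ i) = fps_X ^ sq_exp n * ((-1) ^ n * (qpoch_odd n)\<^sup>2)"
proof -
  have split: "{..<2*n} = {..<n} \<union> {n..<2*n}" by auto
  have "{..<n} \<inter> {n..<2*n} = {}" by auto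
  then have "(\<Prod>i<2*n. fps_X ^ (2*n-1) + (-1) * (fps_X\<^sup>2) ^ i :: real fps)
     = (\<Prod>i<n. fps_X ^ (2*n-1) + (-1) * (fps_X\<^sup>2) ^ i) * (\<Prod>i=n..<2*n. fps_X ^ (2*n-1) + (-1) * (fps_X\<^sup>2) ^ i)"
    unfolding split by (intro prod.union_disjoint) auto
  also have "(\<Prod>i=n..<2*n. fps_X ^ (2*n-1) + (-1) * (fps_X\<^sup>2) ^ i :: real fps)
     = (\<Prod>j<n. fps_X ^ (2*n-1) + (-1) * (fps_X\<^sup>2) ^ (n + j))"
    by (rule prod.reindex_bij_witness[of _ "\<lambda>j. n + j" "\<lambda>k. k - n"]) auto
  also have "\<dots> = (\<Prod>j<n. fps_X ^ (2*n-1) * (1 - fps_X ^ (2 * j + 1)))"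
  proof (intro prod.cong refl)
    fix j
    have "(fps_X\<^sup>2) ^ (n + j) = (fps_X ^ (2*n-1) * fps_X ^ (2 * j + 1) :: real fps)"
      unfolding power_mult [symmetric] power_add [symmetric] using assms by (intro arg_cong[of _ _ "\<lambda>k. fps_X ^ k"]) simp
    then show "fps_X ^ (2*n-1) + (-1) * (fps_X\<^sup>2) ^ (n + j) = (fps_X ^ (2*n-1) * (1 - fps_X ^ (2 * j + 1)) :: real fps)"
      by (simp add: right_diff_distrib)
  qed
  also have "\<dots> = fps_X ^ ((2*n-1) * n) * qpoch_odd n"
    by (simp only: prod.distrib prod_constant card_lessThan power_mult qpoch_odd_def)
  also have "(\<Prod>i<n. fps_X ^ (2*n-1) + (-1) * (fps_X\<^sup>2) ^ i :: real fps)
     = (\<Prod>i<n. (-1) * (fps_X\<^sup>2) ^ i * (1 - fps_X ^ (2 * (n - Suc i) + 1)))"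
  proof (intro prod.cong refl)
    fix i assume "i \<in> {..<n}"
    then have "(fps_X ^ (2*n-1) :: real fps) = (fps_X\<^sup>2) ^ i * fps_X ^ (2 * (n - Suc i) + 1)"
      unfolding power_mult [symmetric] power_add [symmetric] by (intro arg_cong[of _ _ "\<lambda>k. fps_X ^ k"]) auto
    then show "fps_X ^ (2*n-1) + (-1) * (fps_X\<^sup>2) ^ i = ((-1) * (fps_X\<^sup>2) ^ i * (1 - fps_X ^ (2 * (n - Suc i) + 1)) :: real fps)"
      by (simp add: right_diff_distrib)
  qed
  also have "\<dots> = (-1) ^ n * (fps_X\<^sup>2) ^ (n choose 2) * (\<Prod>i<n. 1 - fps_X ^ (2 * (n - Suc i) + 1))"
    by (simp only: prod.distrib prod_constant card_lessThan prod_power_lessThan)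
  also have "(\<Prod>i<n. 1 - fps_X ^ (2 * (n - Suc i) + 1)) = qpoch_odd n"
    unfolding qpoch_odd_def by (rule prod.nat_diff_reindex)
  finally show ?thesis
    by (simp only: power2_eq_square[of "qpoch_odd n"] sq_exp_def power_add power_mult mult_ac)
qed

text \<open>Gauss's product for phi(-q). The binomial at n + j or n - j is known modulo
  X^(2(n-j+1)); the extra factor X^(j^2) raises the precision beyond X^n.\<close>

lemma theta_sq_cong:
  assumes "n > 0"
  shows "fps_cong (Suc n) (qpoch (fps_X\<^sup>2) n * (qpoch_odd n)\<^sup>2) (theta_sq n)"
proof -
  define h :: "nat \<Rightarrow> real fps" where
    "h k = qpoch (fps_X\<^sup>2) n * (qbinomial (fps_X\<^sup>2) (2*n) k * ((fps_X\<^sup>2) ^ (k choose 2) * (fps_X ^ (2*n-1)) ^ (2*n-k)) * (-1) ^ k)" for k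
  have h: "fps_cong (sq_exp n + Suc n) (h k) (fps_X ^ sq_exp n * ((-1) ^ n * ((-1) ^ j * fps_X ^ (j * j))))"
    if "j \<le> n" "k = n + j \<or> k = n - j" for j k
  proof -
    have f: "2 * (k choose 2) + (2*n-1) * (2*n-k) = sq_exp n + j * j"
      using that sq_exp_lower[of j n] sq_exp_upper[of j n] assms by auto
    have X: "(fps_X\<^sup>2) ^ (k choose 2) * (fps_X ^ (2*n-1)) ^ (2*n-k) = (fps_X ^ (sq_exp n + j * j) :: real fps)"
      unfolding f [symmetric] by (simp only: power_add power_mult)
    have sgn: "(-1) ^ k = ((-1) ^ n * (-1) ^ j :: real fps)"
    proof -
      have "even k \<longleftrightarrow> even (n + j)" using that by auto
      then show ?thesis by (simp add: uminus_power_if flip: power_add)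
    qed
    have "fps_cong (2 * Suc (n - j)) (qpoch (fps_X\<^sup>2) n * qbinomial (fps_X\<^sup>2) (2*n) k) 1"
      using that by (intro qbinomial_qpoch_cong) auto
    then have "fps_cong (2 * Suc (n - j)) (qpoch (fps_X\<^sup>2) n * qbinomial (fps_X\<^sup>2) (2*n) k * (-1) ^ k) (1 * (-1) ^ k)"
      by (intro fps_cong_mult fps_cong_refl)
    then have "fps_cong (sq_exp n + j * j + 2 * Suc (n - j))
       (fps_X ^ (sq_exp n + j * j) * (qpoch (fps_X\<^sup>2) n * qbinomial (fps_X\<^sup>2) (2*n) k * (-1) ^ k))
       (fps_X ^ (sq_exp n + j * j) * (1 * (-1) ^ k))" by (rule fps_cong_X_mult)
    moreover have "sq_exp n + Suc n \<le> sq_exp n + j * j + 2 * Suc (n - j)"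
    proof -
      have "j \<le> j * j" by simp
      moreover have "2 * Suc (n - j) + 2 * j = 2 * n + 2" using that(1) by simp
      ultimately show ?thesis using that(1) by linarith
    qed
    ultimately have "fps_cong (sq_exp n + Suc n)
       (fps_X ^ (sq_exp n + j * j) * (qpoch (fps_X\<^sup>2) n * qbinomial (fps_X\<^sup>2) (2*n) k * (-1) ^ k))
       (fps_X ^ (sq_exp n + j * j) * (1 * (-1) ^ k))" by (rule fps_cong_weaken)
    then show ?thesis unfolding h_def X sgn by (simp only: mult_ac power_add mult_1)
  qed
  have "fps_cong (sq_exp n + Suc n) ((\<Sum>j\<le>n. h (n + j)) + (\<Sum>j=1..n. h (n - j)))
          ((\<Sum>j\<le>n. fps_X ^ sq_exp n * ((-1) ^ n * ((-1) ^ j * fps_X ^ (j * j))))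
          + (\<Sum>j=1..n. fps_X ^ sq_exp n * ((-1) ^ n * ((-1) ^ j * fps_X ^ (j * j)))))" (is "fps_cong _ (?A + ?B) (?C + ?D)")
  proof -
    have A: "fps_cong (sq_exp n + Suc n) ?A ?C" by (rule fps_cong_sum) (rule h, auto)
    have B: "fps_cong (sq_exp n + Suc n) ?B ?D" by (rule fps_cong_sum) (rule h, auto)
    show ?thesis using dvd_add[OF A B] by (simp only: add_diff_add)
  qed
  moreover have "?C + ?D = fps_X ^ sq_exp n * ((-1) ^ n * theta_sq n)"
    by (simp only: theta_sq_def sum_distrib_left distrib_left)
  moreover have "?A + ?B = (\<Sum>k\<le>2*n. h k)" by (rule sum_split_even [symmetric])
  moreover have "(\<Sum>k\<le>2*n. h k) = qpoch (fps_X\<^sup>2) n * (fps_X ^ sq_exp n * ((-1) ^ n * (qpoch_odd n)\<^sup>2))"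
    unfolding h_def sum_distrib_left [symmetric] qbinomial_theorem [symmetric] prod_odd_split[OF assms] ..
  ultimately have "fps_cong (sq_exp n + Suc n) (fps_X ^ sq_exp n * ((-1) ^ n * (qpoch (fps_X\<^sup>2) n * (qpoch_odd n)\<^sup>2)))
      (fps_X ^ sq_exp n * ((-1) ^ n * theta_sq n))" by (simp only: mult_ac)
  then have "fps_cong (Suc n) ((-1) ^ n * (qpoch (fps_X\<^sup>2) n * (qpoch_odd n)\<^sup>2)) ((-1) ^ n * theta_sq n)"
    by (rule fps_cong_X_cancel)
  then show ?thesis by (rule fps_cong_unit_cancel[rotated]) (simp add: fps_power_zeroth)
qed

lemma qpoch_square: "qpoch (fps_X\<^sup>2) n = qpoch fps_X n * qpoch_plus n"
  unfolding qpoch_def qpoch_plus_def prod.distrib [symmetric]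
  by (intro prod.cong refl) (simp add: algebra_simps flip: power_mult power_add)

text \<open>Even and odd exponents separated. With \<open>qpoch_square\<close> this gives Euler's
  (-q;q)_inf (q;q^2)_inf = 1 modulo X^(n+1).\<close>

lemma qpoch_double: "qpoch (fps_X\<^sup>2) n * qpoch_odd n = qpoch fps_X (2 * n)"
proof (induction n)
  case (Suc n)
  have X: "(fps_X\<^sup>2) ^ Suc n = (fps_X ^ Suc (Suc (2 * n)) :: real fps)"
    unfolding power_mult [symmetric] by simp
  have "qpoch (fps_X\<^sup>2) (Suc n) * qpoch_odd (Suc n)
      = (qpoch (fps_X\<^sup>2) n * qpoch_odd n) * ((1 - (fps_X\<^sup>2) ^ Suc n) * (1 - fps_X ^ (2 * n + 1)))"
    by (simp only: qpoch_simps qpoch_odd_def prod.lessThan_Suc mult_ac)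
  also have "\<dots> = qpoch fps_X (Suc (Suc (2 * n)))"
    unfolding Suc.IH X by (simp only: qpoch_simps mult_ac flip: Suc_eq_plus1)
  also have "Suc (Suc (2 * n)) = 2 * Suc n" by simp
  finally show ?case .
qed (simp add: qpoch_simps qpoch_odd_def)

text \<open>With truncations of $\varphi(-q)$ and $\psi(q)$ on the left; both sides are $(q;q)_\infty^3$.\<close>

lemma theta_product_cong:
  assumes "n > 0"
  shows "fps_cong (Suc n) ((theta_sq n)\<^sup>2 * theta_tri n) (jacobi_cube n)"
proof -
  let ?E = "qpoch fps_X n :: real fps" and ?O = "qpoch_plus n" and ?B = "qpoch_odd n"
  have "fps_cong (1 * Suc n) (qpoch (fps_X ^ 1) (2 * n)) (qpoch (fps_X ^ 1) n)" by (rule qpoch_cong) simp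
  then have "fps_cong (Suc n) (?E * (?O * ?B)) (?E * 1)"
    using qpoch_double[of n] qpoch_square[of n] by (simp add: mult.assoc)
  then have OB: "fps_cong (Suc n) (?O * ?B) 1"
    by (rule fps_cong_unit_cancel[rotated]) (use qpoch_nth_0[of 1 n] in simp)
  have "fps_cong (Suc n) (?E * ((?O * ?B) * (?O * ?B))) (?E * (1 * 1))"
    by (intro fps_cong_mult OB fps_cong_refl)
  then have "fps_cong (Suc n) ((qpoch (fps_X\<^sup>2) n * ?B\<^sup>2) * ?O) ?E"
    unfolding qpoch_square by (simp only: power2_eq_square mult_ac mult_1_right mult_1_left)
  moreover have "fps_cong (Suc n) ((qpoch (fps_X\<^sup>2) n * ?B\<^sup>2) * ?O) (theta_sq n * ?O)"
    by (intro fps_cong_mult theta_sq_cong assms fps_cong_refl)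
  \<comment> \<open>That is, phi(-q) (-q;q)_inf = (q;q)_inf; its square, multiplied by (q;q)_inf, is
    the cube.\<close>
  ultimately have PO: "fps_cong (Suc n) (theta_sq n * ?O) ?E"
    by (rule fps_cong_trans[OF fps_cong_sym, rotated])
  have "fps_cong (Suc n) ((theta_sq n)\<^sup>2 * (?E * ?O\<^sup>2)) ((theta_sq n)\<^sup>2 * theta_tri n)"
    by (intro fps_cong_mult theta_tri_cong fps_cong_refl)
  moreover have "fps_cong (Suc n) (?E * ((theta_sq n * ?O) * (theta_sq n * ?O))) (?E * (?E * ?E))"
    by (intro fps_cong_mult PO fps_cong_refl)
  then have "fps_cong (Suc n) ((theta_sq n)\<^sup>2 * (?E * ?O\<^sup>2)) (?E ^ 3)"
    by (simp add: power2_eq_square power3_eq_cube mult_ac)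
  ultimately have "fps_cong (Suc n) ((theta_sq n)\<^sup>2 * theta_tri n) (?E ^ 3)"
    by (rule fps_cong_trans[OF fps_cong_sym])
  then show ?thesis using jacobi_cube_cong by (rule fps_cong_trans)
qed

text \<open>The number of integers with absolute value $j$.\<close>

definition sq_weight :: "nat \<Rightarrow> real" where "sq_weight j = (if j = 0 then 1 else 2)"

lemma theta_sq_weighted: "theta_sq n = (\<Sum>j\<le>n. fps_const (sq_weight j * (-1) ^ j) * fps_X ^ (j * j))"
proof -
  have "(\<Sum>j\<le>n. f j) = f 0 + (\<Sum>j=1..n. f j)" for f :: "nat \<Rightarrow> real fps"
    by (simp add: sum.atMost_shift sum.atLeast1_atMost_eq lessThan_Suc_atMost)
  then have "(\<Sum>j\<le>n. fps_const (sq_weight j * (-1) ^ j) * fps_X ^ (j * j))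
      = 1 + (\<Sum>j=1..n. fps_const (sq_weight j * (-1) ^ j) * fps_X ^ (j * j))"
    and 1: "theta_sq n = 1 + (\<Sum>j=1..n. (-1) ^ j * fps_X ^ (j * j)) + (\<Sum>j=1..n. (-1) ^ j * fps_X ^ (j * j))"
    by (simp_all add: theta_sq_def sq_weight_def)
  note this(1)
  also have "(\<Sum>j=1..n. fps_const (sq_weight j * (-1) ^ j) * fps_X ^ (j * j))
      = (\<Sum>j=1..n. (-1) ^ j * fps_X ^ (j * j) + (-1) ^ j * fps_X ^ (j * j))"
  proof (intro sum.cong refl)
    fix j assume "j \<in> {1..n}"
    then have "fps_const (sq_weight j * (-1) ^ j) = (-1) ^ j + (-1 :: real fps) ^ j"
      by (cases "even j") (simp_all add: sq_weight_def numeral_fps_const flip: fps_const_neg)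
    then show "fps_const (sq_weight j * (-1) ^ j) * fps_X ^ (j * j) = (-1) ^ j * fps_X ^ (j * j) + (-1) ^ j * fps_X ^ (j * j)"
      by (simp only: distrib_right)
  qed
  finally show ?thesis unfolding 1 by (simp only: sum.distrib add.assoc)
qed

text \<open>The bounds keep the set finite and match the truncation of the theta series at n. Only
  natural x, y are listed; their signs are counted by \<open>sq_weight\<close>.\<close>

definition tri_reps :: "nat \<Rightarrow> (nat \<times> nat \<times> nat) set" where
  "tri_reps n = {(x, y, z). x \<le> n \<and> y \<le> n \<and> z \<le> n \<and> x * x + y * y + (Suc z choose 2) = n}"

lemma finite_tri_reps: "finite (tri_reps n)"
  by (rule finite_subset[of _ "{..n} \<times> {..n} \<times> {..n}"]) (auto simp: tri_reps_def)

lemma theta_product_nth: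
  "((theta_sq n)\<^sup>2 * theta_tri n) $ n = (\<Sum>(x, y, z)\<in>tri_reps n. sq_weight x * sq_weight y * (-1) ^ (x + y))"
proof -
  let ?a = "\<lambda>j. sq_weight j * (-1) ^ j"
  have "(theta_sq n)\<^sup>2 * theta_tri n = (\<Sum>x\<le>n. \<Sum>y\<le>n. \<Sum>z\<le>n.
      fps_const (?a x) * fps_X ^ (x * x) * (fps_const (?a y) * fps_X ^ (y * y)) * fps_X ^ (Suc z choose 2))"
    unfolding theta_sq_weighted theta_tri_def power2_eq_square
    by (simp only: sum_product, simp only: sum_distrib_right sum_distrib_left)
       (rule sum.cong[OF refl], rule sum.swap)
  also have "\<dots> = (\<Sum>x\<le>n. \<Sum>y\<le>n. \<Sum>z\<le>n. fps_const (?a x * ?a y) * fps_X ^ (x * x + y * y + (Suc z choose 2)))"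
    by (intro sum.cong refl) (simp only: power_add mult_ac flip: fps_const_mult)
  finally have "((theta_sq n)\<^sup>2 * theta_tri n) $ n
      = (\<Sum>x\<le>n. \<Sum>y\<le>n. \<Sum>z\<le>n. if x * x + y * y + (Suc z choose 2) = n then ?a x * ?a y else 0)"
    by (simp add: fps_sum_nth fps_X_power_nth if_distrib cong: if_cong) (intro sum.cong refl, auto)
  also have "\<dots> = (\<Sum>(x, y, z)\<in>{..n}\<times>{..n}\<times>{..n}. if x * x + y * y + (Suc z choose 2) = n then ?a x * ?a y else 0)"
    by (simp add: sum.cartesian_product)
  also have "\<dots> = (\<Sum>(x, y, z)\<in>tri_reps n. ?a x * ?a y)"
    by (intro sum.mono_neutral_cong_right) (auto simp: tri_reps_def split: if_splits)
  also have "\<dots> = (\<Sum>(x, y, z)\<in>tri_reps n. sq_weight x * sq_weight y * (-1) ^ (x + y))"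
    by (intro sum.cong refl) (auto simp: power_add)
  finally show ?thesis .
qed

lemma jacobi_cube_nth:
  "jacobi_cube n $ n = (\<Sum>j\<le>n. if Suc j choose 2 = n then (-1) ^ j * (2 * real j + 1) else 0)"
proof -
  have "(-1) ^ j * (2 * of_nat j + 1) = fps_const ((-1) ^ j * (2 * real j + 1))" for j
    by (cases "even j") (simp_all add: fps_of_nat [symmetric] numeral_fps_const fps_const_1_eq_1[symmetric] del: fps_const_1_eq_1)
  then show ?thesis unfolding jacobi_cube_def
    by (simp add: fps_sum_nth fps_X_power_nth) (intro sum.cong refl, auto)
qed

lemma tri_reps_signed_sum:
  assumes "n > 0"
  shows "(\<Sum>(x, y, z)\<in>tri_reps n. sq_weight x * sq_weight y * (-1) ^ (x + y))
      = (\<Sum>j\<le>n. if Suc j choose 2 = n then (-1) ^ j * (2 * real j + 1) else 0)"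
  unfolding theta_product_nth [symmetric] jacobi_cube_nth [symmetric]
  using theta_product_cong[OF assms] by (rule fps_cong_nth) simp

lemma sq_weight_pos: "sq_weight j > 0" by (simp add: sq_weight_def)

text \<open>The signed sum vanishes while all weights are positive, so neither parity can occur
  alone.\<close>

lemma tri_reps_both_parities:
  assumes "n > 0" "\<And>j. Suc j choose 2 \<noteq> n" "tri_reps n \<noteq> {}"
  shows "\<exists>(x, y, z)\<in>tri_reps n. odd (x + y)" "\<exists>(x, y, z)\<in>tri_reps n. even (x + y)"
proof -
  let ?f = "\<lambda>(x, y, z). sq_weight x * sq_weight y * (-1) ^ (x + y) :: real"
  have zero: "sum ?f (tri_reps n) = 0" using tri_reps_signed_sum[OF assms(1)] assms(2) by simp
  show "\<exists>(x, y, z)\<in>tri_reps n. odd (x + y)"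
  proof (rule ccontr)
    assume none: "\<not> ?thesis"
    have "?f p > 0" if "p \<in> tri_reps n" for p
    proof -
      obtain x y z where p: "p = (x, y, z)" by (cases p)
      then have "even (x + y)" using none that by auto
      then show ?thesis unfolding p by (simp add: sq_weight_pos del: even_add)
    qed
    then have "sum ?f (tri_reps n) > 0" using assms(3) finite_tri_reps by (intro sum_pos) auto
    with zero show False by simp
  qed
  show "\<exists>(x, y, z)\<in>tri_reps n. even (x + y)"
  proof (rule ccontr)
    assume none: "\<not> ?thesis"
    have "- ?f p > 0" if "p \<in> tri_reps n" for p
    proof -
      obtain x y z where p: "p = (x, y, z)" by (cases p)
      then have "odd (x + y)" using none that by auto
      then show ?thesis unfolding p by (simp add: sq_weight_pos del: even_add)
    qed
    then have "sum (\<lambda>p. - ?f p) (tri_reps n) > 0" using assms(3) finite_tri_reps by (intro sum_pos) auto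
    with zero show False by (simp add: sum_negf)
  qed
qed

text \<open>For odd m the signed sum is -(2m + 1), so a negative term must occur.\<close>

lemma tri_reps_odd_triangular:
  assumes "odd m" "n = Suc m choose 2"
  shows "\<exists>(x, y, z)\<in>tri_reps n. odd (x + y)"
proof (rule ccontr)
  let ?f = "\<lambda>(x, y, z). sq_weight x * sq_weight y * (-1) ^ (x + y) :: real"
  assume none: "\<not> ?thesis"
  have "?f p \<ge> 0" if "p \<in> tri_reps n" for p
  proof -
    obtain x y z where p: "p = (x, y, z)" by (cases p)
    then have "even (x + y)" using none that by auto
    then show ?thesis unfolding p by (simp add: sq_weight_pos less_imp_le del: even_add)
  qed
  then have "sum ?f (tri_reps n) \<ge> 0" by (rule sum_nonneg)
  have inj: "j = m" if "Suc j choose 2 = Suc m choose 2" for j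
  proof -
    have "j * Suc j = m * Suc m"
      using choose_two_double[of "Suc j"] choose_two_double[of "Suc m"] that by simp
    then have "\<not> j < m" "\<not> m < j" using mult_strict_mono[of j m "Suc j" "Suc m"] mult_strict_mono[of m j "Suc m" "Suc j"] by auto
    then show ?thesis by simp
  qed
  have "m \<le> n" unfolding assms(2) by (simp add: numeral_2_eq_2)
  have "m > 0" using assms(1) by (auto intro!: Nat.gr0I)
  then have "n > 0" using \<open>m \<le> n\<close> by simp
  have "(\<Sum>j\<le>n. if Suc j choose 2 = n then (-1) ^ j * (2 * real j + 1) else 0)
      = (\<Sum>j\<in>{m}. (-1) ^ j * (2 * real j + 1))"
    using \<open>m \<le> n\<close> inj assms(2) by (intro sum.mono_neutral_cong_right) auto
  also have "\<dots> < 0" using assms(1) by simp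
  finally show False using \<open>sum ?f (tri_reps n) \<ge> 0\<close> tri_reps_signed_sum[OF \<open>n > 0\<close>] by simp
qed

section \<open>From natural to integral representations\<close>

lemma two_triangular: "2 * triangular z = z * (z + 1)"
  unfolding triangular_def by (intro dvd_mult_div_cancel) simp

lemma triangular_eight: "8 * triangular z + 1 = (2 * z + 1)\<^sup>2"
  using two_triangular[of z] by (simp add: power2_eq_square algebra_simps)

lemma triangular_nat: "triangular (int k) = int (Suc k choose 2)"
proof -
  have "2 * int (Suc k choose 2) = int k * (int k + 1)"
    using arg_cong[OF choose_two_double[of "Suc k"], of int] by (simp add: algebra_simps)
  then show ?thesis using two_triangular[of "int k"] by simp
qed

text \<open>The reflection reverses the parity of the index. It serves to pass to natural indices
  and, in part (ii), to adjust a parity.\<close>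

lemma triangular_reflect: "triangular (- 1 - z) = triangular z"
  using two_triangular[of "- 1 - z"] two_triangular[of z] by (simp add: algebra_simps)

lemma triangular_as_nat: "\<exists>k. triangular z = triangular (int k)"
proof (cases "z \<ge> 0")
  case True
  then show ?thesis by (metis nat_0_le)
next
  case False
  then have "- 1 - z = int (nat (- 1 - z))" by simp
  then show ?thesis using triangular_reflect[of z] by metis
qed

lemma tri_reps_of_int:
  assumes "int n = x\<^sup>2 + y\<^sup>2 + triangular z"
  shows "\<exists>c. (nat \<bar>x\<bar>, nat \<bar>y\<bar>, c) \<in> tri_reps n"
proof -
  obtain c where c: "triangular z = triangular (int c)" using triangular_as_nat by blast
  define a b where "a = nat \<bar>x\<bar>" and "b = nat \<bar>y\<bar>"
  have "x\<^sup>2 = (int a)\<^sup>2" "y\<^sup>2 = (int b)\<^sup>2" by (simp_all add: a_def b_def)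
  then have "int n = int (a * a + b * b + (Suc c choose 2))"
    using assms c by (simp add: triangular_nat power2_eq_square)
  then have eq: "a * a + b * b + (Suc c choose 2) = n" by (simp only: of_nat_eq_iff)
  moreover have "a \<le> a * a" "b \<le> b * b" "c \<le> Suc c choose 2" by (simp_all add: numeral_2_eq_2)
  ultimately have "a \<le> n" "b \<le> n" "c \<le> n" by linarith+
  then show ?thesis using eq by (auto simp: tri_reps_def a_def b_def)
qed

lemma int_of_tri_reps:
  assumes "(a, b, c) \<in> tri_reps n"
  shows "int n = (int a)\<^sup>2 + (int b)\<^sup>2 + triangular (int c)"
  using assms by (auto simp: tri_reps_def triangular_nat power2_eq_square)

lemma square_square_triangular_parities:
  fixes n :: int
  assumes "n > 0" "\<nexists>m. n = triangular m" "n = x\<^sup>2 + y\<^sup>2 + triangular z"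
  shows "\<exists>x y z. n = x\<^sup>2 + y\<^sup>2 + triangular z \<and> odd (x + y)"
    and "\<exists>x y z. n = x\<^sup>2 + y\<^sup>2 + triangular z \<and> even (x + y)"
proof -
  define k where "k = nat n"
  have k: "n = int k" "k > 0" using assms(1) by (simp_all add: k_def)
  have nt: "Suc j choose 2 \<noteq> k" for j using assms(2) k triangular_nat[of j] by metis
  have ne: "tri_reps k \<noteq> {}" using tri_reps_of_int[of k x y z] assms(3) k by auto
  obtain a b c where "(a, b, c) \<in> tri_reps k" "odd (a + b)"
    using tri_reps_both_parities(1)[OF k(2) nt ne] by auto
  then show "\<exists>x y z. n = x\<^sup>2 + y\<^sup>2 + triangular z \<and> odd (x + y)"
    using int_of_tri_reps k(1) by (metis even_of_nat_iff of_nat_add)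
  obtain a b c where "(a, b, c) \<in> tri_reps k" "even (a + b)"
    using tri_reps_both_parities(2)[OF k(2) nt ne] by auto
  then show "\<exists>x y z. n = x\<^sup>2 + y\<^sup>2 + triangular z \<and> even (x + y)"
    using int_of_tri_reps k(1) by (metis even_of_nat_iff of_nat_add)
qed

lemma odd_triangular_rep:
  fixes m :: int
  assumes "m > 0" "odd m"
  shows "\<exists>x y z. triangular m = x\<^sup>2 + y\<^sup>2 + triangular z \<and> odd (x + y)"
proof -
  define k where "k = nat m"
  have k: "m = int k" "odd k" using assms by (auto simp: k_def even_nat_iff)
  obtain a b c where "(a, b, c) \<in> tri_reps (Suc k choose 2)" "odd (a + b)"
    using tri_reps_odd_triangular[OF k(2) refl] by auto
  then show ?thesis unfolding k(1) triangular_nat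
    using int_of_tri_reps by (metis even_of_nat_iff of_nat_add)
qed

section \<open>Mixed sums of squares and triangular numbers\<close>

lemma square_mod_four: "a\<^sup>2 mod 4 = (if even a then 0 else 1)" for a :: int
proof (cases "even a")
  case True
  then obtain b where "a = 2 * b" by blast
  then show ?thesis by (simp add: power2_eq_square)
next
  case False
  then obtain b where b: "a = 2 * b + 1" by (elim oddE)
  have "a\<^sup>2 = 4 * (b * b + b) + 1" by (simp add: b power2_eq_square algebra_simps)
  moreover have "(4 * x + 1) mod 4 = 1" for x :: int by presburger
  ultimately show ?thesis using False by metis
qed

text \<open>Modulo 4 exactly one of three squares with sum 4k + 1 is odd, and an odd square is 8 T_z
  + 1; the rest is divided by 4.\<close>

lemma two_squares_and_double_triangular:
  fixes k :: int
  assumes "k \<ge> 0"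
  shows "\<exists>x y z. k = x\<^sup>2 + y\<^sup>2 + 2 * triangular z"
proof -
  have shape: ?thesis if eq: "4 * k + 1 = a\<^sup>2 + b\<^sup>2 + c\<^sup>2" and "odd a" "even b" "even c" for a b c
  proof -
    obtain z where "a = 2 * z + 1" using \<open>odd a\<close> by (elim oddE)
    moreover obtain x where "b = 2 * x" using \<open>even b\<close> by (elim evenE)
    moreover obtain y where "c = 2 * y" using \<open>even c\<close> by (elim evenE)
    ultimately have "4 * k = 4 * (x\<^sup>2 + y\<^sup>2 + 2 * triangular z)"
      using eq triangular_eight[of z] by (simp add: power_mult_distrib)
    then have "k = x\<^sup>2 + y\<^sup>2 + 2 * triangular z"
      by (simp only: mult_cancel_left zero_neq_numeral[symmetric] simp_thms)
    then show ?thesis by blast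
  qed
  have mod: "(4 * k + 1) mod 4 = 1" by presburger
  have "4 * k + 1 > 0" using assms by simp
  from three_squares[OF this mod] obtain a b c where abc: "4 * k + 1 = a\<^sup>2 + b\<^sup>2 + c\<^sup>2"
    by (elim exE)
  have "(a\<^sup>2 mod 4 + b\<^sup>2 mod 4 + c\<^sup>2 mod 4) mod 4 = 1"
  proof -
    have "[a\<^sup>2 mod 4 + b\<^sup>2 mod 4 + c\<^sup>2 mod 4 = a\<^sup>2 + b\<^sup>2 + c\<^sup>2] (mod 4)"
      by (intro cong_add) (simp_all only: cong_def mod_mod_trivial)
    then show ?thesis using mod unfolding abc cong_def by (rule trans)
  qed
  then consider "odd a" "even b" "even c" | "even a" "odd b" "even c" | "even a" "even b" "odd c"
    unfolding square_mod_four by (auto split: if_splits)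
  then show ?thesis
  proof cases
    case 1
    then show ?thesis using shape abc by blast
  next
    case 2
    then show ?thesis using shape[of b a c] abc by (simp add: add.commute)
  next
    case 3
    then show ?thesis using shape[of c a b] abc by (simp add: add_ac)
  qed
qed

text \<open>In a representation of 2n by the previous lemma, x and y have equal parity, and passing
  to (x + y)/2 and (x - y)/2 halves the sum of their squares.\<close>

lemma two_squares_and_triangular:
  fixes n :: int
  assumes "n \<ge> 0"
  shows "\<exists>x y z. n = x\<^sup>2 + y\<^sup>2 + triangular z"
proof -
  obtain x y z where eq: "2 * n = x\<^sup>2 + y\<^sup>2 + 2 * triangular z"
    using two_squares_and_double_triangular[of "2 * n"] assms by auto
  have "even (2 * n - 2 * triangular z)" by simp
  then have "even (x\<^sup>2 + y\<^sup>2)" using eq by simp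
  then have "even (x + y)" by simp
  then obtain p where p: "x = 2 * p - y" by (metis add_diff_cancel_right' evenE)
  have "n = p\<^sup>2 + (p - y)\<^sup>2 + triangular z"
    using eq by (simp add: p power2_eq_square algebra_simps)
  then show ?thesis by blast
qed

text \<open>The aim is k = (2z + 1)^2 + (2x)^2 + 4(y^2 + 1) with y even, that is (k - 5)/4 = x^2 +
  y^2 + 2 T_z. If this number j is odd, one of x, y is even anyway. If j = 2i, Jacobi's balance
  yields two squares of equal parity for i, unless i is triangular and x = y = 0 will do.\<close>

lemma four_squares_mixed_parity:
  fixes k :: int
  assumes k: "k \<ge> 5" "k mod 4 = 1"
  shows "\<exists>s t u v. k = s\<^sup>2 + t\<^sup>2 + 4 * (u\<^sup>2 + v\<^sup>2) \<and> odd (s + t) \<and> odd (u + v)"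
proof -
  define j where "j = (k - 5) div 4"
  have j: "k = 4 * j + 5" "j \<ge> 0" using k unfolding j_def by presburger+
  have "\<exists>x y z. j = x\<^sup>2 + y\<^sup>2 + 2 * triangular z \<and> even y"
  proof (cases "even j")
    case False
    obtain x y z where xyz: "j = x\<^sup>2 + y\<^sup>2 + 2 * triangular z"
      using two_squares_and_double_triangular[OF j(2)] by blast
    then have "odd (x\<^sup>2 + y\<^sup>2)" using False by auto
    then consider "even y" | "even x" by auto
    then show ?thesis
    proof cases
      case 1
      then show ?thesis using xyz by blast
    next
      case 2
      then show ?thesis using xyz by (metis add.commute)
    qed
  next
    case True
    then obtain i where i: "j = 2 * i" by blast
    show ?thesis
    proof (cases "\<exists>m. i = triangular m")
      case True
      then obtain m where "i = triangular m" by blast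
      then have "j = 0\<^sup>2 + 0\<^sup>2 + 2 * triangular m \<and> even (0::int)" using i by simp
      then show ?thesis by blast
    next
      case False
      have "i \<noteq> triangular 0" using False by blast
      then have "i > 0" using i j by (simp add: triangular_def)
      obtain x y z where "i = x\<^sup>2 + y\<^sup>2 + triangular z"
        using two_squares_and_triangular[of i] \<open>i > 0\<close> by auto
      then obtain p q c where pq: "i = p\<^sup>2 + q\<^sup>2 + triangular c" "even (p + q)"
        using square_square_triangular_parities(2)[OF \<open>i > 0\<close> False] by blast
      then have "j = (p + q)\<^sup>2 + (p - q)\<^sup>2 + 2 * triangular c \<and> even (p - q)"
        using i by (simp add: power2_eq_square algebra_simps)
      then show ?thesis by blast
    qed
  qed
  then obtain x y z where xyz: "j = x\<^sup>2 + y\<^sup>2 + 2 * triangular z" "even y" by blast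
  have "k = (2 * z + 1)\<^sup>2 + (2 * x)\<^sup>2 + 4 * (y\<^sup>2 + 1\<^sup>2)"
    using j(1) xyz(1) triangular_eight[of z] by (simp add: power_mult_distrib)
  moreover have "odd (2 * z + 1 + 2 * x)" "odd (y + 1)" using xyz(2) by auto
  ultimately show ?thesis by blast
qed

text \<open>$(c + 4d)^2 = (c - 4d)^2 + 16cd$ with $c = s^2 + t^2$ and $d = u^2 + v^2$.\<close>

lemma square_odd_odd:
  fixes k :: int
  assumes "k \<ge> 5" "k mod 4 = 1"
  shows "\<exists>w x y. k\<^sup>2 = w\<^sup>2 + 8 * (x\<^sup>2 + y\<^sup>2) \<and> odd x \<and> odd y"
proof -
  obtain s t u v where eq: "k = s\<^sup>2 + t\<^sup>2 + 4 * (u\<^sup>2 + v\<^sup>2)" and odd: "odd (s + t)" "odd (u + v)"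
    using four_squares_mixed_parity[OF assms] by blast
  define x y where "x = (s * u + t * v) + (s * v - t * u)" and "y = (s * u + t * v) - (s * v - t * u)"
  have "k\<^sup>2 = (s\<^sup>2 + t\<^sup>2 - 4 * (u\<^sup>2 + v\<^sup>2))\<^sup>2 + 8 * (x\<^sup>2 + y\<^sup>2)"
    unfolding eq x_def y_def by (simp add: power2_eq_square algebra_simps)
  moreover have "odd x" "odd y" using odd unfolding x_def y_def by auto
  ultimately show ?thesis by blast
qed

lemma triangular_of_square:
  assumes "(2 * m + 1)\<^sup>2 = w\<^sup>2 + 8 * (x\<^sup>2 + y\<^sup>2)"
  shows "\<exists>z. triangular m = x\<^sup>2 + y\<^sup>2 + triangular z"
proof -
  have "odd ((2 * m + 1)\<^sup>2)" by simp
  then have "odd (w\<^sup>2)" unfolding assms by simp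
  then obtain z where "w = 2 * z + 1" by (auto elim: oddE)
  then show ?thesis using assms triangular_eight[of m] triangular_eight[of z] by (intro exI[of _ z]) simp
qed

text \<open>The cofactor l is odd, so scaling by it preserves the parities of x and y: a
  representation need only be constructed for a divisor of 2m + 1.\<close>

lemma triangular_rep_of_divisor:
  assumes "k dvd 2 * m + 1" "k\<^sup>2 = w\<^sup>2 + 8 * (x\<^sup>2 + y\<^sup>2)"
  shows "\<exists>l z. odd l \<and> triangular m = (l * x)\<^sup>2 + (l * y)\<^sup>2 + triangular z"
proof -
  obtain l where l: "2 * m + 1 = k * l" using assms(1) by (elim dvdE)
  have "odd (k * l)" unfolding l [symmetric] by simp
  then have "odd l" by simp
  have "(2 * m + 1)\<^sup>2 = k\<^sup>2 * l\<^sup>2" unfolding l by (rule power_mult_distrib)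
  also have "\<dots> = (l * w)\<^sup>2 + 8 * ((l * x)\<^sup>2 + (l * y)\<^sup>2)"
    unfolding assms(2) by (simp add: power2_eq_square algebra_simps)
  finally show ?thesis using triangular_of_square \<open>odd l\<close> by blast
qed

text \<open>Two factors that are 3 modulo 4 have a product that is 1 modulo 4, so any proper
  factorization of M \<equiv> 3 (mod 4) contains a factor of the wanted class.\<close>

lemma ex_divisor_one_mod_four:
  fixes M :: int
  assumes "M > 1" "odd M" "\<not> (prime M \<and> M mod 4 = 3)"
  shows "\<exists>k\<ge>5. k dvd M \<and> k mod 4 = 1"
proof -
  have five: "k \<ge> 5" if "k > 1" "k mod 4 = 1" for k :: int using that by presburger
  show ?thesis
  proof (cases "M mod 4 = 1")
    case True
    then show ?thesis using five[OF assms(1) True] by (intro exI[of _ M]) simp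
  next
    case False
    then have M3: "M mod 4 = 3" using assms(2) by presburger
    then have "\<not> prime M" using assms(3) by blast
    then obtain a where a: "a \<ge> 0" "a dvd M" "a \<noteq> 1" "a \<noteq> M" using assms(1) by (auto simp: prime_int_iff)
    then obtain b where b: "M = a * b" by (elim dvdE)
    have "a > 1" using a b assms(1) by (cases "a = 0") auto
    have "a * b > 0" using b assms(1) by simp
    then have "b > 0" using \<open>a > 1\<close> by (simp add: zero_less_mult_iff)
    moreover have "b \<noteq> 1" using a(4) b by auto
    ultimately have "b > 1" by simp
    have "a mod 4 = 1 \<or> b mod 4 = 1"
    proof (rule ccontr)
      assume no: "\<not> ?thesis"
      have "odd a" "odd b" using assms(2) b by auto
      have three: "c mod 4 = 3" if "odd c" "c mod 4 \<noteq> 1" for c :: int using that by presburger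
      have "a mod 4 = 3" "b mod 4 = 3" using three[of a] three[of b] \<open>odd a\<close> \<open>odd b\<close> no by blast+
      then have "(a * b) mod 4 = 1" using mod_mult_eq[of a 4 b] by simp
      then show False using M3 b by simp
    qed
    then show ?thesis
    proof
      assume "a mod 4 = 1"
      then show ?thesis using five[OF \<open>a > 1\<close>] a(2) by (intro exI[of _ a]) simp
    next
      assume "b mod 4 = 1"
      then show ?thesis using five[OF \<open>b > 1\<close>] b by (intro exI[of _ b]) simp
    qed
  qed
qed

section \<open>Obstructions modulo 4\<close>

lemma three_mod_four_dvd_sum_squares:
  fixes p :: int
  assumes p: "prime p" "p mod 4 = 3" and dvd: "p dvd x\<^sup>2 + y\<^sup>2"
  shows "p dvd x"
proof (rule ccontr)
  assume nx: "\<not> p dvd x"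
  define q where "q = nat p"
  have q: "p = int q" "prime q" using p(1) prime_ge_0_int[OF p(1)] by (auto simp: q_def)
  have q3: "q mod 4 = 3" using p(2) unfolding q(1) by presburger
  have q2: "q > 2" using q3 prime_ge_2_nat[OF q(2)] by (cases "q = 2") auto
  have "[x * x = -1 * (y * y)] (mod int q)" using dvd q(1) by (simp add: cong_iff_dvd_diff power2_eq_square)
  then have "Legendre (x * x) q = Legendre (-1 * (y * y)) q" by (rule Legendre_cong)
  then have "Legendre x q * Legendre x q = - (Legendre y q * Legendre y q)"
    using Legendre_minus_one[OF q(2) q2] q3 by (simp only: Legendre_mult[OF q(2) q2]) simp
  moreover have "Legendre x q \<noteq> 0" using nx q(1) by (simp add: Legendre_eq_0)
  ultimately show False by (smt (verit) mult_eq_0_iff zero_le_square)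
qed

lemma even_multiplicity_sum_squares:
  fixes p :: int
  assumes p: "prime p" "p mod 4 = 3" and "x\<^sup>2 + y\<^sup>2 \<noteq> 0"
  shows "even (multiplicity p (x\<^sup>2 + y\<^sup>2))"
  using assms(3)
proof (induction "nat (x\<^sup>2 + y\<^sup>2)" arbitrary: x y rule: less_induct)
  case less
  show ?case
  proof (cases "p dvd x\<^sup>2 + y\<^sup>2")
    case False
    then show ?thesis by (simp add: not_dvd_imp_multiplicity_0)
  next
    case True
    have "p dvd x" using three_mod_four_dvd_sum_squares[OF p True] .
    moreover have "p dvd y" using three_mod_four_dvd_sum_squares[OF p, of y x] True by (simp add: add.commute)
    ultimately obtain a b where ab: "x = p * a" "y = p * b" by (auto elim!: dvdE)
    have eq: "x\<^sup>2 + y\<^sup>2 = p\<^sup>2 * (a\<^sup>2 + b\<^sup>2)" by (simp add: ab power_mult_distrib algebra_simps)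
    have ne: "a\<^sup>2 + b\<^sup>2 \<noteq> 0" using less.prems eq by auto
    then have pos: "a\<^sup>2 + b\<^sup>2 > 0" by (metis add_nonneg_nonneg order_le_less zero_le_power2)
    have "1 < p\<^sup>2" using prime_gt_1_int[OF p(1)] by simp
    then have "1 * (a\<^sup>2 + b\<^sup>2) < p\<^sup>2 * (a\<^sup>2 + b\<^sup>2)" using pos by (intro mult_strict_right_mono)
    then have "a\<^sup>2 + b\<^sup>2 < x\<^sup>2 + y\<^sup>2" unfolding eq by simp
    then have "nat (a\<^sup>2 + b\<^sup>2) < nat (x\<^sup>2 + y\<^sup>2)" using pos by linarith
    then have IH: "even (multiplicity p (a\<^sup>2 + b\<^sup>2))" using ne by (rule less.hyps)
    have "multiplicity p (p\<^sup>2 * (a\<^sup>2 + b\<^sup>2)) = multiplicity p (p\<^sup>2) + multiplicity p (a\<^sup>2 + b\<^sup>2)"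
      using p(1) ne by (intro prime_elem_multiplicity_mult_distrib) auto
    also have "multiplicity p (p\<^sup>2) = 2" using p(1) by (intro multiplicity_same_power) auto
    finally show ?thesis unfolding eq using IH by simp
  qed
qed

lemma one_mod_four_of_multiplicities:
  fixes d :: int
  assumes d: "d > 0" "odd d"
    and ev: "\<And>p. prime p \<Longrightarrow> p dvd d \<Longrightarrow> p mod 4 = 3 \<Longrightarrow> even (multiplicity p d)"
  shows "d mod 4 = 1"
proof -
  have "[p ^ multiplicity p d = 1] (mod 4)" if p: "p \<in> prime_factors d" for p
  proof -
    have pp: "prime p" "p dvd d" using p by auto
    then have "odd p" using d(2) by auto
    then have "p mod 4 = 1 \<or> p mod 4 = 3" by presburger
    then consider "p mod 4 = 1" | "p mod 4 = 3" by blast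
    then show ?thesis
    proof cases
      case 1
      then have "[p = 1] (mod 4)" by (simp add: cong_def)
      then have "[p ^ multiplicity p d = 1 ^ multiplicity p d] (mod 4)" by (rule cong_pow)
      then show ?thesis by simp
    next
      case 2
      then obtain e where e: "multiplicity p d = 2 * e" using ev pp by blast
      have "[p\<^sup>2 = 1] (mod 4)" using square_mod_four[of p] \<open>odd p\<close> by (simp add: cong_def)
      then have "[(p\<^sup>2) ^ e = 1 ^ e] (mod 4)" by (rule cong_pow)
      then show ?thesis by (simp add: e power_mult)
    qed
  qed
  then have "[(\<Prod>p\<in>prime_factors d. p ^ multiplicity p d) = (\<Prod>p\<in>prime_factors d. 1)] (mod 4)"
    by (rule cong_prod)
  moreover have "d = (\<Prod>p\<in>prime_factors d. p ^ multiplicity p d)" using d(1) by (rule prime_factorization_int)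
  ultimately show ?thesis by (simp add: cong_def)
qed

text \<open>A prime p \<equiv> 3 (mod 4) has even exponent in a sum of two squares. If it divides d,
  then e contributes nothing to that exponent and g^2 an even amount, so the exponent in d is
  even.\<close>

lemma coprime_factor_of_sum_squares:
  fixes d e g :: int
  assumes d: "d > 0" "odd d" and "e \<noteq> 0" "g \<noteq> 0" "coprime d e" and eq: "g\<^sup>2 * (d * e) = x\<^sup>2 + y\<^sup>2"
  shows "d mod 4 = 1"
proof (rule one_mod_four_of_multiplicities[OF d])
  fix p :: int assume p: "prime p" "p dvd d" "p mod 4 = 3"
  have "\<not> p dvd e" using p assms(5) by (meson coprime_common_divisor not_prime_unit)
  then have e0: "multiplicity p e = 0" by (simp add: not_dvd_imp_multiplicity_0)
  have "x\<^sup>2 + y\<^sup>2 \<noteq> 0" using eq assms by auto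
  then have "even (multiplicity p (g\<^sup>2 * (d * e)))" unfolding eq by (rule even_multiplicity_sum_squares[OF p(1,3)])
  also have "multiplicity p (g\<^sup>2 * (d * e)) = multiplicity p (g\<^sup>2) + multiplicity p (d * e)"
    using p(1) d(1) assms(3,4) by (intro prime_elem_multiplicity_mult_distrib) auto
  also have "multiplicity p (d * e) = multiplicity p d + multiplicity p e"
    using p(1) d(1) assms(3) by (intro prime_elem_multiplicity_mult_distrib) auto
  also have "multiplicity p (g\<^sup>2) = 2 * multiplicity p g"
    using p(1) assms(4) by (intro prime_elem_multiplicity_power_distrib) auto
  finally show "even (multiplicity p d)" using e0 by simp
qed

text \<open>$a$ and $b$ are $(M - w)/2$ and $(M + w)/2$ in some order, divided by their gcd.\<close>

lemma square_factorization:
  fixes M w :: int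
  assumes M: "M > 0" "odd M" and eq: "M\<^sup>2 = w\<^sup>2 + 8 * (x\<^sup>2 + y\<^sup>2)" and pos: "x\<^sup>2 + y\<^sup>2 > 0"
  shows "\<exists>g a b. g > 0 \<and> a > 0 \<and> b > 0 \<and> coprime a b \<and> odd a \<and> M = g * (a + b) \<and> g\<^sup>2 * (a * b) = 2 * (x\<^sup>2 + y\<^sup>2)"
proof -
  have "odd (M\<^sup>2)" using M by simp
  then have "odd (w\<^sup>2)" unfolding eq by simp
  then have "even (M - w)" using M by simp
  then obtain \<alpha> where \<alpha>: "M - w = 2 * \<alpha>" by blast
  define \<beta> where "\<beta> = M - \<alpha>"
  have w: "w = \<beta> - \<alpha>" using \<alpha> by (simp add: \<beta>_def)
  have "4 * (\<alpha> * \<beta>) = 8 * (x\<^sup>2 + y\<^sup>2)" using eq unfolding w \<beta>_def by (simp add: power2_eq_square algebra_simps)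
  then have prod: "\<alpha> * \<beta> = 2 * (x\<^sup>2 + y\<^sup>2)" by simp
  have sum: "\<alpha> + \<beta> = M" by (simp add: \<beta>_def)
  have "\<alpha> * \<beta> > 0" using prod pos by simp
  then have ab: "\<alpha> > 0" "\<beta> > 0" using sum M(1) by (auto simp: zero_less_mult_iff)
  define g where "g = gcd \<alpha> \<beta>"
  have g: "g > 0" using ab by (simp add: g_def)
  obtain a b where ab': "\<alpha> = a * g" "\<beta> = b * g" "coprime a b"
    using gcd_coprime_exists[of \<alpha> \<beta>] g unfolding g_def by auto
  have "a > 0" "b > 0" using ab ab' g by (auto simp: zero_less_mult_iff)
  have Mg: "M = g * (a + b)" using sum ab' by (simp add: algebra_simps)
  have gab: "g\<^sup>2 * (a * b) = 2 * (x\<^sup>2 + y\<^sup>2)" using prod ab' by (simp add: power2_eq_square algebra_simps)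
  have "odd (a + b)" using Mg M(2) by auto
  then consider "odd a" | "odd b" by auto
  then show ?thesis
  proof cases
    case 1
    then show ?thesis using g \<open>a > 0\<close> \<open>b > 0\<close> ab'(3) Mg gab by blast
  next
    case 2
    then show ?thesis using g \<open>a > 0\<close> \<open>b > 0\<close> ab'(3) Mg gab
      by (intro exI[of _ g] exI[of _ b] exI[of _ a]) (auto simp: coprime_commute algebra_simps)
  qed
qed

lemma double_sum_squares: "2 * (x\<^sup>2 + y\<^sup>2) = (x + y)\<^sup>2 + (x - y)\<^sup>2" for x y :: int
  by (simp add: power2_eq_square algebra_simps)

text \<open>As M is prime and a + b \<ge> 2, the common factor g is 1. Oddness of x and y gives 4 |
  a b, hence 4 | b, while a \<equiv> 1 (mod 4) because g^2 a b is a sum of two squares; so M = a + b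
  would be 1 modulo 4.\<close>

lemma no_odd_odd_rep:
  fixes M w :: int
  assumes M: "prime M" "M mod 4 = 3" and eq: "M\<^sup>2 = w\<^sup>2 + 8 * (x\<^sup>2 + y\<^sup>2)" and xy: "odd x" "odd y"
  shows False
proof -
  have M0: "M > 0" using M(1) by (rule prime_gt_0_int)
  have "odd M" using M(2) by presburger
  have "x \<noteq> 0" using xy by auto
  then have "x\<^sup>2 + y\<^sup>2 > 0" by (simp add: sum_power2_gt_zero_iff)
  then obtain g a b where g: "g > 0" "a > 0" "b > 0" "coprime a b" "odd a" "M = g * (a + b)"
      "g\<^sup>2 * (a * b) = 2 * (x\<^sup>2 + y\<^sup>2)"
    using square_factorization[OF M0 \<open>odd M\<close> eq] by blast
  have "g dvd M" unfolding g(6) by (rule dvd_triv_left)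
  then have "g = 1 \<or> g = M" using M(1) g(1) unfolding prime_int_iff by auto
  moreover have "g * 2 \<le> M" unfolding g(6) using g(1-3) by (intro mult_left_mono) auto
  ultimately have "g = 1" using g(1) by linarith
  have "a mod 4 = 1"
    using coprime_factor_of_sum_squares[of a b g "x + y" "x - y"] g double_sum_squares[of x y] by simp
  have "4 dvd 2 * (x\<^sup>2 + y\<^sup>2)"
  proof -
    have "even (x\<^sup>2 + y\<^sup>2)" using xy by simp
    then obtain c where "x\<^sup>2 + y\<^sup>2 = 2 * c" by blast
    then show ?thesis by simp
  qed
  then have "4 dvd a * b" using g(7) \<open>g = 1\<close> by simp
  moreover have "coprime 4 a"
  proof -
    have "coprime ((2::int) ^ 2) a" using \<open>odd a\<close> by (simp only: coprime_power_left_iff coprime_left_2_iff_odd simp_thms)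
    moreover have "(2::int) ^ 2 = 4" by simp
    ultimately show ?thesis by metis
  qed
  ultimately have "4 dvd b" by (simp add: coprime_dvd_mult_right_iff)
  then have "M mod 4 = 1" using g(6) \<open>g = 1\<close> \<open>a mod 4 = 1\<close> by (auto simp: mod_add_eq elim!: dvdE)
  then show False using M(2) by simp
qed

text \<open>Now x^2 + y^2 is odd, so b = 2c with c odd. Both a and c are coprime to their cofactors
  and hence 1 modulo 4, so a + b \<equiv> 3 (mod 4); but a + b divides M, which has no prime divisor
  of that class.\<close>

lemma no_odd_sum_rep:
  fixes M w :: int
  assumes M: "M > 0" "odd M" and primes: "\<And>p. prime p \<Longrightarrow> p dvd M \<Longrightarrow> p mod 4 \<noteq> 3"
    and eq: "M\<^sup>2 = w\<^sup>2 + 8 * (x\<^sup>2 + y\<^sup>2)" and xy: "odd (x + y)"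
  shows False
proof -
  have "x \<noteq> 0 \<or> y \<noteq> 0" using xy by auto
  then have "x\<^sup>2 + y\<^sup>2 > 0" by (simp add: sum_power2_gt_zero_iff)
  then obtain g a b where g: "g > 0" "a > 0" "b > 0" "coprime a b" "odd a" "M = g * (a + b)"
      "g\<^sup>2 * (a * b) = 2 * (x\<^sup>2 + y\<^sup>2)"
    using square_factorization[OF M eq] by blast
  have "odd g" "odd (a + b)" using M(2) g(6) by auto
  then have "even b" using g(5) by simp
  then obtain c where c: "b = 2 * c" by blast
  have "2 * (g\<^sup>2 * (a * c)) = 2 * (x\<^sup>2 + y\<^sup>2)" using g(7) c by simp
  then have "g\<^sup>2 * (a * c) = x\<^sup>2 + y\<^sup>2" by simp
  moreover have "odd (x\<^sup>2 + y\<^sup>2)" using xy by simp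
  ultimately have "odd c" by (metis even_mult_iff)
  have "a mod 4 = 1"
    using coprime_factor_of_sum_squares[of a b g "x + y" "x - y"] g double_sum_squares[of x y] by simp
  have "coprime c (2 * a)" using g(4) c \<open>odd c\<close> by (simp add: coprime_commute)
  moreover have "g\<^sup>2 * (c * (2 * a)) = (x + y)\<^sup>2 + (x - y)\<^sup>2"
    using g(7) c double_sum_squares[of x y] by (simp add: mult_ac)
  ultimately have "c mod 4 = 1"
    using coprime_factor_of_sum_squares[of c "2 * a" g "x + y" "x - y"] g c \<open>odd c\<close> by simp
  then have "(a + b) mod 4 = 3" using \<open>a mod 4 = 1\<close> c by presburger
  moreover have "(a + b) mod 4 = 1"
  proof (rule one_mod_four_of_multiplicities)
    show "even (multiplicity p (a + b))" if "prime p" "p dvd a + b" "p mod 4 = 3" for p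
      using primes[of p] that g(6) by simp
  qed (use g \<open>odd (a + b)\<close> in auto)
  ultimately show False by simp
qed

text \<open>Links two shapes: for the same x, the forms x^2 + T_y + T_z and x^2 + d^2 + 2 T_c
  represent the same numbers.\<close>

lemma square_and_double_triangular:
  "triangular (c + d) + triangular (c - d) = d\<^sup>2 + 2 * triangular c"
  using two_triangular[of "c + d"] two_triangular[of "c - d"] two_triangular[of c]
  by (simp add: power2_eq_square algebra_simps)

lemma sum_of_triangulars:
  assumes "even (y + z)"
  shows "\<exists>c d. triangular y + triangular z = d\<^sup>2 + 2 * triangular c"
proof -
  obtain c where c: "y = 2 * c - z" using assms by (metis add_diff_cancel_right' evenE)
  define d where "d = c - z"
  have "y = c + d" "z = c - d" by (simp_all add: c d_def)
  then show ?thesis using square_and_double_triangular[of c d] by metis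
qed

lemma positive_index:
  assumes "triangular z > 0"
  shows "\<exists>m>0. triangular z = triangular m"
proof -
  obtain k where k: "triangular z = triangular (int k)" using triangular_as_nat by blast
  then have "k > 0" using assms by (auto simp: triangular_def intro!: Nat.gr0I)
  then show ?thesis using k by (intro exI[of _ "int k"]) simp
qed

lemma triangular_odd_odd_iff:
  assumes "m > 0"
  shows "(\<exists>x y z. odd x \<and> odd y \<and> triangular m = x\<^sup>2 + y\<^sup>2 + triangular z)
    \<longleftrightarrow> \<not> (prime (2 * m + 1) \<and> (2 * m + 1) mod 4 = 3)"
proof
  assume "\<exists>x y z. odd x \<and> odd y \<and> triangular m = x\<^sup>2 + y\<^sup>2 + triangular z"
  then obtain x y z where xyz: "odd x" "odd y" "triangular m = x\<^sup>2 + y\<^sup>2 + triangular z" by blast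
  then have "(2 * m + 1)\<^sup>2 = (2 * z + 1)\<^sup>2 + 8 * (x\<^sup>2 + y\<^sup>2)"
    using triangular_eight[of m] triangular_eight[of z] by simp
  then show "\<not> (prime (2 * m + 1) \<and> (2 * m + 1) mod 4 = 3)" using no_odd_odd_rep xyz by blast
next
  assume "\<not> (prime (2 * m + 1) \<and> (2 * m + 1) mod 4 = 3)"
  then obtain k where k: "k \<ge> 5" "k dvd 2 * m + 1" "k mod 4 = 1"
    using ex_divisor_one_mod_four[of "2 * m + 1"] assms by auto
  obtain w x y where wxy: "k\<^sup>2 = w\<^sup>2 + 8 * (x\<^sup>2 + y\<^sup>2)" "odd x" "odd y" using square_odd_odd[OF k(1,3)] by blast
  obtain l z where "odd l" "triangular m = (l * x)\<^sup>2 + (l * y)\<^sup>2 + triangular z"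
    using triangular_rep_of_divisor[OF k(2) wxy(1)] by blast
  moreover have "odd (l * x)" "odd (l * y)" using \<open>odd l\<close> wxy by auto
  ultimately show "\<exists>x y z. odd x \<and> odd y \<and> triangular m = x\<^sup>2 + y\<^sup>2 + triangular z" by blast
qed

text \<open>Jacobi's balance settles nontriangular n, and the negative sign in Jacobi's identity
  settles T_m for odd m. For even m, 2m + 1 is 1 modulo 4, so the prime obstruction is absent and
  even two odd squares are available.\<close>

lemma square_odd_square_triangular:
  fixes n :: int
  assumes "n > 0"
  shows "\<exists>x y z. odd y \<and> n = x\<^sup>2 + y\<^sup>2 + triangular z"
proof -
  have from_sum: ?thesis if rep: "n = x\<^sup>2 + y\<^sup>2 + triangular z" and "odd (x + y)" for x y z
  proof (cases "odd y")
    case True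
    then show ?thesis using rep by blast
  next
    case False
    then have "odd x" using that by simp
    moreover have "n = y\<^sup>2 + x\<^sup>2 + triangular z" using rep by simp
    ultimately show ?thesis by blast
  qed
  show ?thesis
  proof (cases "\<exists>m. n = triangular m")
    case False
    obtain x y z where "n = x\<^sup>2 + y\<^sup>2 + triangular z"
      using two_squares_and_triangular[of n] assms by auto
    then show ?thesis using square_square_triangular_parities(1)[OF assms False] from_sum by blast
  next
    case True
    then obtain m where m: "m > 0" "n = triangular m" using positive_index assms by metis
    show ?thesis
    proof (cases "odd m")
      case True
      then show ?thesis using odd_triangular_rep[OF m(1)] m(2) from_sum by blast
    next
      case False
      then have "(2 * m + 1) mod 4 \<noteq> 3" by presburger
      then show ?thesis using triangular_odd_odd_iff[OF m(1)] m(2) by blast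
    qed
  qed
qed

text \<open>Since 2(a^2 + b^2) = (a + b)^2 + (a - b)^2, for n = 2k the question is whether k = a^2 +
  b^2 + T_c with a + b odd.\<close>

lemma not_odd_square_two_triangulars_iff:
  fixes n :: int
  assumes n: "n > 0"
  shows "(\<not> (\<exists>x y z. odd x \<and> n = x\<^sup>2 + triangular y + triangular z))
    \<longleftrightarrow> (\<exists>m>0. n = 2 * triangular m \<and> \<not> (\<exists>p. prime p \<and> p dvd 2 * m + 1 \<and> p mod 4 = 3))"
    (is "\<not> ?rep \<longleftrightarrow> ?exc")
proof
  assume no: "\<not> ?rep"
  have rep1: False if "n = x\<^sup>2 + d\<^sup>2 + 2 * triangular c" "odd x" for x d c
    using no that square_and_double_triangular[of c d] by (metis add.assoc)
  have rep2: False if ab: "n = 2 * (a\<^sup>2 + b\<^sup>2 + triangular c)" "odd (a + b)" for a b c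
  proof -
    have "n = (a + b)\<^sup>2 + (a - b)\<^sup>2 + 2 * triangular c"
      using ab(1) double_sum_squares[of a b] by simp
    then show False using rep1 ab(2) by blast
  qed
  have "even n"
  proof (rule ccontr)
    assume "odd n"
    obtain x y z where xyz: "n = x\<^sup>2 + y\<^sup>2 + 2 * triangular z"
      using two_squares_and_double_triangular[of n] n by auto
    then have "odd (x\<^sup>2 + y\<^sup>2)" using \<open>odd n\<close> by auto
    then consider "odd x" | "odd y" by auto
    then show False
    proof cases
      case 1
      then show False using rep1 xyz by blast
    next
      case 2
      moreover have "n = y\<^sup>2 + x\<^sup>2 + 2 * triangular z" using xyz by simp
      ultimately show False using rep1 by blast
    qed
  qed
  then obtain k where k: "n = 2 * k" by blast
  have "k > 0" using n k by simp
  have "\<exists>m. k = triangular m"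
  proof (rule ccontr)
    assume nt: "\<not> ?thesis"
    obtain x y z where xyz: "k = x\<^sup>2 + y\<^sup>2 + triangular z"
      using two_squares_and_triangular[of k] \<open>k > 0\<close> by auto
    obtain a b c where "k = a\<^sup>2 + b\<^sup>2 + triangular c" "odd (a + b)"
      using square_square_triangular_parities(1)[OF \<open>k > 0\<close> nt xyz] by blast
    then show False using rep2[of a b c] k by simp
  qed
  then obtain m where m: "m > 0" "k = triangular m" using positive_index \<open>k > 0\<close> by metis
  have "\<not> (\<exists>p. prime p \<and> p dvd 2 * m + 1 \<and> p mod 4 = 3)"
  proof
    assume "\<exists>p. prime p \<and> p dvd 2 * m + 1 \<and> p mod 4 = 3"
    then obtain p where p: "prime p" "p dvd 2 * m + 1" "p mod 4 = 3" by blast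
    \<comment> \<open>From p \<equiv> 3 (mod 4) it follows that r is odd, so Jacobi's identity
      represents T_r with x + y odd; this is scaled up from p to 2m + 1.\<close>
    define r where "r = p div 2"
    have r: "p = 2 * r + 1" "odd r" using p(3) unfolding r_def by presburger+
    have "r > 0" using r prime_gt_1_int[OF p(1)] by simp
    obtain x y z where xyz: "triangular r = x\<^sup>2 + y\<^sup>2 + triangular z" "odd (x + y)"
      using odd_triangular_rep[OF \<open>r > 0\<close> r(2)] by blast
    then have "p\<^sup>2 = (2 * z + 1)\<^sup>2 + 8 * (x\<^sup>2 + y\<^sup>2)"
      using triangular_eight[of r] triangular_eight[of z] r(1) by simp
    then obtain l c where l: "odd l" "triangular m = (l * x)\<^sup>2 + (l * y)\<^sup>2 + triangular c"
      using triangular_rep_of_divisor[OF p(2)] by blast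
    have "odd (l * x + l * y)" using l(1) xyz(2) by simp
    then show False using rep2[of "l * x" "l * y" c] l(2) k m(2) by simp
  qed
  then show ?exc using m k by blast
next
  assume ?exc
  then obtain m where m: "m > 0" "n = 2 * triangular m" "\<not> (\<exists>p. prime p \<and> p dvd 2 * m + 1 \<and> p mod 4 = 3)" by blast
  show "\<not> ?rep"
  proof
    assume ?rep
    then obtain x y z where xyz: "odd x" "n = x\<^sup>2 + triangular y + triangular z" by blast
    \<comment> \<open>Replacing z by -1 - z where necessary gives both indices the same parity, as
      \<open>sum_of_triangulars\<close> requires.\<close>
    obtain z' where "triangular z' = triangular z" "even (y + z')"
    proof (cases "even (y + z)")
      case False
      then have "even (y + (- 1 - z))" by presburger
      then show ?thesis using that triangular_reflect by blast
    qed (use that in blast)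
    then obtain c d where "triangular y + triangular z = d\<^sup>2 + 2 * triangular c"
      using sum_of_triangulars by metis
    then have eq: "2 * triangular m = x\<^sup>2 + d\<^sup>2 + 2 * triangular c" using m(2) xyz(2) by simp
    have "even (2 * triangular m - 2 * triangular c)" by simp
    then have "even (x\<^sup>2 + d\<^sup>2)" using eq by simp
    then have "even (x + d)" by simp
    then obtain a where a: "d = 2 * a - x" by (metis add_diff_cancel_left' evenE)
    have "triangular m = a\<^sup>2 + (x - a)\<^sup>2 + triangular c"
      using eq by (simp add: a power2_eq_square algebra_simps)
    then have "(2 * m + 1)\<^sup>2 = (2 * c + 1)\<^sup>2 + 8 * (a\<^sup>2 + (x - a)\<^sup>2)"
      using triangular_eight[of m] triangular_eight[of c] by simp
    moreover have "odd (a + (x - a))" using xyz(1) by simp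
    ultimately show False using no_odd_sum_rep[of "2 * m + 1"] m by fastforce
  qed
qed

theorem theorem1p1:
  shows "(\<forall>n::int. n > 0 \<longrightarrow>
            (\<exists>x y z::int. odd y \<and> n = x\<^sup>2 + y\<^sup>2 + triangular z))
       \<and> (\<forall>m::int. m > 0 \<longrightarrow>
            ((\<exists>x y z::int. odd x \<and> odd y \<and> triangular m = x\<^sup>2 + y\<^sup>2 + triangular z)
              \<longleftrightarrow> \<not> (prime (2 * m + 1) \<and> [2 * m + 1 = 3] (mod 4))))
       \<and> (\<forall>n::int. n > 0 \<longrightarrow>
            ((\<not> (\<exists>x y z::int. odd x \<and> n = x\<^sup>2 + triangular y + triangular z))
              \<longleftrightarrow> (\<exists>m::int. m > 0 \<and> n = 2 * triangular m \<and>
                    \<not> (\<exists>p::int. prime p \<and> p dvd 2 * m + 1 \<and> [p = 3] (mod 4)))))"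
proof -
  have cong: "[p = 3] (mod 4) \<longleftrightarrow> p mod 4 = 3" for p :: int by (simp add: cong_def)
  show ?thesis unfolding cong
    using square_odd_square_triangular triangular_odd_odd_iff not_odd_square_two_triangulars_iff by blast
qed

end
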